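(* Let $G=(V,E)$ be a point-line graph and $A\subseteq E$. Then the rank $r_{\rm PL}(A)$ of $A$ in the generic 2-dimensional point-line rigidity matroid $\mathcal{M}_{\rm PL}(G)$ is $$r_{\rm PL}(A)=\nu_L(A)+\min_{\mathcal{F}}\left\{\sum_{A_i\in\mathcal{F}}(2\nu_P(A_i)+\nu_L(A_i)-2)-c_L(\mathcal{F})\right\}$$ where the minimum is taken over all partitions $\mathcal{F}$ of $A$ (into nonempty sets).
   Context: A point-line graph is a finite simple graph $G=(V,E)$ (no loops, no parallel edges) together with an ordered pair $(V_P,V_L)$ of (possibly empty) disjoint sets with $V=V_P\cup V_L$. Vertices in $V_P=\{u_1,\dots,u_s\}$ are point-vertices, vertices in $V_L=\{v_1,\dots,v_t\}$ are line-vertices. $E_{PP},E_{PL},E_{LL}$ are the sets of edges joining two point-vertices, a point-vertex and a line-vertex, and two line-vertices, respectively. Rigidity matroid. A point-line framework is a pair $(G,p)$ with $p:V\to\mathbb{R}^2$; write $p(u_i)=(x_i,y_i)$ for $u_i\in V_P$ and $p(v_i)=(a_i,b_i)$ for $v_i\in V_L$. The rigidity matrix $R(G,p)$ is the $|E|\times 2|V|$ real matrix with rows indexed by $E$, two columns $u_{i,x},u_{i,y}$ for each $u_i\in V_P$ and two columns $v_{i,a},v_{i,b}$ for each $v_i\in V_L$, with the following entries (zeros elsewhere): - row $u_ju_k\in E_{PP}$: $x_j-x_k,\ y_j-y_k,\ x_k-x_j,\ y_k-y_j$ in columns $u_{j,x},u_{j,y},u_{k,x},u_{k,y}$; - row $u_jv_k\in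 E_{PL}$: $1,\ -a_k,\ -x_ja_k-y_j,\ -1$ in columns $u_{j,x},u_{j,y},v_{k,a},v_{k,b}$; - row $v_jv_k\in E_{LL}$ with $j<k$: $1,\ -1$ in columns $v_{j,a},v_{k,a}$. $(G,p)$ is generic if the coordinates $x_i,y_i,a_j$ ($u_i\in V_P$, $v_j\in V_L$) are algebraically independent over $\mathbb{Q}$. $\mathcal{M}_{\rm PL}(G)$ is the matroid on $E$ in which $S\subseteq E$ is independent iff the rows of $R(G,p)$ indexed by $S$ are linearly independent for a generic $(G,p)$; it is the same for all generic $(G,p)$. For $A\subseteq E$, $\nu_P(A)$ and $\nu_L(A)$ are the numbers of point-vertices and line-vertices, respectively, incident to edges in $A$, and $V_L(A)$ is the set of line-vertices incident to edges in $A$. For a partition $\mathcal{F}$ of $A$, $c_L(\mathcal{F})$ is the number of connected components of the graph with vertex set $\mathcal{F}$ in which two distinct members $A_i,A_j$ are adjacent iff $V_L(A_i)\cap V_L(A_j)\ne\emptyset$. *)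

theory Defs
  imports Complex_Main "HOL-Library.Disjoint_Sets" "HOL-Library.Poly_Mapping"
begin

section \<open>Point-line graphs\<close>

text \<open>The field \<open>line_index\<close> is the numbering \<open>v\<^sub>1, \<dots>, v\<^sub>t\<close> of the line-vertices. Its only role is
  to fix the sign of the rows of the rigidity matrix that belong to line-line edges.\<close>

record 'v point_line_graph =
  points :: "'v set"
  lines :: "'v set"
  line_index :: "'v \<Rightarrow> nat"
  edges :: "'v set set"

definition is_point_line_graph :: "'v point_line_graph \<Rightarrow> bool" where
  "is_point_line_graph G \<longleftrightarrow>
     finite (points G) \<and> finite (lines G) \<and> points G \<inter> lines G = {} \<and>
     bij_betw (line_index G) (lines G) {1..card (lines G)} \<and>
     (\<forall>e\<in>edges G. e \<subseteq> points G \<union> lines G \<and> card e = 2)"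

definition points_of :: "'v point_line_graph \<Rightarrow> 'v set set \<Rightarrow> 'v set" where
  "points_of G A = {u \<in> points G. \<exists>e\<in>A. u \<in> e}"

definition lines_of :: "'v point_line_graph \<Rightarrow> 'v set set \<Rightarrow> 'v set" where
  "lines_of G A = {v \<in> lines G. \<exists>e\<in>A. v \<in> e}"

definition nu_P :: "'v point_line_graph \<Rightarrow> 'v set set \<Rightarrow> nat" where
  "nu_P G A = card (points_of G A)"

definition nu_L :: "'v point_line_graph \<Rightarrow> 'v set set \<Rightarrow> nat" where
  "nu_L G A = card (lines_of G A)"

section \<open>The rigidity matrix\<close>

text \<open>A framework is \<open>(G, p)\<close> with \<open>p :: 'v \<Rightarrow> real \<times> real\<close>; \<open>p u = (x, y)\<close> for a point-vertex \<open>u\<close>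
  and \<open>p v = (a, b)\<close> for a line-vertex \<open>v\<close>. The constructors below name both the columns of the
  rigidity matrix and the coordinates of a framework.\<close>

datatype 'v coordinate = X 'v | Y 'v | A 'v | B 'v

fun coord :: "('v \<Rightarrow> real \<times> real) \<Rightarrow> 'v coordinate \<Rightarrow> real" where
  "coord p (X u) = fst (p u)"
| "coord p (Y u) = snd (p u)"
| "coord p (A v) = fst (p v)"
| "coord p (B v) = snd (p v)"

definition columns :: "'v point_line_graph \<Rightarrow> 'v coordinate set" where
  "columns G = X ` points G \<union> Y ` points G \<union> A ` lines G \<union> B ` lines G"

definition other_end :: "'v set \<Rightarrow> 'v \<Rightarrow> 'v" where
  "other_end e u = the_elem (e - {u})"

fun rigidity_matrix ::
  "'v point_line_graph \<Rightarrow> ('v \<Rightarrow> real \<times> real) \<Rightarrow> 'v set \<Rightarrow> 'v coordinate \<Rightarrow> real" where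
  "rigidity_matrix G p e (X u) =
     (if u \<in> e \<and> u \<in> points G then
        (let w = other_end e u in
           if w \<in> points G then coord p (X u) - coord p (X w) else 1)
      else 0)"
| "rigidity_matrix G p e (Y u) =
     (if u \<in> e \<and> u \<in> points G then
        (let w = other_end e u in
           if w \<in> points G then coord p (Y u) - coord p (Y w) else - coord p (A w))
      else 0)"
| "rigidity_matrix G p e (A v) =
     (if v \<in> e \<and> v \<in> lines G then
        (let w = other_end e v in
           if w \<in> points G then - coord p (X w) * coord p (A v) - coord p (Y w)
           else if line_index G v < line_index G w then 1 else - 1)
      else 0)"
| "rigidity_matrix G p e (B v) =
     (if v \<in> e \<and> v \<in> lines G then
        (let w = other_end e v in if w \<in> points G then - 1 else 0)
      else 0)"

text \<open>Independence of the rows as a family: equal rows of distinct edges are dependent.\<close>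

definition rows_independent ::
  "'v point_line_graph \<Rightarrow> ('v \<Rightarrow> real \<times> real) \<Rightarrow> 'v set set \<Rightarrow> bool" where
  "rows_independent G p S \<longleftrightarrow>
     (\<forall>c :: 'v set \<Rightarrow> real.
        (\<forall>j\<in>columns G. (\<Sum>e\<in>S. c e * rigidity_matrix G p e j) = 0) \<longrightarrow> (\<forall>e\<in>S. c e = 0))"

section \<open>Genericity\<close>

text \<open>A polynomial over the rationals in indeterminates of type \<open>'i\<close> is a finitely supported map
  from monomials (exponent vectors, type \<open>'i \<Rightarrow>\<^sub>0 nat\<close>) to coefficients.\<close>

definition eval_poly ::
  "('i \<Rightarrow> real) \<Rightarrow> (('i \<Rightarrow>\<^sub>0 nat) \<Rightarrow>\<^sub>0 rat) \<Rightarrow> real" where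
  "eval_poly z q =
     (\<Sum>m\<in>Poly_Mapping.keys q.
        of_rat (Poly_Mapping.lookup q m) *
        (\<Prod>i\<in>Poly_Mapping.keys m. z i ^ Poly_Mapping.lookup m i))"

definition algebraically_independent :: "'i set \<Rightarrow> ('i \<Rightarrow> real) \<Rightarrow> bool" where
  "algebraically_independent I z \<longleftrightarrow>
     (\<forall>q. (\<forall>m\<in>Poly_Mapping.keys q. Poly_Mapping.keys m \<subseteq> I) \<and> eval_poly z q = 0 \<longrightarrow> q = 0)"

text \<open>The coordinates \<open>b\<close> of the line-vertices are unconstrained; they do not occur in the
  rigidity matrix.\<close>

definition generic :: "'v point_line_graph \<Rightarrow> ('v \<Rightarrow> real \<times> real) \<Rightarrow> bool" where
  "generic G p \<longleftrightarrow>
     algebraically_independent (X ` points G \<union> Y ` points G \<union> A ` lines G) (coord p)"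

section \<open>The rigidity matroid and its rank function\<close>

text \<open>Whether the rows of \<open>S\<close> are independent is the same for all generic \<open>p\<close>.\<close>

definition PL_independent :: "'v point_line_graph \<Rightarrow> 'v set set \<Rightarrow> bool" where
  "PL_independent G S \<longleftrightarrow> S \<subseteq> edges G \<and> (\<exists>p. generic G p \<and> rows_independent G p S)"

definition PL_rank :: "'v point_line_graph \<Rightarrow> 'v set set \<Rightarrow> nat" where
  "PL_rank G F = Max (card ` {S. S \<subseteq> F \<and> PL_independent G S})"

section \<open>Components of a partition\<close>

definition line_adjacent :: "'v point_line_graph \<Rightarrow> 'v set set set \<Rightarrow> 'v set set rel" where
  "line_adjacent G \<F> =
     {(C, D). C \<in> \<F> \<and> D \<in> \<F> \<and> C \<noteq> D \<and> lines_of G C \<inter> lines_of G D \<noteq> {}}"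

text \<open>The intersection with \<open>\<F> \<times> \<F>\<close> makes the reflexive-transitive closure an equivalence
  relation on \<open>\<F>\<close>; its classes are the connected components.\<close>

definition c_L :: "'v point_line_graph \<Rightarrow> 'v set set set \<Rightarrow> nat" where
  "c_L G \<F> = card (\<F> // ((line_adjacent G \<F>)\<^sup>* \<inter> \<F> \<times> \<F>))"

end

theory Submission
  imports Defs "HOL-Library.Function_Algebras" "HOL-Computational_Algebra.Polynomial"
    "HOL-Analysis.Continuum_Not_Denumerable"
begin

text \<open>
  Read a vector indexed by the columns as a load on the framework. Three linear functionals, dual to
  the two translations and the rotation, vanish on every row: the horizontal resultant, the vertical
  resultant and the moment. In a generic framework, the row of an edge spans the space of all loads
  that are supported on the columns of that edge and annihilated by the three functionals
  (\<open>equilibrium_eq_span_row\<close>). So the row space of a set of edges arises from coordinate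
  subspaces by two \<^emph>\<open>truncations\<close>, in which each space \<open>U\<^sub>e\<close> of a family is replaced by the common
  kernel in \<open>U\<^sub>e\<close> of \<open>d\<close> functionals. The first uses the two resultants and the columns \<open>X\<close>, \<open>Y\<close>,
  \<open>B\<close>; the columns \<open>A\<close>, which the resultants ignore, are then adjoined, and the second truncation
  uses the moment.

  For functionals in general position, Lovasz's theorem on Dilworth truncations gives the dimension
  of the span of the truncated family as the minimum of \<open>\<Sum>\<^sub>R (dim (\<Sum>\<^sub>e\<^sub>\<in>\<^sub>R U\<^sub>e) - d)\<close> over the
  partitions of the index set. The first truncation therefore has rank
  \<open>\<rho> E = min \<Sum>\<^sub>C (2 \<nu>\<^sub>P C + \<nu>\<^sub>L C - 2)\<close>, and the second one has rank \<open>min \<Sum>\<^sub>R (\<nu>\<^sub>L R + \<rho> R - 1)\<close>.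
  Substituting the first formula into the second leaves a partition \<open>\<F>\<close> and a coarsening of it. Merging
  two parts that share a line-vertex does not increase \<open>\<Sum>\<^sub>R (\<nu>\<^sub>L R - 1)\<close>, so the best coarsening
  joins the members of each component of \<open>\<F>\<close>, and the sum becomes \<open>\<nu>\<^sub>L E - c\<^sub>L \<F>\<close>.

  The upper bound only needs that the functionals are independent on each \<open>U\<^sub>e\<close> (\<open>dim_kernel_le\<close>).
  For the lower bound, general position is expressed by a first-order condition, which is verified at a
  generic framework whose ranks are as large as possible: a small perturbation of one coordinate does
  not raise the rank, so the derivative of a linear relation between truncated vectors stays in
  their span (\<open>first_order_stable\<close>). From this condition \<open>truncation_partition\<close>
  produces the partition: as long as vectors of two members of the family on which the truncating functionals
  take the same values differ modulo the span \<open>K\<close> of the truncated spaces, a functional that vanishes on \<open>K\<close> splits the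
  family into two parts whose spans are independent, and otherwise the whole family is one part of
  the partition.
\<close>

section \<open>Finite-dimensional subspaces of real vector spaces\<close>

instantiation "fun" :: (type, real_vector) real_vector
begin

definition scaleR_fun :: "real \<Rightarrow> ('a \<Rightarrow> 'b) \<Rightarrow> 'a \<Rightarrow> 'b" where
  "scaleR_fun r f = (\<lambda>x. r *\<^sub>R f x)"

instance
  by standard (auto simp: scaleR_fun_def fun_eq_iff algebra_simps)

end

lemma scaleR_fun_apply [simp]: "(r *\<^sub>R f) x = r *\<^sub>R f x"
  by (simp add: scaleR_fun_def)

lemma sum_fun_apply: "(\<Sum>i\<in>I. f i) x = (\<Sum>i\<in>I. f i x)"
  by (induction I rule: infinite_finite_induct) auto

text \<open>The column space is modelled by all functions on an arbitrary, possibly infinite type, so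
  finite dimension is a property of the subsets that occur rather than of the space.\<close>

definition fin_dim :: "'a::real_vector set \<Rightarrow> bool" where
  "fin_dim V \<longleftrightarrow> (\<exists>S. finite S \<and> V \<subseteq> span S)"

lemma fin_dimI: "finite S \<Longrightarrow> V \<subseteq> span S \<Longrightarrow> fin_dim V"
  by (auto simp: fin_dim_def)

lemma fin_dim_finite [simp]: "finite S \<Longrightarrow> fin_dim S"
  by (auto intro: fin_dimI span_superset[THEN subsetD])

lemma fin_dim_mono: "fin_dim W \<Longrightarrow> V \<subseteq> span W \<Longrightarrow> fin_dim V"
  unfolding fin_dim_def by (metis span_minimal subspace_span subset_trans)

lemma fin_dim_subset: "fin_dim W \<Longrightarrow> V \<subseteq> W \<Longrightarrow> fin_dim V"
  by (meson fin_dim_mono span_superset subset_trans)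

lemma fin_dim_Un [simp]: "fin_dim (V \<union> W) \<longleftrightarrow> fin_dim V \<and> fin_dim W"
proof
  assume "fin_dim V \<and> fin_dim W"
  then obtain S T where "finite S" "V \<subseteq> span S" "finite T" "W \<subseteq> span T"
    by (auto simp: fin_dim_def)
  then have "finite (S \<union> T)" "V \<union> W \<subseteq> span (S \<union> T)"
    using span_mono[of S "S \<union> T"] span_mono[of T "S \<union> T"] by auto
  then show "fin_dim (V \<union> W)" by (rule fin_dimI)
qed (auto intro: fin_dim_subset)

lemma fin_dim_UN:
  assumes "finite I" "\<And>i. i \<in> I \<Longrightarrow> fin_dim (V i)"
  shows "fin_dim (\<Union>i\<in>I. V i)"
  using assms by (induction I rule: finite_induct) auto

lemma fin_dim_basis:
  assumes "fin_dim V"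
  obtains B where "B \<subseteq> V" "finite B" "independent B" "V \<subseteq> span B" "card B = dim V"
proof -
  obtain S where S: "finite S" "V \<subseteq> span S" using assms by (auto simp: fin_dim_def)
  obtain B where B: "B \<subseteq> V" "independent B" "V \<subseteq> span B"
    using maximal_independent_subset by blast
  then have "finite B" using independent_span_bound[OF S(1) B(2)] S(2) by auto
  then show ?thesis using B that basis_card_eq_dim by blast
qed

lemma independent_card_le_dim_span:
  assumes "fin_dim V" "independent S" "S \<subseteq> span V"
  shows "finite S" "card S \<le> dim V"
proof -
  obtain C where C: "C \<subseteq> V" "finite C" "independent C" "V \<subseteq> span C" "card C = dim V"
    using fin_dim_basis[OF assms(1)] .
  have "S \<subseteq> span C" using assms(3) C(4) by (metis span_minimal subspace_span subset_trans)
  from independent_span_bound[OF C(2) assms(2) this] C(5)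
  show "finite S" "card S \<le> dim V" by auto
qed

lemma dim_le_dim_span:
  assumes "fin_dim W" "V \<subseteq> span W"
  shows "dim V \<le> dim W"
proof -
  obtain B where B: "B \<subseteq> V" "independent B" "card B = dim V"
    using fin_dim_basis[OF fin_dim_mono[OF assms]] by metis
  then show ?thesis using independent_card_le_dim_span(2)[OF assms(1) B(2)] assms(2) by auto
qed

lemma dim_Un_le:
  assumes "fin_dim V" "fin_dim W"
  shows "dim (V \<union> W) \<le> dim V + dim W"
proof -
  obtain B where B: "finite B" "V \<subseteq> span B" "card B = dim V"
    using fin_dim_basis[OF assms(1)] by metis
  obtain C where C: "finite C" "W \<subseteq> span C" "card C = dim W"
    using fin_dim_basis[OF assms(2)] by metis
  have "V \<union> W \<subseteq> span (B \<union> C)"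
    using B C span_mono[of B "B \<union> C"] span_mono[of C "B \<union> C"] by auto
  from dim_le_card[OF this] B C card_Un_le[of B C] show ?thesis by simp
qed

lemma dim_le_card_finite: "finite S \<Longrightarrow> dim S \<le> card S" for S :: "'a::real_vector set"
  by (rule dim_le_card) (auto intro: span_superset[THEN subsetD])

lemma dim_UN_le:
  assumes "finite I" "\<And>i. i \<in> I \<Longrightarrow> fin_dim (V i)"
  shows "dim (\<Union>i\<in>I. V i) \<le> (\<Sum>i\<in>I. dim (V i))"
  using assms
proof (induction I rule: finite_induct)
  case (insert i I)
  have "dim (V i \<union> (\<Union>i\<in>I. V i)) \<le> dim (V i) + dim (\<Union>i\<in>I. V i)"
    using insert by (intro dim_Un_le fin_dim_UN) auto
  then show ?case using insert by simp
next
  case empty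
  then show ?case using dim_le_card_finite[of "{}"] by simp
qed

text \<open>Adding the vectors of a basis of \<open>W\<close> one at a time to a basis of \<open>V\<close> keeps the union
  independent, because a dependence would put a nonzero vector into both spans.\<close>

lemma dim_Un_direct:
  assumes "fin_dim V" "fin_dim W" "span V \<inter> span W \<subseteq> {0}"
  shows "dim V + dim W \<le> dim (V \<union> W)"
proof -
  obtain B where B: "B \<subseteq> V" "finite B" "independent B" "card B = dim V"
    using fin_dim_basis[OF assms(1)] by metis
  obtain C where C: "C \<subseteq> W" "finite C" "independent C" "card C = dim W"
    using fin_dim_basis[OF assms(2)] by metis
  have "independent (B \<union> C) \<and> B \<inter> C = {}"
    using \<open>finite C\<close> \<open>C \<subseteq> W\<close> \<open>independent C\<close>
  proof (induction C rule: finite_induct)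
    case (insert c C)
    have indC: "independent C" using insert.prems(2) by (rule independent_mono) auto
    have c: "c \<notin> span C"
      using insert.prems(2) insert.hyps(2) by (simp add: independent_insert)
    have "c \<notin> span (B \<union> C)"
    proof
      assume "c \<in> span (B \<union> C)"
      then obtain x y where xy: "c = x + y" "x \<in> span B" "y \<in> span C"
        by (auto simp: span_Un)
      have "x \<in> span V" using xy(2) B(1) span_mono by blast
      moreover have "c \<in> span W" using insert.prems(1) by (simp add: span_base)
      moreover have "y \<in> span W" using insert.prems(1) xy(3) span_mono[of C W] by blast
      ultimately have "x \<in> span V" "c \<in> span W" "y \<in> span W" by blast+
      moreover from this have "x \<in> span W" using xy(1) span_diff[of c W y] by simp
      ultimately have "x = 0" using assms(3) by auto
      then show False using xy c by simp
    qed
    moreover from this have "c \<notin> B" using span_base[of c "B \<union> C"] by blast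
    moreover have "independent (B \<union> C) \<and> B \<inter> C = {}"
      using insert.IH insert.prems(1) indC by blast
    ultimately show ?case by (simp add: independent_insertI)
  qed (use B in auto)
  then have "card (B \<union> C) = dim V + dim W" "independent (B \<union> C)"
    using B C by (auto simp: card_Un_disjoint)
  moreover have "B \<union> C \<subseteq> span (V \<union> W)" using B(1) C(1) span_superset[of "V \<union> W"] by blast
  ultimately show ?thesis
    using independent_card_le_dim_span(2)[of "V \<union> W" "B \<union> C"] assms by auto
qed

lemma dim_insert_functional:
  fixes T :: "'a::real_vector \<Rightarrow> real"
  assumes "fin_dim V" "linear T" "\<And>v. v \<in> V \<Longrightarrow> T v = 0" "T x \<noteq> 0"
  shows "Suc (dim V) \<le> dim (insert x V)"
proof -
  have T0: "T v = 0" if "v \<in> span V" for v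
    using linear_eq_0_on_span[OF assms(2) assms(3) that] by simp
  obtain B where B: "B \<subseteq> V" "finite B" "independent B" "card B = dim V"
    using fin_dim_basis[OF assms(1)] by metis
  have "x \<notin> span B" using T0 assms(4) span_mono[OF B(1)] by blast
  then have ind: "independent (insert x B)" "x \<notin> B"
    using B(3) span_base[of x B] by (auto simp: independent_insertI)
  have "fin_dim (insert x V)" using assms(1) fin_dim_Un[of "{x}" V] by simp
  then have "card (insert x B) \<le> dim (insert x V)"
    using B(1) span_superset[of "insert x V"] by (intro independent_card_le_dim_span(2) ind(1)) auto
  then show ?thesis using ind(2) B(2,4) by simp
qed

lemma independent_family:
  fixes g :: "'i \<Rightarrow> 'a::real_vector"
  assumes "finite I" "\<And>c. (\<Sum>i\<in>I. c i *\<^sub>R g i) = 0 \<Longrightarrow> \<forall>i\<in>I. c i = 0"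
  shows "inj_on g I" "independent (g ` I)"
proof -
  show inj: "inj_on g I"
  proof (rule inj_onI, rule ccontr)
    fix i j assume ij: "i \<in> I" "j \<in> I" "g i = g j" "i \<noteq> j"
    let ?c = "\<lambda>k. if k = i then 1 else if k = j then - 1 else (0::real)"
    have "(\<Sum>k\<in>I. ?c k *\<^sub>R g k) = (\<Sum>k\<in>{i,j}. ?c k *\<^sub>R g k)"
      by (rule sum.mono_neutral_right) (use assms(1) ij(1,2) in auto)
    also have "\<dots> = g i - g j" using ij(4) by simp
    also have "\<dots> = 0" using ij(3) by simp
    finally have "\<forall>k\<in>I. ?c k = 0" by (rule assms(2))
    from bspec[OF this ij(1)] show False by simp
  qed
  show "independent (g ` I)"
  proof (rule independent_if_scalars_zero)
    fix f x assume "(\<Sum>x\<in>g ` I. f x *\<^sub>R x) = 0" "x \<in> g ` I"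
    then have "\<forall>i\<in>I. (f \<circ> g) i = 0" by (intro assms(2)) (simp add: sum.reindex[OF inj])
    then show "f x = 0" using \<open>x \<in> g ` I\<close> by auto
  qed (use assms(1) in simp)
qed

section \<open>Independence and rank under linear perturbation\<close>

lemma independent_coordinate_functionals:
  fixes B :: "'a::real_vector set"
  assumes "independent B"
  shows "\<exists>\<phi> :: 'a \<Rightarrow> 'a \<Rightarrow> real. \<forall>b. linear (\<phi> b) \<and> (\<forall>b'\<in>B. \<phi> b b' = (if b' = b then 1 else 0))"
  by (intro choice allI linear_independent_extend[OF assms])

text \<open>The coordinate functionals of \<open>B\<close>, applied to a relation between the perturbed vectors, give a
  linear system whose matrix is the identity up to entries of size \<open>\<bar>\<epsilon>\<bar> M\<close>. For small \<open>\<epsilon>\<close> it is diagonally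
  dominant, so that the relation is trivial.\<close>

lemma independent_perturb:
  fixes B :: "'a::real_vector set"
  assumes "finite B" "independent B"
  obtains \<delta> :: real where "\<delta> > 0"
    "\<And>\<epsilon>. \<bar>\<epsilon>\<bar> < \<delta> \<Longrightarrow> inj_on (\<lambda>b. b + \<epsilon> *\<^sub>R f b) B \<and> independent ((\<lambda>b. b + \<epsilon> *\<^sub>R f b) ` B)"
proof -
  obtain \<phi> :: "'a \<Rightarrow> 'a \<Rightarrow> real" where lin: "\<And>b. linear (\<phi> b)"
    and \<phi>: "\<And>b b'. b' \<in> B \<Longrightarrow> \<phi> b b' = (if b' = b then 1 else 0)"
    using independent_coordinate_functionals[OF assms(2)] by blast
  define M where "M = 1 + (\<Sum>a\<in>B. \<Sum>b\<in>B. \<bar>\<phi> a (f b)\<bar>)"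
  have "M \<ge> 1" unfolding M_def by (simp add: sum_nonneg)
  have M: "\<bar>\<phi> a (f b)\<bar> \<le> M" if "a \<in> B" "b \<in> B" for a b
  proof -
    have "\<bar>\<phi> a (f b)\<bar> \<le> (\<Sum>b\<in>B. \<bar>\<phi> a (f b)\<bar>)"
      using that assms by (intro member_le_sum) auto
    also have "\<dots> \<le> (\<Sum>a\<in>B. \<Sum>b\<in>B. \<bar>\<phi> a (f b)\<bar>)"
      using that assms by (intro member_le_sum[of a B "\<lambda>a. \<Sum>b\<in>B. \<bar>\<phi> a (f b)\<bar>"]) (auto simp: sum_nonneg)
    finally show ?thesis by (simp add: M_def)
  qed
  define \<delta> where "\<delta> = 1 / (M * (1 + card B))"
  have "\<delta> > 0" using \<open>M \<ge> 1\<close> by (simp add: \<delta>_def)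
  have main: "\<forall>b\<in>B. c b = 0"
    if \<epsilon>: "\<bar>\<epsilon>\<bar> < \<delta>" and c: "(\<Sum>b\<in>B. c b *\<^sub>R (b + \<epsilon> *\<^sub>R f b)) = 0" for c \<epsilon>
  proof -
    define S where "S = (\<Sum>b\<in>B. \<bar>c b\<bar>)"
    have S0: "S \<ge> 0" unfolding S_def by (simp add: sum_nonneg)
    have *: "\<bar>c a\<bar> \<le> \<bar>\<epsilon>\<bar> * M * S" if a: "a \<in> B" for a
    proof -
      have "0 = \<phi> a (\<Sum>b\<in>B. c b *\<^sub>R (b + \<epsilon> *\<^sub>R f b))"
        using c lin[of a] by (simp add: linear_0)
      also have "\<dots> = (\<Sum>b\<in>B. c b * (\<phi> a b + \<epsilon> * \<phi> a (f b)))"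
        by (simp add: linear_sum[OF lin] linear_cmul[OF lin] linear_add[OF lin] algebra_simps)
      also have "\<dots> = (\<Sum>b\<in>B. c b * \<phi> a b) + \<epsilon> * (\<Sum>b\<in>B. c b * \<phi> a (f b))"
        by (simp add: algebra_simps sum.distrib sum_distrib_left)
      also have "(\<Sum>b\<in>B. c b * \<phi> a b) = (\<Sum>b\<in>B. if b = a then c b else 0)"
        using \<phi> a by (intro sum.cong) auto
      also have "\<dots> = c a" using a assms by simp
      finally have "\<bar>c a\<bar> = \<bar>\<epsilon>\<bar> * \<bar>\<Sum>b\<in>B. c b * \<phi> a (f b)\<bar>"
        by (simp add: abs_mult[symmetric])
      also have "\<bar>\<Sum>b\<in>B. c b * \<phi> a (f b)\<bar> \<le> (\<Sum>b\<in>B. \<bar>c b\<bar> * M)"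
        using M a by (intro order.trans[OF sum_abs] sum_mono) (auto simp: abs_mult mult_left_mono)
      also have "\<dots> = M * S" by (simp add: S_def sum_distrib_left mult.commute)
      finally show ?thesis by (simp add: mult_left_mono mult.assoc)
    qed
    have "S \<le> (\<Sum>b\<in>B. \<bar>\<epsilon>\<bar> * M * S)" unfolding S_def by (rule sum_mono) (use * S_def in auto)
    also have "\<dots> = \<bar>\<epsilon>\<bar> * M * card B * S" by simp
    finally have le: "S \<le> \<bar>\<epsilon>\<bar> * M * card B * S" .
    have "\<bar>\<epsilon>\<bar> * (M * (1 + card B)) < 1"
      using \<epsilon> \<open>M \<ge> 1\<close> by (simp add: \<delta>_def pos_less_divide_eq)
    moreover have "\<bar>\<epsilon>\<bar> * M \<ge> 0" using \<open>M \<ge> 1\<close> by simp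
    ultimately have "\<bar>\<epsilon>\<bar> * M * card B < 1" by (simp add: algebra_simps)
    then have "S = 0" using le S0 mult_strict_right_mono[of "\<bar>\<epsilon>\<bar> * M * card B" 1 S] by linarith
    then show ?thesis using assms(1) by (simp add: S_def sum_nonneg_eq_0_iff)
  qed
  show ?thesis
    using independent_family[OF assms(1), of "\<lambda>b. b + \<epsilon> *\<^sub>R f b" for \<epsilon>] main \<open>\<delta> > 0\<close>
    by (intro that[of \<delta>]) blast+
qed

text \<open>For a one-parameter family \<open>K\<close> of spanning sets: \<open>v\<close> extends to an affine path through the
  spaces \<open>span (K \<epsilon>)\<close>. Affine paths suffice for all perturbations below, since each of them changes a
  single coordinate on which the truncating functionals depend affinely.\<close>

definition liftable :: "(real \<Rightarrow> 'a::real_vector set) \<Rightarrow> 'a \<Rightarrow> bool" where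
  "liftable K v \<longleftrightarrow> (\<exists>v'. \<forall>\<epsilon>. v + \<epsilon> *\<^sub>R v' \<in> span (K \<epsilon>))"

text \<open>A basis at \<open>0\<close> moves along affine paths, and it stays independent for small \<open>\<epsilon>\<close>.\<close>

lemma dim_lower_semicontinuous:
  fixes K :: "real \<Rightarrow> 'a::real_vector set"
  assumes "\<And>v. v \<in> K 0 \<Longrightarrow> liftable K v" "\<And>\<epsilon>. fin_dim (K \<epsilon>)"
  obtains \<delta> where "\<delta> > 0" "\<And>\<epsilon>. \<bar>\<epsilon>\<bar> < \<delta> \<Longrightarrow> dim (K 0) \<le> dim (K \<epsilon>)"
proof -
  obtain B where B: "B \<subseteq> K 0" "finite B" "independent B" "card B = dim (K 0)"
    using fin_dim_basis[OF assms(2)] by metis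
  have "\<forall>b\<in>B. \<exists>b'. \<forall>\<epsilon>. b + \<epsilon> *\<^sub>R b' \<in> span (K \<epsilon>)"
    using assms(1) B(1) by (auto simp: liftable_def)
  then obtain f where f: "\<And>b \<epsilon>. b \<in> B \<Longrightarrow> b + \<epsilon> *\<^sub>R f b \<in> span (K \<epsilon>)" by metis
  obtain \<delta> where "\<delta> > 0"
    and \<delta>: "\<And>\<epsilon>. \<bar>\<epsilon>\<bar> < \<delta> \<Longrightarrow> inj_on (\<lambda>b. b + \<epsilon> *\<^sub>R f b) B \<and> independent ((\<lambda>b. b + \<epsilon> *\<^sub>R f b) ` B)"
    by (rule independent_perturb[OF B(2,3), of f]) (rule that)
  show ?thesis
  proof (rule that[OF \<open>\<delta> > 0\<close>])
    fix \<epsilon> :: real assume \<epsilon>: "\<bar>\<epsilon>\<bar> < \<delta>"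
    have "card ((\<lambda>b. b + \<epsilon> *\<^sub>R f b) ` B) \<le> dim (K \<epsilon>)"
      using \<delta>[OF \<epsilon>] f assms(2) by (intro independent_card_le_dim_span) auto
    then show "dim (K 0) \<le> dim (K \<epsilon>)" using \<delta>[OF \<epsilon>] B by (simp add: card_image)
  qed
qed

text \<open>If \<open>w\<close> were not in the span at \<open>0\<close>, then a basis there together with \<open>w\<close> would move to
  independent vectors of \<open>span (K \<epsilon>)\<close> for all small \<open>\<epsilon> \<noteq> 0\<close>, since \<open>span (K \<epsilon>)\<close> contains \<open>w\<close> itself.
  The dimension would then jump at \<open>0\<close>. In the application, \<open>w\<close> is the derivative of a linear
  relation.\<close>

lemma first_order_stable:
  fixes K :: "real \<Rightarrow> 'a::real_vector set"
  assumes lift: "\<And>v. v \<in> K 0 \<Longrightarrow> liftable K v" and fin: "\<And>\<epsilon>. fin_dim (K \<epsilon>)"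
    and stable: "\<And>\<delta>. \<delta> > 0 \<Longrightarrow> \<exists>\<epsilon>. \<epsilon> \<noteq> 0 \<and> \<bar>\<epsilon>\<bar> < \<delta> \<and> dim (K \<epsilon>) \<le> dim (K 0)"
    and w: "\<And>\<epsilon>. \<epsilon> *\<^sub>R w \<in> span (K \<epsilon>)"
  shows "w \<in> span (K 0)"
proof (rule ccontr)
  assume nw: "w \<notin> span (K 0)"
  \<comment> \<open>For \<open>\<epsilon> \<noteq> 0\<close> the vector \<open>w\<close> already lies in the span, so only the fibre at \<open>0\<close> has to be enlarged.\<close>
  define L where "L \<epsilon> = (if \<epsilon> = 0 then insert w (K 0) else K \<epsilon>)" for \<epsilon>
  have wL: "w \<in> span (L \<epsilon>)" for \<epsilon>
  proof (cases "\<epsilon> = 0")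
    case False
    then show ?thesis using span_scale[OF w[of \<epsilon>], of "1/\<epsilon>"] by (simp add: L_def)
  qed (simp add: L_def span_base)
  have KL: "span (K \<epsilon>) \<subseteq> span (L \<epsilon>)" for \<epsilon> by (rule span_mono) (auto simp: L_def)
  have "liftable L v" if v: "v \<in> L 0" for v
  proof (cases "v = w")
    case True
    have "v + \<epsilon> *\<^sub>R 0 \<in> span (L \<epsilon>)" for \<epsilon> using wL True by simp
    then show ?thesis unfolding liftable_def by blast
  next
    case False
    then have "v \<in> K 0" using v by (simp add: L_def)
    then show ?thesis using lift KL unfolding liftable_def by blast
  qed
  moreover have "fin_dim (L \<epsilon>)" for \<epsilon>
    using fin[of \<epsilon>] fin[of 0] fin_dim_Un[of "{w}" "K 0"] by (simp add: L_def)
  ultimately obtain \<delta> where "\<delta> > 0" and \<delta>: "\<And>\<epsilon>. \<bar>\<epsilon>\<bar> < \<delta> \<Longrightarrow> dim (L 0) \<le> dim (L \<epsilon>)"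
    using dim_lower_semicontinuous[of L] by metis
  obtain \<epsilon> where \<epsilon>: "\<epsilon> \<noteq> 0" "\<bar>\<epsilon>\<bar> < \<delta>" "dim (K \<epsilon>) \<le> dim (K 0)" using stable[OF \<open>\<delta> > 0\<close>] by blast
  obtain B where B: "B \<subseteq> K 0" "finite B" "independent B" "card B = dim (K 0)"
    using fin_dim_basis[OF fin] by metis
  have "w \<notin> span B" using nw span_mono[OF B(1)] by blast
  then have "independent (insert w B)" "w \<notin> B"
    using B(3) span_base[of w B] by (auto simp: independent_insertI)
  then have "card (insert w B) \<le> dim (L 0)"
    using \<open>\<And>\<epsilon>. fin_dim (L \<epsilon>)\<close>[of 0] B(1) span_superset[of "L 0"]
    by (intro independent_card_le_dim_span) (auto simp: L_def)
  then have "dim (K 0) < dim (L 0)" using B \<open>w \<notin> B\<close> by simp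
  then show False using \<delta>[OF \<epsilon>(2)] \<epsilon> by (simp add: L_def)
qed


text \<open>No single dimension can drop for small \<open>\<epsilon>\<close>, so if the sum of the dimensions does not grow then
  none of them grows. This passes from a framework that maximizes a sum of ranks to the stability of
  each rank.\<close>

lemma stable_of_stable_sum:
  fixes K :: "'i \<Rightarrow> real \<Rightarrow> 'a::real_vector set"
  assumes "finite I"
    and lift: "\<And>i v. i \<in> I \<Longrightarrow> v \<in> K i 0 \<Longrightarrow> liftable (K i) v"
    and fin: "\<And>i \<epsilon>. i \<in> I \<Longrightarrow> fin_dim (K i \<epsilon>)"
    and stable: "\<And>\<delta>. \<delta> > 0 \<Longrightarrow> \<exists>\<epsilon>. \<epsilon> \<noteq> 0 \<and> \<bar>\<epsilon>\<bar> < \<delta> \<and> (\<Sum>i\<in>I. dim (K i \<epsilon>)) \<le> (\<Sum>i\<in>I. dim (K i 0))"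
    and "i \<in> I" "\<delta> > 0"
  shows "\<exists>\<epsilon>. \<epsilon> \<noteq> 0 \<and> \<bar>\<epsilon>\<bar> < \<delta> \<and> dim (K i \<epsilon>) \<le> dim (K i 0)"
proof -
  have "\<exists>\<delta>>0. \<forall>\<epsilon>. \<bar>\<epsilon>\<bar> < \<delta> \<longrightarrow> dim (K i 0) \<le> dim (K i \<epsilon>)" if "i \<in> I" for i
    using dim_lower_semicontinuous[OF lift fin, OF that _ that] by metis
  then obtain d where d: "\<And>i. i \<in> I \<Longrightarrow> d i > 0"
      "\<And>i \<epsilon>. i \<in> I \<Longrightarrow> \<bar>\<epsilon>\<bar> < d i \<Longrightarrow> dim (K i 0) \<le> dim (K i \<epsilon>)" by metis
  define \<delta>' where "\<delta>' = Min (insert \<delta> (d ` I))"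
  have "\<delta>' > 0" "\<delta>' \<le> \<delta>" and le: "\<And>i. i \<in> I \<Longrightarrow> \<delta>' \<le> d i"
    using d(1) assms(1) \<open>\<delta> > 0\<close> by (auto simp: \<delta>'_def)
  then obtain \<epsilon> where \<epsilon>: "\<epsilon> \<noteq> 0" "\<bar>\<epsilon>\<bar> < \<delta>'" "(\<Sum>i\<in>I. dim (K i \<epsilon>)) \<le> (\<Sum>i\<in>I. dim (K i 0))"
    using stable by blast
  have ge: "dim (K i 0) \<le> dim (K i \<epsilon>)" if "i \<in> I" for i
    using d(2)[OF that] le[OF that] \<epsilon>(2) by simp
  have "dim (K i \<epsilon>) \<le> dim (K i 0)"
  proof (rule ccontr)
    assume "\<not> ?thesis"
    then have "(\<Sum>i\<in>I. dim (K i 0)) < (\<Sum>i\<in>I. dim (K i \<epsilon>))"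
      using ge assms(1,5) by (intro sum_strict_mono_ex1) (auto simp: not_le)
    then show False using \<epsilon>(3) by simp
  qed
  then show ?thesis using \<epsilon> \<open>\<delta>' \<le> \<delta>\<close> by (intro exI[of _ \<epsilon>]) simp
qed

section \<open>Splitting a spanned space along a partition\<close>

lemma separating_functional:
  fixes V :: "'a::real_vector set"
  assumes "v \<notin> span V"
  obtains m :: "'a \<Rightarrow> real" where "linear m" "\<And>u. u \<in> span V \<Longrightarrow> m u = 0" "m v \<noteq> 0"
proof -
  obtain C where C: "C \<subseteq> V" "independent C" "V \<subseteq> span C"
    using maximal_independent_subset by blast
  have "v \<notin> span C" using assms span_mono[OF C(1)] by blast
  then have "independent (insert v C)" using C(2) by (rule independent_insertI)
  then obtain m :: "'a \<Rightarrow> real" where m: "linear m" "\<forall>u\<in>insert v C. m u = (if u = v then 1 else 0)"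
    using linear_independent_extend[of "insert v C" "\<lambda>u. if u = v then 1 else (0::real)"] by metis
  have "v \<notin> C" using \<open>v \<notin> span C\<close> span_base by blast
  have "m u = 0" if "u \<in> span V" for u
  proof (rule linear_eq_0_on_span[OF m(1)])
    show "m b = 0" if "b \<in> C" for b using m(2) that \<open>v \<notin> C\<close> by auto
    show "u \<in> span C" by (rule subsetD[OF span_minimal[OF C(3) subspace_span] that])
  qed
  then show ?thesis using m by (intro that[of m]) auto
qed

text \<open>If relations may be multiplied by the weights \<open>\<mu>\<close>, they may be multiplied by any polynomial in
  \<open>\<mu>\<close>, in particular by one that vanishes at all values of \<open>\<mu>\<close> except \<open>c\<close>. Thus a relation splits
  into separate relations over the level sets of \<open>\<mu>\<close>.\<close>

lemma level_set_of_relation: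
  fixes W :: "'e \<Rightarrow> 'a::real_vector set" and \<mu> :: "'e \<Rightarrow> real"
  assumes "finite Q" and W: "\<And>e. e \<in> Q \<Longrightarrow> subspace (W e)"
    and closed: "\<And>y. (\<And>e. e \<in> Q \<Longrightarrow> y e \<in> W e) \<Longrightarrow> (\<Sum>e\<in>Q. y e) = 0 \<Longrightarrow> (\<Sum>e\<in>Q. \<mu> e *\<^sub>R y e) = 0"
    and y: "\<And>e. e \<in> Q \<Longrightarrow> y e \<in> W e" "(\<Sum>e\<in>Q. y e) = 0"
  shows "(\<Sum>e | e \<in> Q \<and> \<mu> e = c. y e) = 0"
proof -
  define \<Gamma> where "\<Gamma> = \<mu> ` Q - {c}"
  have fin: "finite \<Gamma>" using assms(1) by (simp add: \<Gamma>_def)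
  have "(\<Sum>e\<in>Q. (\<Prod>g\<in>\<Delta>. \<mu> e - g) *\<^sub>R y e) = 0" if "finite \<Delta>" for \<Delta>
    using that
  proof (induction \<Delta> rule: finite_induct)
    case (insert g \<Delta>)
    let ?z = "\<lambda>e. (\<Prod>g\<in>\<Delta>. \<mu> e - g) *\<^sub>R y e"
    have "(\<Sum>e\<in>Q. \<mu> e *\<^sub>R ?z e) = 0"
      by (rule closed) (use insert.IH W y(1) in \<open>auto simp: subspace_scale\<close>)
    moreover have "(\<Sum>e\<in>Q. (\<Prod>h\<in>insert g \<Delta>. \<mu> e - h) *\<^sub>R y e) = (\<Sum>e\<in>Q. \<mu> e *\<^sub>R ?z e - g *\<^sub>R ?z e)"
      using insert.hyps by (intro sum.cong) (auto simp: algebra_simps)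
    moreover have "(\<Sum>e\<in>Q. g *\<^sub>R ?z e) = g *\<^sub>R (\<Sum>e\<in>Q. ?z e)" by (simp only: scaleR_sum_right)
    ultimately show ?case using insert.IH by (simp only: sum_subtractf) simp
  qed (use y in simp)
  from this[OF fin] have "0 = (\<Sum>e\<in>Q. (\<Prod>g\<in>\<Gamma>. \<mu> e - g) *\<^sub>R y e)" by simp
  also have "\<dots> = (\<Sum>e | e \<in> Q \<and> \<mu> e = c. (\<Prod>g\<in>\<Gamma>. \<mu> e - g) *\<^sub>R y e)"
  proof (rule sum.mono_neutral_right)
    show "\<forall>e\<in>Q - {e \<in> Q. \<mu> e = c}. (\<Prod>g\<in>\<Gamma>. \<mu> e - g) *\<^sub>R y e = 0"
    proof
      fix e assume "e \<in> Q - {e \<in> Q. \<mu> e = c}"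
      then have "\<mu> e \<in> \<Gamma>" by (auto simp: \<Gamma>_def)
      then have "(\<Prod>g\<in>\<Gamma>. \<mu> e - g) = 0" using fin by (intro prod_zero) auto
      then show "(\<Prod>g\<in>\<Gamma>. \<mu> e - g) *\<^sub>R y e = 0" by simp
    qed
  qed (use assms(1) in auto)
  also have "\<dots> = (\<Prod>g\<in>\<Gamma>. c - g) *\<^sub>R (\<Sum>e | e \<in> Q \<and> \<mu> e = c. y e)"
    unfolding scaleR_sum_right by (intro sum.cong) auto
  finally show ?thesis using fin by (auto simp: \<Gamma>_def)
qed

lemma span_UN_decompose:
  fixes W :: "'e \<Rightarrow> 'a::real_vector set"
  assumes "finite Q" "\<And>e. e \<in> Q \<Longrightarrow> subspace (W e)" "v \<in> span (\<Union>e\<in>Q. W e)"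
  obtains y where "\<And>e. e \<in> Q \<Longrightarrow> y e \<in> W e" "v = (\<Sum>e\<in>Q. y e)"
proof -
  have "\<exists>y. (\<forall>e\<in>Q. y e \<in> W e) \<and> v = (\<Sum>e\<in>Q. y e)"
    using assms(3)
  proof (induction rule: span_induct_alt)
    case base
    show ?case by (rule exI[of _ "\<lambda>_. 0"]) (use assms(2) in \<open>auto simp: subspace_0\<close>)
  next
    case (step c x z)
    then obtain y where y: "\<forall>e\<in>Q. y e \<in> W e" "z = (\<Sum>e\<in>Q. y e)" by blast
    obtain f where f: "f \<in> Q" "x \<in> W f" using step by blast
    have "\<forall>e\<in>Q. (y(f := c *\<^sub>R x + y f)) e \<in> W e"
      using f y(1) assms(2) by (auto simp: subspace_add subspace_scale)
    moreover have "c *\<^sub>R x + z = (\<Sum>e\<in>Q. (y(f := c *\<^sub>R x + y f)) e)"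
      using f(1) assms(1) y(2) by (simp add: sum.remove[of Q f] add.assoc)
    ultimately show ?case by blast
  qed
  then show ?thesis using that by blast
qed

text \<open>The lower bound in Lovasz's theorem. The spaces \<open>W e\<close> are the truncated ones, and \<open>x j e\<close> for \<open>j \<in> J\<close>
  are complementary vectors, so that \<open>W e\<close> and the \<open>x j e\<close> together span the original space. The
  assumption \<open>relation\<close> is the first-order form of general position.

  If no \<open>x j e\<close> depends on \<open>e\<close> modulo the span \<open>K\<close> of all \<open>W e\<close>, the original spaces together have
  dimension at most \<open>dim K + card J\<close>, and the one-part partition works. Otherwise choose \<open>j\<close> and a functional \<open>m\<close> that
  vanishes on \<open>K\<close> and for which \<open>\<mu> e = m (x j e)\<close> is not constant. Applying \<open>m\<close> to the assumption
  shows that relations may be multiplied by \<open>\<mu>\<close>. Hence they split over a level set of \<open>\<mu>\<close> and its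
  complement, so that the spans of these two parts of the family are independent, and induction
  applies to each part.\<close>

lemma truncation_partition:
  fixes W :: "'e \<Rightarrow> ('c \<Rightarrow> real) set" and x :: "'j \<Rightarrow> 'e \<Rightarrow> 'c \<Rightarrow> real"
  assumes "finite Q" "finite J"
    and W: "\<And>e. e \<in> Q \<Longrightarrow> subspace (W e)" and fin: "\<And>e. e \<in> Q \<Longrightarrow> fin_dim (W e)"
    and relation: "\<And>R y j c. R \<subseteq> Q \<Longrightarrow> j \<in> J \<Longrightarrow> (\<And>e. e \<in> R \<Longrightarrow> y e \<in> W e) \<Longrightarrow> (\<Sum>e\<in>R. y e) = 0 \<Longrightarrow>
        (\<Sum>e\<in>R. y e c *\<^sub>R x j e) \<in> span (\<Union>e\<in>R. W e)"
  shows "\<exists>P. partition_on Q P \<and>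
    (\<Sum>R\<in>P. int (dim (\<Union>e\<in>R. W e \<union> (\<lambda>j. x j e) ` J)) - int (card J)) \<le> int (dim (\<Union>e\<in>Q. W e))"
  using assms
proof (induction "card Q" arbitrary: Q rule: less_induct)
  case less
  note W = less.prems(3) and fin = less.prems(4) and relation = less.prems(5)
  define K where "K R = (\<Union>e\<in>R. W e)" for R
  have finK: "fin_dim (K R)" if "R \<subseteq> Q" for R
    unfolding K_def using that less.prems(1) fin by (intro fin_dim_UN) (auto intro: finite_subset)
  consider "Q = {}" | e where "e \<in> Q" "\<forall>f\<in>Q. \<forall>j\<in>J. x j f - x j e \<in> span (K Q)"
    | e f j where "e \<in> Q" "f \<in> Q" "j \<in> J" "x j f - x j e \<notin> span (K Q)"
    by blast
  then show ?case
  proof cases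
    case 1
    then show ?thesis by (intro exI[of _ "{}"]) (auto simp: partition_on_def)
  next
    case 2
    \<comment> \<open>The original spaces are all contained in the sum of \<open>K Q\<close> and the span of the vectors \<open>x j e\<close>.\<close>
    let ?S = "K Q \<union> (\<lambda>j. x j e) ` J"
    have "x j f \<in> span ?S" if "f \<in> Q" "j \<in> J" for f j
    proof -
      have "x j f - x j e \<in> span ?S" using 2(2) that span_mono[of "K Q" ?S] by blast
      moreover have "x j e \<in> span ?S" using that by (auto intro: span_base)
      ultimately show ?thesis using span_add by fastforce
    qed
    moreover have "W f \<subseteq> span ?S" if "f \<in> Q" for f
      using that span_superset[of ?S] by (auto simp: K_def)
    ultimately have sub: "(\<Union>e\<in>Q. W e \<union> (\<lambda>j. x j e) ` J) \<subseteq> span ?S" by blast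
    have "dim (\<Union>e\<in>Q. W e \<union> (\<lambda>j. x j e) ` J) \<le> dim ?S"
      by (rule dim_le_dim_span[OF _ sub]) (use finK less.prems(2) in simp)
    also have "\<dots> \<le> dim (K Q) + dim ((\<lambda>j. x j e) ` J)"
      by (rule dim_Un_le) (use finK less.prems(2) in auto)
    also have "dim ((\<lambda>j. x j e) ` J) \<le> card J"
      using dim_le_card_finite[of "(\<lambda>j. x j e) ` J"] card_image_le[OF less.prems(2), of "\<lambda>j. x j e"]
        less.prems(2) by simp
    finally show ?thesis using 2(1) by (intro exI[of _ "{Q}"]) (auto simp: partition_on_def K_def)
  next
    case 3
    obtain m :: "('c \<Rightarrow> real) \<Rightarrow> real" where m: "linear m" "\<And>u. u \<in> span (K Q) \<Longrightarrow> m u = 0" "m (x j f - x j e) \<noteq> 0"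
      by (rule separating_functional[OF 3(4)]) (rule that)
    define \<mu> where "\<mu> g = m (x j g)" for g
    have ne: "\<mu> f \<noteq> \<mu> e" using m(3) by (simp add: \<mu>_def linear_diff[OF m(1)])
    have closed: "(\<Sum>g\<in>Q. \<mu> g *\<^sub>R y g) = 0"
      if y: "\<And>g. g \<in> Q \<Longrightarrow> y g \<in> W g" "(\<Sum>g\<in>Q. y g) = 0" for y
    proof
      fix c
      have "0 = m (\<Sum>g\<in>Q. y g c *\<^sub>R x j g)"
        using relation[OF subset_refl 3(3) y] m(2) by (simp add: K_def)
      also have "\<dots> = (\<Sum>g\<in>Q. \<mu> g *\<^sub>R y g) c"
        by (simp add: \<mu>_def linear_sum[OF m(1)] linear_cmul[OF m(1)] sum_fun_apply mult.commute)
      finally show "(\<Sum>g\<in>Q. \<mu> g *\<^sub>R y g) c = 0 c" by simp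
    qed
    define R S where "R = {g \<in> Q. \<mu> g = \<mu> e}" and "S = {g \<in> Q. \<mu> g \<noteq> \<mu> e}"
    have RS: "R \<subseteq> Q" "S \<subseteq> Q" "R \<union> S = Q" "R \<inter> S = {}" "e \<in> R" "f \<in> S"
      using 3 ne by (auto simp: R_def S_def)
    then have lt: "card R < card Q" "card S < card Q"
      using less.prems(1) by (metis (no_types, lifting) IntI empty_iff psubsetI psubset_card_mono Un_iff)+
    have finRS: "finite R" "finite S" using RS less.prems(1) by (auto intro: finite_subset)
    have "\<exists>P. partition_on R P \<and>
      (\<Sum>R\<in>P. int (dim (\<Union>e\<in>R. W e \<union> (\<lambda>j. x j e) ` J)) - int (card J)) \<le> int (dim (\<Union>e\<in>R. W e))"
      by (rule less.hyps[OF lt(1) finRS(1) less.prems(2)]) (use RS(1) W fin relation in \<open>auto dest: subset_trans\<close>)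
    then obtain P1 where P1: "partition_on R P1"
      "(\<Sum>R\<in>P1. int (dim (\<Union>e\<in>R. W e \<union> (\<lambda>j. x j e) ` J)) - int (card J)) \<le> int (dim (K R))"
      unfolding K_def by blast
    have "\<exists>P. partition_on S P \<and>
      (\<Sum>R\<in>P. int (dim (\<Union>e\<in>R. W e \<union> (\<lambda>j. x j e) ` J)) - int (card J)) \<le> int (dim (\<Union>e\<in>S. W e))"
      by (rule less.hyps[OF lt(2) finRS(2) less.prems(2)]) (use RS(2) W fin relation in \<open>auto dest: subset_trans\<close>)
    then obtain P2 where P2: "partition_on S P2"
      "(\<Sum>R\<in>P2. int (dim (\<Union>e\<in>R. W e \<union> (\<lambda>j. x j e) ` J)) - int (card J)) \<le> int (dim (K S))"
      unfolding K_def by blast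
    \<comment> \<open>A common vector of the two spans is a relation over \<open>Q\<close>, and its part over the level set \<open>R\<close>
      is again a relation.\<close>
    have "span (K R) \<inter> span (K S) \<subseteq> {0}"
    proof
      fix v assume v: "v \<in> span (K R) \<inter> span (K S)"
      obtain y where y: "\<And>g. g \<in> R \<Longrightarrow> y g \<in> W g" "v = (\<Sum>g\<in>R. y g)"
        using span_UN_decompose[OF finRS(1), of W v] v W RS(1) unfolding K_def by blast
      obtain z where z: "\<And>g. g \<in> S \<Longrightarrow> z g \<in> W g" "v = (\<Sum>g\<in>S. z g)"
        using span_UN_decompose[OF finRS(2), of W v] v W RS(2) unfolding K_def by blast
      define u where "u g = (if g \<in> R then y g else - z g)" for g
      have "(\<Sum>g\<in>Q. u g) = (\<Sum>g\<in>R. u g) + (\<Sum>g\<in>S. u g)"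
        using RS finRS sum.union_disjoint[of R S u] by simp
      moreover have "(\<Sum>g\<in>R. u g) = v" using y(2) by (simp add: u_def)
      moreover have "(\<Sum>g\<in>S. u g) = (\<Sum>g\<in>S. - z g)"
        using RS(4) by (intro sum.cong) (auto simp: u_def)
      ultimately have u0: "(\<Sum>g\<in>Q. u g) = 0" using z(2) by (simp add: sum_negf)
      have uW: "u g \<in> W g" if "g \<in> Q" for g
        using that RS y(1) z(1) W[OF that] by (auto simp: u_def subspace_neg)
      have "(\<Sum>g | g \<in> Q \<and> \<mu> g = \<mu> e. u g) = 0"
        by (rule level_set_of_relation[OF less.prems(1) W closed uW u0])
      then show "v \<in> {0}" using \<open>(\<Sum>g\<in>R. u g) = v\<close> by (simp add: R_def)
    qed
    then have "dim (K R) + dim (K S) \<le> dim (K R \<union> K S)"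
      using finK RS by (intro dim_Un_direct) auto
    also have "K R \<union> K S = K Q" using RS(3) by (auto simp: K_def)
    finally have *: "dim (K R) + dim (K S) \<le> dim (K Q)" .
    have P: "partition_on Q (P1 \<union> P2)"
      using P1(1) P2(1) RS(3,4) disjoint_union[of P1 P2] by (simp add: partition_on_def)
    have "P1 \<inter> P2 = {}"
    proof (rule ccontr)
      assume "P1 \<inter> P2 \<noteq> {}"
      then obtain D where "D \<in> P1" "D \<in> P2" by blast
      then have "D \<noteq> {}" "D \<subseteq> R" "D \<subseteq> S"
        using P1(1) P2(1) by (auto simp: partition_on_def)
      then show False using RS(4) by blast
    qed
    moreover have "finite P1" "finite P2"
      using P1(1) P2(1) finRS finite_elements by blast+
    ultimately show ?thesis using P P1(2) P2(2) *
      by (intro exI[of _ "P1 \<union> P2"]) (simp add: sum.union_disjoint K_def)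
  qed
qed

section \<open>Truncation of a family of subspaces by linear functionals\<close>

text \<open>A family of subspaces \<open>U e\<close> and functionals \<open>T j\<close> that are linearly independent on each of
  them, as witnessed by the dual vectors \<open>x j e\<close>.\<close>

locale truncation =
  fixes Q :: "'e set" and U :: "'e \<Rightarrow> ('c \<Rightarrow> real) set"
    and J :: "'j set" and T :: "'j \<Rightarrow> ('c \<Rightarrow> real) \<Rightarrow> real" and x :: "'j \<Rightarrow> 'e \<Rightarrow> 'c \<Rightarrow> real"
  assumes finite_Q: "finite Q" and finite_J: "finite J"
    and subspace_U: "e \<in> Q \<Longrightarrow> subspace (U e)" and fin_dim_U: "e \<in> Q \<Longrightarrow> fin_dim (U e)"
    and linear_T: "j \<in> J \<Longrightarrow> linear (T j)"
    and anchor_in_U: "e \<in> Q \<Longrightarrow> j \<in> J \<Longrightarrow> x j e \<in> U e"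
    and T_anchor: "e \<in> Q \<Longrightarrow> i \<in> J \<Longrightarrow> j \<in> J \<Longrightarrow> T i (x j e) = (if i = j then 1 else 0)"
begin

definition kernel :: "'e \<Rightarrow> ('c \<Rightarrow> real) set" where
  "kernel e = {v \<in> U e. \<forall>j\<in>J. T j v = 0}"

text \<open>The truncated spaces after the functional \<open>T j\<close> has been changed by \<open>\<epsilon> * s\<close> times the
  coordinate \<open>c\<close>. The effect of moving one point or turning one line has this form.\<close>

definition kernel_perturbed :: "'j \<Rightarrow> 'c \<Rightarrow> real \<Rightarrow> real \<Rightarrow> 'e \<Rightarrow> ('c \<Rightarrow> real) set" where
  "kernel_perturbed j c s \<epsilon> e = {v \<in> U e. \<forall>i\<in>J. T i v + (if i = j then \<epsilon> * s * v c else 0) = 0}"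

lemma kernel_perturbed_0: "kernel_perturbed j c s 0 e = kernel e"
  by (auto simp: kernel_perturbed_def kernel_def)

lemma kernel_subset_U: "kernel e \<subseteq> U e"
  by (auto simp: kernel_def)

lemma subspace_kernel: "e \<in> Q \<Longrightarrow> subspace (kernel e)"
  using subspace_U[of e] linear_T unfolding subspace_def kernel_def
  by (auto simp: linear_0 linear_add linear_cmul)

lemma fin_dim_kernel: "R \<subseteq> Q \<Longrightarrow> fin_dim (\<Union>e\<in>R. kernel e)"
  using fin_dim_U kernel_subset_U finite_Q by (intro fin_dim_UN) (blast intro: finite_subset fin_dim_subset)+

lemma reduce_to_kernel:
  assumes "e \<in> Q" "v \<in> U e"
  shows "v - (\<Sum>j\<in>J. T j v *\<^sub>R x j e) \<in> kernel e"
proof -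
  have "(\<Sum>j\<in>J. T j v *\<^sub>R x j e) \<in> U e"
    using assms(1) by (intro subspace_sum subspace_scale subspace_U anchor_in_U)
  moreover have "T i (\<Sum>j\<in>J. T j v *\<^sub>R x j e) = T i v" if "i \<in> J" for i
  proof -
    have "T i (\<Sum>j\<in>J. T j v *\<^sub>R x j e) = (\<Sum>j\<in>J. T j v * T i (x j e))"
      by (simp add: linear_sum[OF linear_T[OF that]] linear_cmul[OF linear_T[OF that]])
    also have "\<dots> = (\<Sum>j\<in>J. if j = i then T j v else 0)"
      using assms(1) that by (intro sum.cong) (auto simp: T_anchor)
    finally show ?thesis using that finite_J by simp
  qed
  ultimately show ?thesis
    using assms subspace_U[OF assms(1)]
    by (auto simp: kernel_def subspace_diff linear_diff[OF linear_T])
qed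

lemma kernel_anchors_span_U:
  assumes "R \<subseteq> Q"
  shows "span (\<Union>e\<in>R. kernel e \<union> (\<lambda>j. x j e) ` J) = span (\<Union>e\<in>R. U e)"
proof -
  have "(\<Union>e\<in>R. kernel e \<union> (\<lambda>j. x j e) ` J) \<subseteq> (\<Union>e\<in>R. U e)"
    using assms anchor_in_U kernel_subset_U by blast
  moreover have "U e \<subseteq> span (\<Union>e\<in>R. kernel e \<union> (\<lambda>j. x j e) ` J)" if e: "e \<in> R" for e
  proof
    fix v assume v: "v \<in> U e"
    let ?S = "\<Union>e\<in>R. kernel e \<union> (\<lambda>j. x j e) ` J"
    have "v - (\<Sum>j\<in>J. T j v *\<^sub>R x j e) \<in> span ?S"
      using reduce_to_kernel[of e v] assms e v by (intro span_base) blast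
    moreover have "(\<Sum>j\<in>J. T j v *\<^sub>R x j e) \<in> span ?S"
      using e by (intro span_sum span_scale span_base) blast
    ultimately have "v - (\<Sum>j\<in>J. T j v *\<^sub>R x j e) + (\<Sum>j\<in>J. T j v *\<^sub>R x j e) \<in> span ?S"
      by (rule span_add)
    then show "v \<in> span ?S" by simp
  qed
  ultimately show ?thesis
    unfolding span_eq by (meson UN_least span_superset subset_trans)
qed

text \<open>The dual vectors of a single member of the family are independent modulo the span of all
  truncated spaces, since the functionals vanish on the latter.\<close>

lemma dim_kernel_le:
  assumes "R \<subseteq> Q" "R \<noteq> {}"
  shows "dim (\<Union>e\<in>R. kernel e) + card J \<le> dim (\<Union>e\<in>R. U e)"
proof -
  obtain e where e: "e \<in> R" using assms(2) by blast
  let ?K = "\<Union>e\<in>R. kernel e"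
  have "dim ?K + card I \<le> dim (?K \<union> (\<lambda>j. x j e) ` I)" if "I \<subseteq> J" for I
    using finite_subset[OF that finite_J] that
  proof (induction I rule: finite_induct)
    case (insert i I)
    have i: "i \<in> J" using insert.prems by simp
    have "Suc (dim (?K \<union> (\<lambda>j. x j e) ` I)) \<le> dim (insert (x i e) (?K \<union> (\<lambda>j. x j e) ` I))"
    proof (rule dim_insert_functional[OF _ linear_T[OF i]])
      show "fin_dim (?K \<union> (\<lambda>j. x j e) ` I)" using fin_dim_kernel[OF assms(1)] insert.hyps by simp
      show "T i v = 0" if "v \<in> ?K \<union> (\<lambda>j. x j e) ` I" for v
        using that i insert.hyps insert.prems T_anchor[of e i] subsetD[OF assms(1) e]
        by (auto simp: kernel_def)
      show "T i (x i e) \<noteq> 0" using T_anchor[of e i i] e i assms(1) by auto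
    qed
    then show ?case using insert by simp
  qed simp
  from this[OF subset_refl] have "dim ?K + card J \<le> dim (?K \<union> (\<lambda>j. x j e) ` J)" .
  also have "\<dots> \<le> dim (\<Union>e\<in>R. U e)"
  proof (rule dim_le_dim_span)
    show "fin_dim (\<Union>e\<in>R. U e)"
      using assms(1) finite_Q fin_dim_U by (intro fin_dim_UN) (auto intro: finite_subset)
    have "?K \<union> (\<lambda>j. x j e) ` J \<subseteq> (\<Union>e\<in>R. U e)" using e assms(1) anchor_in_U kernel_subset_U by blast
    then show "?K \<union> (\<lambda>j. x j e) ` J \<subseteq> span (\<Union>e\<in>R. U e)"
      by (rule subset_trans[OF _ span_superset])
  qed
  finally show ?thesis .
qed

text \<open>For some coordinates \<open>c\<close> the condition of general position holds without any perturbation: if one vector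
  \<open>s\<close> lies in all spaces that involve \<open>c\<close>, then its reductions agree with \<open>s\<close> modulo the truncated
  spaces, and the sum collapses to the coordinate \<open>c\<close> of the relation times \<open>s\<close>, which is zero.\<close>

lemma relation_common_vector:
  assumes R: "R \<subseteq> Q" and y: "\<And>e. e \<in> R \<Longrightarrow> y e \<in> kernel e" "(\<Sum>e\<in>R. y e) = 0"
    and s: "\<And>e. e \<in> R \<Longrightarrow> y e c \<noteq> 0 \<Longrightarrow> s \<in> U e"
  shows "(\<Sum>e\<in>R. y e c *\<^sub>R (\<Sum>j\<in>J. T j s *\<^sub>R x j e)) \<in> span (\<Union>e\<in>R. kernel e)"
proof -
  have "(\<Sum>e\<in>R. y e c *\<^sub>R (s - (\<Sum>j\<in>J. T j s *\<^sub>R x j e))) \<in> span (\<Union>e\<in>R. kernel e)"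
  proof (rule span_sum)
    fix e assume e: "e \<in> R"
    show "y e c *\<^sub>R (s - (\<Sum>j\<in>J. T j s *\<^sub>R x j e)) \<in> span (\<Union>e\<in>R. kernel e)"
    proof (cases "y e c = 0")
      case False
      then show ?thesis
        using reduce_to_kernel[of e s] s[OF e] e R by (intro span_scale span_base) blast
    qed (simp add: span_zero)
  qed
  moreover have "(\<Sum>e\<in>R. y e c *\<^sub>R s) = 0"
    using fun_cong[OF y(2), of c] by (simp add: sum_fun_apply flip: scaleR_sum_left)
  ultimately have "- (\<Sum>e\<in>R. y e c *\<^sub>R (\<Sum>j\<in>J. T j s *\<^sub>R x j e)) \<in> span (\<Union>e\<in>R. kernel e)"
    by (simp add: scaleR_diff_right sum_subtractf)
  from span_neg[OF this] show ?thesis by simp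
qed

text \<open>Because \<open>x' c = 0\<close>, the correction by a multiple of \<open>x'\<close> compensates the change of the
  functional exactly and not only to first order.\<close>

lemma perturbed_vector:
  assumes "e \<in> Q" "v \<in> kernel e" "j \<in> J"
    and x': "v c \<noteq> 0 \<Longrightarrow> x' \<in> U e \<and> (\<forall>i\<in>J. T i x' = (if i = j then 1 else 0)) \<and> x' c = 0"
  shows "v + \<epsilon> *\<^sub>R (- (s * v c)) *\<^sub>R x' \<in> kernel_perturbed j c s \<epsilon> e"
proof (cases "v c = 0")
  case False
  then have x': "x' \<in> U e" "\<And>i. i \<in> J \<Longrightarrow> T i x' = (if i = j then 1 else 0)" "x' c = 0"
    using x' by auto
  have v: "v \<in> U e" "\<And>i. i \<in> J \<Longrightarrow> T i v = 0" using assms(2) by (auto simp: kernel_def)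
  have "v + \<epsilon> *\<^sub>R (- (s * v c)) *\<^sub>R x' \<in> U e"
    using v(1) x'(1) subspace_U[OF assms(1)] by (blast intro: subspace_add subspace_scale)
  moreover have "T i (v + \<epsilon> *\<^sub>R (- (s * v c)) *\<^sub>R x') = (if i = j then - (\<epsilon> * s * v c) else 0)" if "i \<in> J" for i
    using that v(2)[OF that] x'(2)[OF that] linear_T[OF that] assms(3)
    by (simp add: linear_diff linear_cmul)
  ultimately show ?thesis using x'(3) by (auto simp: kernel_perturbed_def)
qed (use assms(2) in \<open>auto simp: kernel_perturbed_def kernel_def\<close>)

lemma perturbed_liftable:
  assumes "R \<subseteq> Q" "j \<in> J"
    and x': "\<And>e v. e \<in> R \<Longrightarrow> v \<in> kernel e \<Longrightarrow> v c \<noteq> 0 \<Longrightarrow>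
        \<exists>x'. x' \<in> U e \<and> (\<forall>i\<in>J. T i x' = (if i = j then 1 else 0)) \<and> x' c = 0"
    and v: "v \<in> (\<Union>e\<in>R. kernel_perturbed j c s 0 e)"
  shows "liftable (\<lambda>\<epsilon>. \<Union>e\<in>R. kernel_perturbed j c s \<epsilon> e) v"
proof -
  obtain e where e: "e \<in> R" "v \<in> kernel e" using v by (auto simp: kernel_perturbed_0)
  then have "\<exists>x'. v c \<noteq> 0 \<longrightarrow> x' \<in> U e \<and> (\<forall>i\<in>J. T i x' = (if i = j then 1 else 0)) \<and> x' c = 0"
    using x' by blast
  then obtain x' where "v c \<noteq> 0 \<Longrightarrow> x' \<in> U e \<and> (\<forall>i\<in>J. T i x' = (if i = j then 1 else 0)) \<and> x' c = 0"
    by blast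
  then have "v + \<epsilon> *\<^sub>R (- (s * v c)) *\<^sub>R x' \<in> span (\<Union>e\<in>R. kernel_perturbed j c s \<epsilon> e)" for \<epsilon>
    using perturbed_vector[of e v j c x' \<epsilon> s] e assms(1,2) by (intro span_base) blast
  then show ?thesis unfolding liftable_def by blast
qed

lemma fin_dim_kernel_perturbed: "R \<subseteq> Q \<Longrightarrow> fin_dim (\<Union>e\<in>R. kernel_perturbed j c s \<epsilon> e)"
proof (rule fin_dim_UN)
  fix e assume "R \<subseteq> Q" "e \<in> R"
  then show "fin_dim (kernel_perturbed j c s \<epsilon> e)"
    by (intro fin_dim_subset[OF fin_dim_U, of e]) (auto simp: kernel_perturbed_def)
qed (use finite_Q in \<open>auto intro: finite_subset\<close>)

text \<open>The terms of the relation lift to the perturbed spaces, and the derivative of the lifted relation is,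
  modulo the truncated spaces, a nonzero multiple of the sum in the conclusion.\<close>

lemma relation_perturbed:
  assumes R: "R \<subseteq> Q" and j: "j \<in> J" and y: "\<And>e. e \<in> R \<Longrightarrow> y e \<in> kernel e" "(\<Sum>e\<in>R. y e) = 0"
    and "s \<noteq> 0"
    and x': "\<And>e v. e \<in> R \<Longrightarrow> v \<in> kernel e \<Longrightarrow> v c \<noteq> 0 \<Longrightarrow>
        \<exists>x'. x' \<in> U e \<and> (\<forall>i\<in>J. T i x' = (if i = j then 1 else 0)) \<and> x' c = 0"
    and stable: "\<And>\<delta>. \<delta> > 0 \<Longrightarrow> \<exists>\<epsilon>. \<epsilon> \<noteq> 0 \<and> \<bar>\<epsilon>\<bar> < \<delta> \<and>
        dim (\<Union>e\<in>R. kernel_perturbed j c s \<epsilon> e) \<le> dim (\<Union>e\<in>R. kernel e)"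
  shows "(\<Sum>e\<in>R. y e c *\<^sub>R x j e) \<in> span (\<Union>e\<in>R. kernel e)"
proof -
  let ?K = "\<Union>e\<in>R. kernel e"
  have "\<forall>e\<in>R. \<exists>x'. y e c \<noteq> 0 \<longrightarrow> x' \<in> U e \<and> (\<forall>i\<in>J. T i x' = (if i = j then 1 else 0)) \<and> x' c = 0"
    using x' y(1) by blast
  then obtain g where g: "\<And>e. e \<in> R \<Longrightarrow> y e c \<noteq> 0 \<Longrightarrow>
      g e \<in> U e \<and> (\<forall>i\<in>J. T i (g e) = (if i = j then 1 else 0)) \<and> g e c = 0"
    by metis
  \<comment> \<open>The derivative of the lifted relation at \<open>\<epsilon> = 0\<close>.\<close>
  define w where "w = (\<Sum>e\<in>R. (- (s * y e c)) *\<^sub>R g e)"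
  have "w \<in> span (\<Union>e\<in>R. kernel_perturbed j c s 0 e)"
  proof (rule first_order_stable)
    fix \<epsilon> :: real
    have "(\<Sum>e\<in>R. y e + \<epsilon> *\<^sub>R (- (s * y e c)) *\<^sub>R g e) \<in> span (\<Union>e\<in>R. kernel_perturbed j c s \<epsilon> e)"
    proof (rule span_sum)
      fix e assume e: "e \<in> R"
      show "y e + \<epsilon> *\<^sub>R (- (s * y e c)) *\<^sub>R g e \<in> span (\<Union>e\<in>R. kernel_perturbed j c s \<epsilon> e)"
        using perturbed_vector[of e "y e" j c "g e" \<epsilon> s] e R j y(1) g[OF e] by (intro span_base) blast
    qed
    also have "(\<Sum>e\<in>R. y e + \<epsilon> *\<^sub>R (- (s * y e c)) *\<^sub>R g e) = \<epsilon> *\<^sub>R w"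
      unfolding w_def scaleR_sum_right sum.distrib y(2) by simp
    finally show "\<epsilon> *\<^sub>R w \<in> span (\<Union>e\<in>R. kernel_perturbed j c s \<epsilon> e)" .
  next
    fix v assume "v \<in> (\<Union>e\<in>R. kernel_perturbed j c s 0 e)"
    then show "liftable (\<lambda>\<epsilon>. \<Union>e\<in>R. kernel_perturbed j c s \<epsilon> e) v"
      by (intro perturbed_liftable[OF R j x'])
  next
    fix \<delta> :: real assume "\<delta> > 0"
    then show "\<exists>\<epsilon>. \<epsilon> \<noteq> 0 \<and> \<bar>\<epsilon>\<bar> < \<delta> \<and> dim (\<Union>e\<in>R. kernel_perturbed j c s \<epsilon> e)
        \<le> dim (\<Union>e\<in>R. kernel_perturbed j c s 0 e)"
      using stable unfolding kernel_perturbed_0 by blast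
  qed (use fin_dim_kernel_perturbed[OF R] in blast)
  then have w: "w \<in> span ?K" unfolding kernel_perturbed_0 .
  have "(\<Sum>e\<in>R. (s * y e c) *\<^sub>R (x j e - g e)) \<in> span ?K"
  proof (rule span_sum)
    fix e assume e: "e \<in> R"
    show "(s * y e c) *\<^sub>R (x j e - g e) \<in> span ?K"
    proof (cases "y e c = 0")
      case False
      have "x j e - g e \<in> kernel e"
        using g[OF e False] e R j anchor_in_U[of e j] T_anchor[of e _ j] subspace_U[of e]
        by (auto simp: kernel_def subspace_diff linear_diff[OF linear_T])
      then show ?thesis using e by (intro span_scale span_base) blast
    qed (simp add: span_zero)
  qed
  from span_diff[OF this w] have "(\<Sum>e\<in>R. (s * y e c) *\<^sub>R x j e) \<in> span ?K"
    by (simp add: w_def scaleR_diff_right sum_subtractf sum_negf)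
  from span_scale[OF this, of "1 / s"] show ?thesis
    using \<open>s \<noteq> 0\<close> by (simp add: scaleR_sum_right)
qed

lemma truncation_partition_dims:
  assumes relation: "\<And>R y j c. R \<subseteq> Q \<Longrightarrow> j \<in> J \<Longrightarrow> (\<And>e. e \<in> R \<Longrightarrow> y e \<in> kernel e) \<Longrightarrow> (\<Sum>e\<in>R. y e) = 0 \<Longrightarrow>
        (\<Sum>e\<in>R. y e c *\<^sub>R x j e) \<in> span (\<Union>e\<in>R. kernel e)"
    and "S \<subseteq> Q"
  shows "\<exists>P. partition_on S P \<and>
    (\<Sum>R\<in>P. int (dim (\<Union>e\<in>R. U e)) - int (card J)) \<le> int (dim (\<Union>e\<in>S. kernel e))"
proof -
  have "\<exists>P. partition_on S P \<and>
    (\<Sum>R\<in>P. int (dim (\<Union>e\<in>R. kernel e \<union> (\<lambda>j. x j e) ` J)) - int (card J)) \<le> int (dim (\<Union>e\<in>S. kernel e))"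
  proof (rule truncation_partition)
    show "finite S" by (rule finite_subset[OF assms(2) finite_Q])
    fix e assume "e \<in> S"
    then have e: "e \<in> Q" using assms(2) by blast
    show "subspace (kernel e)" by (rule subspace_kernel[OF e])
    show "fin_dim (kernel e)" by (rule fin_dim_subset[OF fin_dim_U[OF e] kernel_subset_U])
  next
    fix R y j c
    assume "R \<subseteq> S" "j \<in> J" "\<And>e. e \<in> R \<Longrightarrow> y e \<in> kernel e" "(\<Sum>e\<in>R. y e) = 0"
    then show "(\<Sum>e\<in>R. y e c *\<^sub>R x j e) \<in> span (\<Union>e\<in>R. kernel e)"
      using assms(2) by (intro relation) auto
  qed (rule finite_J)
  then obtain P where P: "partition_on S P"
    "(\<Sum>R\<in>P. int (dim (\<Union>e\<in>R. kernel e \<union> (\<lambda>j. x j e) ` J)) - int (card J)) \<le> int (dim (\<Union>e\<in>S. kernel e))"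
    by blast
  have "dim (\<Union>e\<in>R. kernel e \<union> (\<lambda>j. x j e) ` J) = dim (\<Union>e\<in>R. U e)" if "R \<in> P" for R
  proof -
    have "R \<subseteq> Q" using that P(1) assms(2) by (auto simp: partition_on_def)
    from kernel_anchors_span_U[OF this] show ?thesis by (rule span_eq_dim)
  qed
  then show ?thesis using P by (intro exI[of _ P]) simp
qed

end

section \<open>Generic coordinates\<close>

lemma algebraically_independent_cong:
  assumes "\<And>i. i \<in> I \<Longrightarrow> z i = z' i"
  shows "algebraically_independent I z \<longleftrightarrow> algebraically_independent I z'"
proof -
  have "eval_poly z q = eval_poly z' q" if "\<forall>m\<in>Poly_Mapping.keys q. Poly_Mapping.keys m \<subseteq> I" for q
    unfolding eval_poly_def
  proof (rule sum.cong[OF refl])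
    fix m assume "m \<in> Poly_Mapping.keys q"
    then have "(\<Prod>i\<in>Poly_Mapping.keys m. z i ^ Poly_Mapping.lookup m i)
        = (\<Prod>i\<in>Poly_Mapping.keys m. z' i ^ Poly_Mapping.lookup m i)"
      using that by (intro prod.cong[OF refl]) (metis assms subsetD)
    then show "of_rat (Poly_Mapping.lookup q m) * (\<Prod>i\<in>Poly_Mapping.keys m. z i ^ Poly_Mapping.lookup m i)
        = of_rat (Poly_Mapping.lookup q m) * (\<Prod>i\<in>Poly_Mapping.keys m. z' i ^ Poly_Mapping.lookup m i)"
      by simp
  qed
  then show ?thesis by (auto simp: algebraically_independent_def)
qed

text \<open>A finitely supported function is determined by its graph over its support, which is a finite
  subset of a countable set.\<close>

lemma countable_finitely_supported:
  assumes "countable (M :: 'a set)"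
  shows "countable {q :: 'a \<Rightarrow>\<^sub>0 'b::{countable,zero}. Poly_Mapping.keys q \<subseteq> M}"
proof -
  define graph :: "('a \<Rightarrow>\<^sub>0 'b) \<Rightarrow> ('a \<times> 'b) set" where
    "graph q = (\<lambda>m. (m, Poly_Mapping.lookup q m)) ` Poly_Mapping.keys q" for q
  have "inj graph"
  proof (rule injI, rule poly_mapping_eqI)
    fix q r :: "'a \<Rightarrow>\<^sub>0 'b" and m
    assume eq: "graph q = graph r"
    have *: "(m, c) \<in> graph s \<longleftrightarrow> c \<noteq> 0 \<and> Poly_Mapping.lookup s m = c" for s c
      by (auto simp: graph_def in_keys_iff)
    show "Poly_Mapping.lookup q m = Poly_Mapping.lookup r m"
      using *[of _ q] *[of _ r] unfolding eq by metis
  qed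
  moreover have "countable (graph ` {q. Poly_Mapping.keys q \<subseteq> M})"
  proof (rule countable_subset)
    show "graph ` {q. Poly_Mapping.keys q \<subseteq> M} \<subseteq> {F. finite F \<and> F \<subseteq> M \<times> UNIV}"
      by (auto simp: graph_def)
    show "countable {F. finite F \<and> F \<subseteq> M \<times> (UNIV :: 'b set)}"
      using assms by (intro countable_Collect_finite_subset) auto
  qed
  ultimately show ?thesis by (metis (no_types, lifting) countable_image_inj_on inj_on_subset subset_UNIV)
qed

lemma countable_polynomials:
  assumes "finite I"
  shows "countable {q :: ('i \<Rightarrow>\<^sub>0 nat) \<Rightarrow>\<^sub>0 rat. \<forall>m\<in>Poly_Mapping.keys q. Poly_Mapping.keys m \<subseteq> I}"
proof -
  have "countable {m :: 'i \<Rightarrow>\<^sub>0 nat. Poly_Mapping.keys m \<subseteq> I}"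
    using assms by (intro countable_finitely_supported countable_finite)
  from countable_finitely_supported[OF this] show ?thesis
    by (rule countable_subset[rotated]) auto
qed

text \<open>The coefficient of the \<open>n\<close>-th power of the indeterminate \<open>j\<close>, as a polynomial in the
  other indeterminates.\<close>

definition slice :: "'i \<Rightarrow> nat \<Rightarrow> (('i \<Rightarrow>\<^sub>0 nat) \<Rightarrow>\<^sub>0 rat) \<Rightarrow> (('i \<Rightarrow>\<^sub>0 nat) \<Rightarrow>\<^sub>0 rat)" where
  "slice j n q = Abs_poly_mapping (\<lambda>m. if Poly_Mapping.lookup m j = 0
      then Poly_Mapping.lookup q (m + Poly_Mapping.single j n) else 0)"

lemma lookup_slice:
  "Poly_Mapping.lookup (slice j n q) m = (if Poly_Mapping.lookup m j = 0
      then Poly_Mapping.lookup q (m + Poly_Mapping.single j n) else 0)"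
proof -
  let ?h = "\<lambda>m. m + Poly_Mapping.single j n"
  have "finite (?h -` Poly_Mapping.keys q)" by (intro finite_vimageI) (auto simp: inj_def)
  then have "finite {m. (if Poly_Mapping.lookup m j = 0 then Poly_Mapping.lookup q (?h m) else 0) \<noteq> 0}"
    by (rule finite_subset[rotated]) (auto simp: in_keys_iff split: if_splits)
  then show ?thesis by (simp add: slice_def)
qed

lemma keys_slice:
  "Poly_Mapping.keys (slice j n q)
    = {m. Poly_Mapping.lookup m j = 0 \<and> m + Poly_Mapping.single j n \<in> Poly_Mapping.keys q}"
  by (auto simp: in_keys_iff lookup_slice split: if_splits)

lemma shift_keys_slice:
  "(\<lambda>m. m + Poly_Mapping.single j n) ` Poly_Mapping.keys (slice j n q)
    = {m \<in> Poly_Mapping.keys q. Poly_Mapping.lookup m j = n}"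
proof (intro equalityI subsetI)
  fix m assume m: "m \<in> {m \<in> Poly_Mapping.keys q. Poly_Mapping.lookup m j = n}"
  define k where "k = m - Poly_Mapping.single j n"
  have "m = k + Poly_Mapping.single j n"
    using m by (intro poly_mapping_eqI) (auto simp: k_def lookup_add lookup_minus lookup_single when_def)
  moreover have "Poly_Mapping.lookup k j = 0"
    using m by (auto simp: k_def lookup_minus)
  ultimately show "m \<in> (\<lambda>m. m + Poly_Mapping.single j n) ` Poly_Mapping.keys (slice j n q)"
    using m by (auto simp: keys_slice)
qed (auto simp: keys_slice lookup_add)

lemma keys_remove_shift:
  assumes "Poly_Mapping.lookup m j = 0"
  shows "Poly_Mapping.keys (m + Poly_Mapping.single j n) - {j} = Poly_Mapping.keys m"
  using assms by (auto simp: in_keys_iff lookup_add lookup_single when_def split: if_splits)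

lemma eval_poly_slices:
  "eval_poly (z(j := t)) q
    = (\<Sum>n\<in>(\<lambda>m. Poly_Mapping.lookup m j) ` Poly_Mapping.keys q. eval_poly z (slice j n q) * t ^ n)"
proof -
  define c where "c m = of_rat (Poly_Mapping.lookup q m) *
    (\<Prod>i\<in>Poly_Mapping.keys m - {j}. z i ^ Poly_Mapping.lookup m i)" for m
  have "eval_poly (z(j := t)) q = (\<Sum>m\<in>Poly_Mapping.keys q. c m * t ^ Poly_Mapping.lookup m j)"
    unfolding eval_poly_def
  proof (rule sum.cong[OF refl])
    fix m
    have "(\<Prod>i\<in>Poly_Mapping.keys m. (z(j := t)) i ^ Poly_Mapping.lookup m i)
      = (\<Prod>i\<in>insert j (Poly_Mapping.keys m). (z(j := t)) i ^ Poly_Mapping.lookup m i)"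
      by (rule prod.mono_neutral_left) (auto simp: in_keys_iff)
    also have "\<dots> = t ^ Poly_Mapping.lookup m j *
        (\<Prod>i\<in>Poly_Mapping.keys m - {j}. (z(j := t)) i ^ Poly_Mapping.lookup m i)"
      by (subst prod.insert_remove) auto
    also have "(\<Prod>i\<in>Poly_Mapping.keys m - {j}. (z(j := t)) i ^ Poly_Mapping.lookup m i)
      = (\<Prod>i\<in>Poly_Mapping.keys m - {j}. z i ^ Poly_Mapping.lookup m i)"
      by (rule prod.cong) auto
    finally show "of_rat (Poly_Mapping.lookup q m) *
        (\<Prod>i\<in>Poly_Mapping.keys m. (z(j := t)) i ^ Poly_Mapping.lookup m i) = c m * t ^ Poly_Mapping.lookup m j"
      by (simp add: c_def)
  qed
  also have "\<dots> = (\<Sum>n\<in>(\<lambda>m. Poly_Mapping.lookup m j) ` Poly_Mapping.keys q.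
      \<Sum>m | m \<in> Poly_Mapping.keys q \<and> Poly_Mapping.lookup m j = n. c m * t ^ Poly_Mapping.lookup m j)"
    by (rule sum.image_gen) simp
  also have "\<dots> = (\<Sum>n\<in>(\<lambda>m. Poly_Mapping.lookup m j) ` Poly_Mapping.keys q. eval_poly z (slice j n q) * t ^ n)"
  proof (rule sum.cong[OF refl])
    fix n :: nat
    let ?h = "\<lambda>m. m + Poly_Mapping.single j n"
    have "(\<Sum>m | m \<in> Poly_Mapping.keys q \<and> Poly_Mapping.lookup m j = n. c m * t ^ Poly_Mapping.lookup m j)
      = (\<Sum>m\<in>?h ` Poly_Mapping.keys (slice j n q). c m * t ^ Poly_Mapping.lookup m j)"
      by (simp only: shift_keys_slice)
    also have "\<dots> = (\<Sum>m\<in>Poly_Mapping.keys (slice j n q). c (?h m) * t ^ Poly_Mapping.lookup (?h m) j)"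
      by (subst sum.reindex) (auto simp: inj_on_def)
    also have "\<dots> = eval_poly z (slice j n q) * t ^ n"
      unfolding eval_poly_def sum_distrib_right
    proof (rule sum.cong[OF refl])
      fix m assume m: "m \<in> Poly_Mapping.keys (slice j n q)"
      then have j: "Poly_Mapping.lookup m j = 0" by (simp add: keys_slice)
      have "(\<Prod>i\<in>Poly_Mapping.keys m. z i ^ Poly_Mapping.lookup (?h m) i)
        = (\<Prod>i\<in>Poly_Mapping.keys m. z i ^ Poly_Mapping.lookup m i)"
        using j by (intro prod.cong) (auto simp: lookup_add lookup_single when_def in_keys_iff)
      then show "c (?h m) * t ^ Poly_Mapping.lookup (?h m) j = of_rat (Poly_Mapping.lookup (slice j n q) m) *
          (\<Prod>i\<in>Poly_Mapping.keys m. z i ^ Poly_Mapping.lookup m i) * t ^ n"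
        using j by (simp add: c_def keys_remove_shift lookup_slice lookup_add)
    qed
    finally show "(\<Sum>m | m \<in> Poly_Mapping.keys q \<and> Poly_Mapping.lookup m j = n. c m * t ^ Poly_Mapping.lookup m j)
      = eval_poly z (slice j n q) * t ^ n" .
  qed
  finally show ?thesis .
qed

text \<open>A value \<open>t\<close> is bad if it is a root of some nonzero polynomial in one variable whose coefficients
  are the values at \<open>z\<close> of rational polynomials. One of these coefficients is the value of a nonzero
  slice and hence nonzero. There are countably many such polynomials, each with finitely many roots.\<close>

lemma countable_dependent_extensions:
  assumes "finite I" "j \<notin> I" and indep: "algebraically_independent I z"
  shows "countable {t. \<not> algebraically_independent (insert j I) (z(j := t))}"
proof -
  let ?Q = "{q :: ('a \<Rightarrow>\<^sub>0 nat) \<Rightarrow>\<^sub>0 rat. \<forall>m\<in>Poly_Mapping.keys q. Poly_Mapping.keys m \<subseteq> insert j I} - {0}"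
  have roots: "finite {t. eval_poly (z(j := t)) q = 0}" if q: "q \<in> ?Q" for q
  proof -
    let ?N = "(\<lambda>m. Poly_Mapping.lookup m j) ` Poly_Mapping.keys q"
    define P where "P = (\<Sum>n\<in>?N. monom (eval_poly z (slice j n q)) n)"
    have eval: "poly P t = eval_poly (z(j := t)) q" for t
      by (simp add: P_def eval_poly_slices poly_sum poly_monom)
    obtain m where m: "m \<in> Poly_Mapping.keys q" using q by fastforce
    let ?n = "Poly_Mapping.lookup m j"
    have "slice j ?n q \<noteq> 0"
    proof
      assume "slice j ?n q = 0"
      then have "{m' \<in> Poly_Mapping.keys q. Poly_Mapping.lookup m' j = ?n} = {}"
        using shift_keys_slice[of j ?n q] by simp
      then show False using m by blast
    qed
    moreover have "Poly_Mapping.keys m' \<subseteq> I" if m': "m' \<in> Poly_Mapping.keys (slice j ?n q)" for m'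
    proof -
      have "Poly_Mapping.keys m' = Poly_Mapping.keys (m' + Poly_Mapping.single j ?n) - {j}"
        using m' keys_remove_shift[of m' j ?n] by (simp add: keys_slice)
      also have "\<dots> \<subseteq> I" using m' q by (auto simp: keys_slice)
      finally show ?thesis .
    qed
    ultimately have "eval_poly z (slice j ?n q) \<noteq> 0"
      using indep unfolding algebraically_independent_def by blast
    moreover have "coeff P ?n = eval_poly z (slice j ?n q)"
      using m by (simp add: P_def coeff_sum)
    ultimately have "P \<noteq> 0" by auto
    then show ?thesis using poly_roots_finite[of P] by (simp add: eval)
  qed
  have "countable (\<Union>q\<in>?Q. {t. eval_poly (z(j := t)) q = 0})"
    using assms(1) roots by (intro countable_UN countable_Diff countable_polynomials countable_finite) auto
  moreover have "{t. \<not> algebraically_independent (insert j I) (z(j := t))}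
    \<subseteq> (\<Union>q\<in>?Q. {t. eval_poly (z(j := t)) q = 0})"
    by (auto simp: algebraically_independent_def)
  ultimately show ?thesis by (rule countable_subset[rotated])
qed

lemma algebraically_independent_subset:
  "algebraically_independent I z \<Longrightarrow> J \<subseteq> I \<Longrightarrow> algebraically_independent J z"
  unfolding algebraically_independent_def by (blast dest: subset_trans)

lemma algebraically_independent_exists:
  assumes "finite I"
  shows "\<exists>z. algebraically_independent I z"
  using assms
proof (induction I rule: finite_induct)
  case empty
  have "q = 0" if "\<forall>m\<in>Poly_Mapping.keys q. Poly_Mapping.keys m \<subseteq> {}" "eval_poly z q = 0" for z :: "'a \<Rightarrow> real" and q
  proof (rule ccontr)
    assume "q \<noteq> 0"
    then obtain m where m: "m \<in> Poly_Mapping.keys q" by fastforce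
    then have "m = 0" using that(1) by auto
    then have "Poly_Mapping.keys q = {0}" using that(1) m by auto
    then have "Poly_Mapping.lookup q 0 = 0" using that(2) by (simp add: eval_poly_def)
    then show False using \<open>Poly_Mapping.keys q = {0}\<close> by (auto simp: in_keys_iff set_eq_iff)
  qed
  then show ?case unfolding algebraically_independent_def by blast
next
  case (insert j I)
  then obtain z where "algebraically_independent I z" by blast
  from countable_dependent_extensions[OF insert.hyps this]
  have "{t. \<not> algebraically_independent (insert j I) (z(j := t))} \<noteq> UNIV"
    using uncountable_UNIV_real by metis
  then show ?case by blast
qed

lemma algebraically_independent_perturb:
  assumes "finite I" "j \<in> I" "algebraically_independent I z" "\<delta> > 0"
  obtains \<epsilon> where "\<epsilon> \<noteq> 0" "\<bar>\<epsilon>\<bar> < \<delta>" "algebraically_independent I (z(j := z j + \<epsilon>))"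
proof -
  let ?bad = "{t. \<not> algebraically_independent (insert j (I - {j})) (z(j := t))}"
  have "countable ?bad"
    using assms(1) algebraically_independent_subset[OF assms(3), of "I - {j}"]
    by (intro countable_dependent_extensions) auto
  moreover have "uncountable {z j<..<z j + \<delta>}" using assms(4) by (simp add: uncountable_open_interval)
  ultimately have "\<not> {z j<..<z j + \<delta>} \<subseteq> ?bad" using countable_subset by blast
  then obtain t where "t \<in> {z j<..<z j + \<delta>}" "t \<notin> ?bad" by blast
  then show ?thesis using assms(2) that[of "t - z j"] by (auto simp: insert_absorb)
qed

text \<open>Otherwise the difference of the two indeterminates would be an algebraic relation.\<close>

lemma algebraically_independent_inj:
  assumes "algebraically_independent I z" "i \<in> I" "j \<in> I" "i \<noteq> j"
  shows "z i \<noteq> z j"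
proof
  assume eq: "z i = z j"
  define q :: "('a \<Rightarrow>\<^sub>0 nat) \<Rightarrow>\<^sub>0 rat" where
    "q = Poly_Mapping.single (Poly_Mapping.single i 1) 1 - Poly_Mapping.single (Poly_Mapping.single j 1) 1"
  have ne: "Poly_Mapping.single i (1::nat) \<noteq> Poly_Mapping.single j 1"
    using assms(4) by (metis keys_single one_neq_zero singleton_inject)
  then have lookup: "Poly_Mapping.lookup q (Poly_Mapping.single i 1) = 1"
      "Poly_Mapping.lookup q (Poly_Mapping.single j 1) = - 1"
    by (auto simp: q_def lookup_minus lookup_single when_def)
  have keys: "Poly_Mapping.keys q = {Poly_Mapping.single i 1, Poly_Mapping.single j 1}"
    using ne by (auto simp: q_def in_keys_iff lookup_minus lookup_single when_def split: if_splits)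
  have "eval_poly z q = 0"
    unfolding eval_poly_def keys using ne eq lookup by (simp add: of_rat_minus)
  moreover have "\<forall>m\<in>Poly_Mapping.keys q. Poly_Mapping.keys m \<subseteq> I"
    using assms by (simp add: keys)
  ultimately have "q = 0" using assms(1) unfolding algebraically_independent_def by blast
  then show False using keys by simp
qed

definition generic_coordinates :: "'v point_line_graph \<Rightarrow> 'v coordinate set" where
  "generic_coordinates G = X ` points G \<union> Y ` points G \<union> A ` lines G"

text \<open>Clauses \<open>X u\<close> and \<open>A u\<close> coincide because the type of frameworks stores the abscissa of a point and
  the slope of a line in the same component.\<close>

fun perturb :: "'v coordinate \<Rightarrow> real \<Rightarrow> ('v \<Rightarrow> real \<times> real) \<Rightarrow> 'v \<Rightarrow> real \<times> real" where
  "perturb (X u) \<epsilon> p = p(u := (fst (p u) + \<epsilon>, snd (p u)))"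
| "perturb (Y u) \<epsilon> p = p(u := (fst (p u), snd (p u) + \<epsilon>))"
| "perturb (A u) \<epsilon> p = p(u := (fst (p u) + \<epsilon>, snd (p u)))"
| "perturb (B u) \<epsilon> p = p(u := (fst (p u), snd (p u) + \<epsilon>))"

lemma generic_exists:
  assumes "is_point_line_graph G"
  shows "\<exists>p. generic G p"
proof -
  have "finite (generic_coordinates G)"
    using assms by (simp add: generic_coordinates_def is_point_line_graph_def)
  then obtain z where z: "algebraically_independent (generic_coordinates G) z"
    using algebraically_independent_exists by blast
  define p where "p v = (if v \<in> points G then (z (X v), z (Y v)) else (z (A v), 0))" for v
  have "z c = coord p c" if "c \<in> generic_coordinates G" for c
    using that assms by (auto simp: generic_coordinates_def p_def is_point_line_graph_def)
  with z show ?thesis unfolding generic_def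
    by (metis algebraically_independent_cong generic_coordinates_def)
qed

lemma generic_perturb:
  assumes G: "is_point_line_graph G" and "generic G p" "c \<in> generic_coordinates G" "\<delta> > 0"
  obtains \<epsilon> where "\<epsilon> \<noteq> 0" "\<bar>\<epsilon>\<bar> < \<delta>" "generic G (perturb c \<epsilon> p)"
proof -
  have "finite (generic_coordinates G)"
    using assms by (simp add: generic_coordinates_def is_point_line_graph_def)
  then obtain \<epsilon> where \<epsilon>: "\<epsilon> \<noteq> 0" "\<bar>\<epsilon>\<bar> < \<delta>"
      "algebraically_independent (generic_coordinates G) ((coord p)(c := coord p c + \<epsilon>))"
    using algebraically_independent_perturb[of "generic_coordinates G" c "coord p" \<delta>] assms(2-4)
    unfolding generic_def generic_coordinates_def[symmetric] by metis
  have "((coord p)(c := coord p c + \<epsilon>)) d = coord (perturb c \<epsilon> p) d" if "d \<in> generic_coordinates G" for d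
    using that assms(3) G by (cases d; cases c) (auto simp: generic_coordinates_def is_point_line_graph_def)
  then have "generic G (perturb c \<epsilon> p)"
    using \<epsilon>(3) unfolding generic_def generic_coordinates_def[symmetric]
    by (metis algebraically_independent_cong)
  then show ?thesis using \<epsilon> that by blast
qed

section \<open>Vectors with prescribed support\<close>

definition unit :: "'c \<Rightarrow> 'c \<Rightarrow> real" where
  "unit c = (\<lambda>d. if d = c then 1 else 0)"

definition supported :: "'c set \<Rightarrow> ('c \<Rightarrow> real) set" where
  "supported C = {v. \<forall>c. c \<notin> C \<longrightarrow> v c = 0}"

lemma unit_apply: "unit c d = (if d = c then 1 else 0)"
  by (simp add: unit_def)

lemma subspace_supported: "subspace (supported C)"
  by (auto simp: subspace_def supported_def)

lemma unit_in_supported [simp]: "unit c \<in> supported C \<longleftrightarrow> c \<in> C"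
  by (auto simp: supported_def unit_def)

lemma supported_mono: "C \<subseteq> D \<Longrightarrow> supported C \<subseteq> supported D"
  by (auto simp: supported_def)

lemma supported_expand:
  assumes "finite C" "v \<in> supported C"
  shows "v = (\<Sum>c\<in>C. v c *\<^sub>R unit c)"
proof
  fix d
  have "(\<Sum>c\<in>C. v c *\<^sub>R unit c) d = (\<Sum>c\<in>C. if c = d then v c else 0)"
    unfolding sum_fun_apply by (intro sum.cong) (auto simp: unit_apply)
  then show "v d = (\<Sum>c\<in>C. v c *\<^sub>R unit c) d" using assms by (auto simp: supported_def)
qed

lemma linear_supported:
  fixes f :: "('c \<Rightarrow> real) \<Rightarrow> real"
  assumes "linear f" "finite C" "v \<in> supported C"
  shows "f v = (\<Sum>c\<in>C. v c * f (unit c))"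
  by (subst supported_expand[OF assms(2,3)])
    (simp add: linear_sum[OF assms(1)] linear_cmul[OF assms(1)])

lemma supported_eq_span: "finite C \<Longrightarrow> supported C = span (unit ` C)"
proof (intro equalityI subsetI)
  fix v :: "'a \<Rightarrow> real" assume "finite C" "v \<in> supported C"
  then have "v = (\<Sum>c\<in>C. v c *\<^sub>R unit c)" by (rule supported_expand)
  also have "\<dots> \<in> span (unit ` C)" by (intro span_sum span_scale span_base) auto
  finally show "v \<in> span (unit ` C)" .
next
  fix v :: "'a \<Rightarrow> real" assume "v \<in> span (unit ` C)"
  moreover have "span (unit ` C) \<subseteq> supported C"
    by (intro span_minimal subspace_supported) auto
  ultimately show "v \<in> supported C" by blast
qed

lemma unit_independent:
  assumes "finite C"
  shows "inj_on unit C" "independent (unit ` C)"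
proof -
  have "\<forall>c\<in>C. a c = 0" if a: "(\<Sum>c\<in>C. a c *\<^sub>R unit c) = 0" for a :: "'a \<Rightarrow> real"
  proof
    fix d assume "d \<in> C"
    have "(\<Sum>c\<in>C. a c *\<^sub>R unit c) d = (\<Sum>c\<in>C. if c = d then a c else 0)"
      unfolding sum_fun_apply by (intro sum.cong) (auto simp: unit_apply)
    then show "a d = 0" using a \<open>d \<in> C\<close> assms by simp
  qed
  note * = this
  show "inj_on unit C" by (rule independent_family(1)[OF assms]) (rule *)
  show "independent (unit ` C)" by (rule independent_family(2)[OF assms]) (rule *)
qed

lemma dim_units: "finite C \<Longrightarrow> dim (unit ` C) = card C"
  using unit_independent[of C] by (simp add: dim_eq_card_independent card_image)

lemma fin_dim_supported: "finite C \<Longrightarrow> fin_dim (supported C)"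
  by (rule fin_dimI[of "unit ` C"]) (auto simp: supported_eq_span)

lemma dim_UN_supported:
  assumes "finite I" "\<And>i. i \<in> I \<Longrightarrow> finite (C i)"
  shows "dim (\<Union>i\<in>I. supported (C i)) = card (\<Union>i\<in>I. C i)"
proof -
  have "span (\<Union>i\<in>I. supported (C i)) = span (unit ` (\<Union>i\<in>I. C i))"
    unfolding span_eq
  proof
    have "supported (C i) \<subseteq> supported (\<Union>i\<in>I. C i)" if "i \<in> I" for i
      using that by (intro supported_mono) auto
    then show "(\<Union>i\<in>I. supported (C i)) \<subseteq> span (unit ` (\<Union>i\<in>I. C i))"
      using supported_eq_span[of "\<Union>i\<in>I. C i"] assms by blast
    have "unit ` (\<Union>i\<in>I. C i) \<subseteq> (\<Union>i\<in>I. supported (C i))" by auto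
    then show "unit ` (\<Union>i\<in>I. C i) \<subseteq> span (\<Union>i\<in>I. supported (C i))"
      by (rule subset_trans[OF _ span_superset])
  qed
  then have "dim (\<Union>i\<in>I. supported (C i)) = dim (unit ` (\<Union>i\<in>I. C i))" by (rule span_eq_dim)
  then show ?thesis using dim_units[of "\<Union>i\<in>I. C i"] assms by simp
qed

section \<open>Resultants and moment on the columns of the rigidity matrix\<close>

definition planar_coords :: "'v point_line_graph \<Rightarrow> 'v set \<Rightarrow> 'v coordinate set" where
  "planar_coords G e = X ` (e \<inter> points G) \<union> Y ` (e \<inter> points G) \<union> B ` (e \<inter> lines G)"

definition slope_coords :: "'v point_line_graph \<Rightarrow> 'v set \<Rightarrow> 'v coordinate set" where
  "slope_coords G e = A ` (e \<inter> lines G)"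

text \<open>The pairing with the translation in direction \<open>(1, 0)\<close>: it moves all points horizontally and changes
  the coordinate \<open>b\<close> of each line by the same amount.\<close>

definition resultant_x :: "'v point_line_graph \<Rightarrow> ('v coordinate \<Rightarrow> real) \<Rightarrow> real" where
  "resultant_x G v = (\<Sum>u\<in>points G. v (X u)) + (\<Sum>l\<in>lines G. v (B l))"

text \<open>The pairing with the translation in direction \<open>(0, 1)\<close>, under which the line \<open>x = a y + b\<close> moves to the
  line with \<open>b\<close> replaced by \<open>b - a\<close>.\<close>

definition resultant_y :: "'v point_line_graph \<Rightarrow> ('v \<Rightarrow> real \<times> real) \<Rightarrow> ('v coordinate \<Rightarrow> real) \<Rightarrow> real" where
  "resultant_y G p v = (\<Sum>u\<in>points G. v (Y u)) - (\<Sum>l\<in>lines G. fst (p l) * v (B l))"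

definition resultant :: "'v point_line_graph \<Rightarrow> ('v \<Rightarrow> real \<times> real) \<Rightarrow> bool \<Rightarrow> ('v coordinate \<Rightarrow> real) \<Rightarrow> real" where
  "resultant G p horizontal = (if horizontal then resultant_x G else resultant_y G p)"

text \<open>The pairing with an infinitesimal rotation. The rigidity matrix is normalized in such a way that this
  motion has entry \<open>1\<close> in every column \<open>A l\<close> and \<open>0\<close> in every column \<open>B l\<close>.\<close>

definition moment :: "'v point_line_graph \<Rightarrow> ('v \<Rightarrow> real \<times> real) \<Rightarrow> ('v coordinate \<Rightarrow> real) \<Rightarrow> real" where
  "moment G p v = (\<Sum>u\<in>points G. snd (p u) * v (X u) - fst (p u) * v (Y u)) + (\<Sum>l\<in>lines G. v (A l))"

text \<open>The result of the first truncation: loads on the columns \<open>X\<close>, \<open>Y\<close>, \<open>B\<close> of an edge without resultant.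
  They depend only on the slopes of the lines.\<close>

definition balanced :: "'v point_line_graph \<Rightarrow> ('v \<Rightarrow> real \<times> real) \<Rightarrow> 'v set \<Rightarrow> ('v coordinate \<Rightarrow> real) set" where
  "balanced G p e = {v \<in> supported (planar_coords G e). \<forall>b. resultant G p b v = 0}"

text \<open>The domain of the second truncation: a balanced load together with arbitrary entries in the slope
  columns, which do not contribute to the resultants.\<close>

definition forces :: "'v point_line_graph \<Rightarrow> ('v \<Rightarrow> real \<times> real) \<Rightarrow> 'v set \<Rightarrow> ('v coordinate \<Rightarrow> real) set" where
  "forces G p e = {v \<in> supported (planar_coords G e \<union> slope_coords G e). \<forall>b. resultant G p b v = 0}"

definition equilibrium :: "'v point_line_graph \<Rightarrow> ('v \<Rightarrow> real \<times> real) \<Rightarrow> 'v set \<Rightarrow> ('v coordinate \<Rightarrow> real) set" where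
  "equilibrium G p e = {v \<in> forces G p e. moment G p v = 0}"

lemma linear_resultant: "linear (resultant G p b)"
  unfolding resultant_def resultant_x_def resultant_y_def
  by (cases b) (auto intro!: linearI simp: sum.distrib sum_distrib_left algebra_simps sum_subtractf)

lemma linear_moment: "linear (moment G p)"
  unfolding moment_def
  by (auto intro!: linearI simp: sum.distrib sum_distrib_left algebra_simps sum_subtractf)

lemma resultant_apply: "resultant G p True = resultant_x G" "resultant G p False = resultant_y G p"
  by (simp_all add: resultant_def)

locale point_line =
  fixes G :: "'v point_line_graph"
  assumes point_line_graph: "is_point_line_graph G"
begin

lemma finite_points: "finite (points G)" and finite_lines: "finite (lines G)"
  and point_not_line: "u \<in> points G \<Longrightarrow> u \<notin> lines G"
  and line_not_point: "u \<in> lines G \<Longrightarrow> u \<notin> points G"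
  using point_line_graph by (auto simp: is_point_line_graph_def)

lemma finite_edges: "finite (edges G)"
  using point_line_graph by (intro finite_subset[of "edges G" "Pow (points G \<union> lines G)"])
    (auto simp: is_point_line_graph_def)

lemma edge_cases [consumes 1, case_names PP PL LL]:
  assumes "e \<in> edges G"
  obtains u w where "e = {u, w}" "u \<noteq> w" "u \<in> points G" "w \<in> points G"
  | u l where "e = {u, l}" "u \<in> points G" "l \<in> lines G"
  | l m where "e = {l, m}" "l \<noteq> m" "l \<in> lines G" "m \<in> lines G"
proof -
  have "card e = 2" "e \<subseteq> points G \<union> lines G"
    using assms point_line_graph by (auto simp: is_point_line_graph_def)
  then obtain u w where uw: "e = {u, w}" "u \<noteq> w" "u \<in> points G \<union> lines G" "w \<in> points G \<union> lines G"
    by (auto simp: card_2_iff)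
  have "e = {w, u}" using uw by auto
  with uw that show thesis by (metis UnE)
qed

lemma finite_planar_coords: "finite (planar_coords G e)"
  using finite_points finite_lines by (simp add: planar_coords_def)

lemma finite_slope_coords: "finite (slope_coords G e)"
  using finite_lines by (simp add: slope_coords_def)

lemma resultant_x_unit:
  "resultant_x G (unit c) = (case c of X u \<Rightarrow> if u \<in> points G then 1 else 0
     | B l \<Rightarrow> if l \<in> lines G then 1 else 0 | _ \<Rightarrow> 0)"
  using finite_points finite_lines by (simp add: resultant_x_def unit_apply split: coordinate.split)

lemma resultant_y_unit:
  "resultant_y G p (unit c) = (case c of Y u \<Rightarrow> if u \<in> points G then 1 else 0
     | B l \<Rightarrow> if l \<in> lines G then - fst (p l) else 0 | _ \<Rightarrow> 0)"
  using finite_points finite_lines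
  by (simp add: resultant_y_def unit_apply if_distrib[of "(*) _"] cong: if_cong split: coordinate.split)

lemma moment_unit:
  "moment G p (unit c) = (case c of X u \<Rightarrow> if u \<in> points G then snd (p u) else 0
     | Y u \<Rightarrow> if u \<in> points G then - fst (p u) else 0
     | A l \<Rightarrow> if l \<in> lines G then 1 else 0 | _ \<Rightarrow> 0)"
  using finite_points finite_lines
  by (simp add: moment_def unit_apply sum_subtractf if_distrib[of "(*) _"] cong: if_cong split: coordinate.split)

lemma functionals_PP:
  assumes "u \<noteq> w" "u \<in> points G" "w \<in> points G" "v \<in> supported {X u, X w, Y u, Y w}"
  shows "resultant_x G v = v (X u) + v (X w)" "resultant_y G p v = v (Y u) + v (Y w)"
    "moment G p v = snd (p u) * v (X u) + snd (p w) * v (X w) - fst (p u) * v (Y u) - fst (p w) * v (Y w)"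
  using linear_supported[OF linear_resultant[of G p True] _ assms(4)]
    linear_supported[OF linear_resultant[of G p False] _ assms(4)]
    linear_supported[OF linear_moment[of G p] _ assms(4)] assms(1-3)
  by (auto simp: resultant_apply resultant_x_unit resultant_y_unit moment_unit)

lemma functionals_PL:
  assumes "u \<in> points G" "l \<in> lines G" "v \<in> supported {X u, Y u, B l, A l}"
  shows "resultant_x G v = v (X u) + v (B l)" "resultant_y G p v = v (Y u) - fst (p l) * v (B l)"
    "moment G p v = snd (p u) * v (X u) - fst (p u) * v (Y u) + v (A l)"
  using linear_supported[OF linear_resultant[of G p True] _ assms(3)]
    linear_supported[OF linear_resultant[of G p False] _ assms(3)]
    linear_supported[OF linear_moment[of G p] _ assms(3)] assms(1-2)
  by (auto simp: resultant_apply resultant_x_unit resultant_y_unit moment_unit)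

lemma functionals_LL:
  assumes "l \<noteq> m" "l \<in> lines G" "m \<in> lines G" "v \<in> supported {B l, B m, A l, A m}"
  shows "resultant_x G v = v (B l) + v (B m)" "resultant_y G p v = - fst (p l) * v (B l) - fst (p m) * v (B m)"
    "moment G p v = v (A l) + v (A m)"
  using linear_supported[OF linear_resultant[of G p True] _ assms(4)]
    linear_supported[OF linear_resultant[of G p False] _ assms(4)]
    linear_supported[OF linear_moment[of G p] _ assms(4)] assms(1-3)
  by (auto simp: resultant_apply resultant_x_unit resultant_y_unit moment_unit)

lemma coords_PP:
  assumes "u \<in> points G" "w \<in> points G"
  shows "planar_coords G {u, w} = {X u, X w, Y u, Y w}" "slope_coords G {u, w} = {}"
  using assms point_not_line by (auto simp: planar_coords_def slope_coords_def)

lemma coords_PL: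
  assumes "u \<in> points G" "l \<in> lines G"
  shows "planar_coords G {u, l} = {X u, Y u, B l}" "slope_coords G {u, l} = {A l}"
  using assms point_not_line line_not_point by (auto simp: planar_coords_def slope_coords_def)

lemma coords_LL:
  assumes "l \<in> lines G" "m \<in> lines G"
  shows "planar_coords G {l, m} = {B l, B m}" "slope_coords G {l, m} = {A l, A m}"
  using assms line_not_point by (auto simp: planar_coords_def slope_coords_def)

lemma row_PP:
  assumes "u \<noteq> w" "u \<in> points G" "w \<in> points G"
  shows "rigidity_matrix G p {u, w} = (\<lambda>d. if d = X u then fst (p u) - fst (p w)
      else if d = X w then fst (p w) - fst (p u) else if d = Y u then snd (p u) - snd (p w)
      else if d = Y w then snd (p w) - snd (p u) else 0)"
proof
  have "{u, w} - {u} = {w}" "{u, w} - {w} = {u}" using assms(1) by auto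
  then have [simp]: "other_end {u, w} u = w" "other_end {u, w} w = u"
    by (simp_all only: other_end_def the_elem_eq)
  show "rigidity_matrix G p {u, w} d = (if d = X u then fst (p u) - fst (p w)
      else if d = X w then fst (p w) - fst (p u) else if d = Y u then snd (p u) - snd (p w)
      else if d = Y w then snd (p w) - snd (p u) else 0)" for d
    using assms point_not_line by (cases d) auto
qed

lemma row_PL:
  assumes "u \<in> points G" "l \<in> lines G"
  shows "rigidity_matrix G p {u, l} = (\<lambda>d. if d = X u then 1 else if d = Y u then - fst (p l)
      else if d = A l then - fst (p u) * fst (p l) - snd (p u) else if d = B l then - 1 else 0)"
proof
  have "u \<noteq> l" using assms point_not_line by blast
  then have "{u, l} - {u} = {l}" "{u, l} - {l} = {u}" by auto
  then have [simp]: "other_end {u, l} u = l" "other_end {u, l} l = u"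
    by (simp_all only: other_end_def the_elem_eq)
  show "rigidity_matrix G p {u, l} d = (if d = X u then 1 else if d = Y u then - fst (p l)
      else if d = A l then - fst (p u) * fst (p l) - snd (p u) else if d = B l then - 1 else 0)" for d
    using assms point_not_line line_not_point by (cases d) auto
qed

lemma row_LL:
  assumes "l \<noteq> m" "l \<in> lines G" "m \<in> lines G"
  obtains s :: real where "s \<noteq> 0"
    "\<And>p. rigidity_matrix G p {l, m} = (\<lambda>d. if d = A l then s else if d = A m then - s else 0)"
proof -
  have "{l, m} - {l} = {m}" "{l, m} - {m} = {l}" using assms(1) by auto
  then have other: "other_end {l, m} l = m" "other_end {l, m} m = l"
    by (simp_all only: other_end_def the_elem_eq)
  have "line_index G l \<noteq> line_index G m"
    using point_line_graph assms by (auto simp: is_point_line_graph_def bij_betw_def inj_on_def)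
  then have "rigidity_matrix G p {l, m} d = (if d = A l then if line_index G l < line_index G m then 1 else - 1
      else if d = A m then - (if line_index G l < line_index G m then 1 else - 1) else 0)" for p d
    using assms other line_not_point by (cases d) auto
  then show ?thesis
    by (intro that[of "if line_index G l < line_index G m then 1 else - 1"]) auto
qed

end


section \<open>Rows of a generic framework as the loads in equilibrium\<close>

locale generic_framework = point_line G for G :: "'v point_line_graph" +
  fixes p :: "'v \<Rightarrow> real \<times> real"
  assumes generic: "generic G p"
begin

lemma x_distinct: "u \<in> points G \<Longrightarrow> w \<in> points G \<Longrightarrow> u \<noteq> w \<Longrightarrow> fst (p u) \<noteq> fst (p w)"
  and y_distinct: "u \<in> points G \<Longrightarrow> w \<in> points G \<Longrightarrow> u \<noteq> w \<Longrightarrow> snd (p u) \<noteq> snd (p w)"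
  and slope_distinct: "l \<in> lines G \<Longrightarrow> m \<in> lines G \<Longrightarrow> l \<noteq> m \<Longrightarrow> fst (p l) \<noteq> fst (p m)"
  using algebraically_independent_inj[OF generic[unfolded generic_def], of "X u" "X w"]
    algebraically_independent_inj[OF generic[unfolded generic_def], of "Y u" "Y w"]
    algebraically_independent_inj[OF generic[unfolded generic_def], of "A l" "A m"]
  by auto

text \<open>The three functionals leave one degree of freedom on the columns of an edge. Genericity enters
  through distinct abscissae for an edge between points, and through distinct slopes for an edge between
  lines, where it forces the entries in the columns \<open>B\<close> to vanish.\<close>

lemma equilibrium_eq_span_row:
  assumes "e \<in> edges G"
  shows "equilibrium G p e = span {rigidity_matrix G p e}"
proof (intro equalityI subsetI)
  fix v assume "v \<in> equilibrium G p e"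
  then have v: "v \<in> supported (planar_coords G e \<union> slope_coords G e)"
      "resultant_x G v = 0" "resultant_y G p v = 0" "moment G p v = 0"
    using resultant_apply[of G p] unfolding equilibrium_def forces_def by (auto, metis+)
  have "\<exists>c. v = c *\<^sub>R rigidity_matrix G p e"
    using assms
  proof (cases rule: edge_cases)
    case (PP u w)
    have sup: "v \<in> supported {X u, X w, Y u, Y w}" using v(1) PP coords_PP by simp
    note eq = functionals_PP(1)[OF PP(2-4) sup, unfolded v(2)]
      functionals_PP(2)[OF PP(2-4) sup, of p, unfolded v(3)]
      functionals_PP(3)[OF PP(2-4) sup, of p, unfolded v(4)]
    define c where "c = v (X u) / (fst (p u) - fst (p w))"
    have ne: "fst (p u) - fst (p w) \<noteq> 0" using x_distinct PP by simp
    have 1: "v (X u) = c * (fst (p u) - fst (p w))" using ne by (simp add: c_def)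
    have 2: "v (X w) = - v (X u)" "v (Y w) = - v (Y u)" using eq(1,2) by simp_all
    have "(fst (p u) - fst (p w)) * v (Y u) = (snd (p u) - snd (p w)) * v (X u)"
      using eq(3) 2 by (simp add: algebra_simps)
    also have "\<dots> = (fst (p u) - fst (p w)) * (c * (snd (p u) - snd (p w)))"
      unfolding 1 by (simp only: mult_ac)
    finally have 3: "v (Y u) = c * (snd (p u) - snd (p w))" using ne by simp
    have "v = c *\<^sub>R rigidity_matrix G p e"
      using sup PP(2) 1 2 3
      by (auto simp: PP(1) row_PP[OF PP(2-4)] fun_eq_iff supported_def algebra_simps)
    then show ?thesis ..
  next
    case (PL u l)
    have sup: "v \<in> supported {X u, Y u, B l, A l}"
      using v(1) PL coords_PL[of u l] by (simp add: insert_commute)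
    note eq = functionals_PL(1)[OF PL(2,3) sup, unfolded v(2)]
      functionals_PL(2)[OF PL(2,3) sup, of p, unfolded v(3)]
      functionals_PL(3)[OF PL(2,3) sup, of p, unfolded v(4)]
    have "v (B l) = - v (X u)" using eq(1) by simp
    moreover from this have "v (Y u) = - fst (p l) * v (X u)" using eq(2) by simp
    moreover from this have "v (A l) = (- fst (p u) * fst (p l) - snd (p u)) * v (X u)"
      using eq(3) by (simp add: algebra_simps)
    ultimately have "v = v (X u) *\<^sub>R rigidity_matrix G p e"
      using sup by (auto simp: PL(1) row_PL[OF PL(2,3)] fun_eq_iff supported_def algebra_simps)
    then show ?thesis ..
  next
    case (LL l m)
    have sup: "v \<in> supported {B l, B m, A l, A m}"
      using v(1) LL coords_LL[of l m] by (simp add: insert_commute)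
    note eq = functionals_LL(1)[OF LL(2-4) sup, unfolded v(2)]
      functionals_LL(2)[OF LL(2-4) sup, of p, unfolded v(3)]
      functionals_LL(3)[OF LL(2-4) sup, of p, unfolded v(4)]
    have "v (B m) = - v (B l)" using eq(1) by simp
    moreover from this have "(fst (p m) - fst (p l)) * v (B l) = 0" using eq(2) by (auto simp: algebra_simps)
    ultimately have B: "v (B l) = 0" "v (B m) = 0" using slope_distinct[of m l] LL by auto
    obtain s where s: "s \<noteq> 0"
        "\<And>p. rigidity_matrix G p {l, m} = (\<lambda>d. if d = A l then s else if d = A m then - s else 0)"
      using row_LL[OF LL(2-4)] by blast
    have "v (A m) = - v (A l)" using eq(3) by simp
    moreover have "v d = 0" if "d \<noteq> A l" "d \<noteq> A m" for d
      using that sup B by (cases "d = B l"; cases "d = B m") (auto simp: supported_def)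
    ultimately have "v = (v (A l) / s) *\<^sub>R rigidity_matrix G p e"
      using s(1) LL(2) by (auto simp: LL(1) s(2) fun_eq_iff)
    then show ?thesis ..
  qed
  then show "v \<in> span {rigidity_matrix G p e}" by (auto simp: span_singleton)
next
  have "rigidity_matrix G p e \<in> equilibrium G p e"
    using assms
  proof (cases rule: edge_cases)
    case (PP u w)
    have sup: "rigidity_matrix G p e \<in> supported {X u, X w, Y u, Y w}"
      by (simp add: PP(1) row_PP[OF PP(2-4)] supported_def)
    show ?thesis using sup PP(2) functionals_PP(1)[OF PP(2-4) sup]
        functionals_PP(2,3)[OF PP(2-4) sup, of p]
      by (auto simp: equilibrium_def forces_def PP(1) coords_PP[OF PP(3,4)] resultant_def
          row_PP[OF PP(2-4)] algebra_simps)
  next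
    case (PL u l)
    have sup: "rigidity_matrix G p e \<in> supported {X u, Y u, B l, A l}"
      by (simp add: PL(1) row_PL[OF PL(2,3)] supported_def)
    have "resultant_x G (rigidity_matrix G p e) = 0" "resultant_y G p (rigidity_matrix G p e) = 0"
        "moment G p (rigidity_matrix G p e) = 0"
      unfolding functionals_PL[OF PL(2,3) sup]
      by (simp_all add: PL(1) row_PL[OF PL(2,3)] algebra_simps)
    moreover have "planar_coords G e \<union> slope_coords G e = {X u, Y u, B l, A l}"
      unfolding PL(1) coords_PL[OF PL(2,3)] by auto
    ultimately show ?thesis using sup by (simp add: equilibrium_def forces_def resultant_def)
  next
    case (LL l m)
    obtain s where s: "s \<noteq> 0"
        "\<And>p. rigidity_matrix G p {l, m} = (\<lambda>d. if d = A l then s else if d = A m then - s else 0)"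
      using row_LL[OF LL(2-4)] by blast
    have sup: "rigidity_matrix G p e \<in> supported {B l, B m, A l, A m}"
      by (simp add: LL(1) s(2) supported_def)
    show ?thesis using sup LL(2) functionals_LL(1)[OF LL(2-4) sup]
        functionals_LL(2,3)[OF LL(2-4) sup, of p]
      by (auto simp: equilibrium_def forces_def LL(1) coords_LL[OF LL(3,4)] resultant_def s(2) insert_commute)
  qed
  moreover have "subspace (equilibrium G p e)"
    using subspace_supported[of "planar_coords G e \<union> slope_coords G e"] linear_resultant[of G p] linear_moment[of G p]
    unfolding equilibrium_def forces_def subspace_def
    by (auto simp: linear_0 linear_add linear_cmul)
  ultimately have "span {rigidity_matrix G p e} \<subseteq> equilibrium G p e" by (intro span_minimal) auto
  then show "v \<in> equilibrium G p e" if "v \<in> span {rigidity_matrix G p e}" for v using that by blast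
qed

text \<open>Forces at a point of the edge have arbitrary resultant. On an edge between lines, the columns \<open>B\<close> suffice
  because the directions of the two lines are independent.\<close>

lemma resultant_anchor:
  assumes "e \<in> edges G"
  shows "\<exists>v\<in>supported (planar_coords G e). \<forall>i. resultant G p i v = (if i = j then 1 else 0)"
  using assms
proof (cases rule: edge_cases)
  case (PP u w)
  then show ?thesis
    by (intro bexI[of _ "unit (if j then X u else Y u)"])
      (auto simp: resultant_def resultant_x_unit resultant_y_unit coords_PP)
next
  case (PL u l)
  then show ?thesis
    by (intro bexI[of _ "unit (if j then X u else Y u)"])
      (auto simp: resultant_def resultant_x_unit resultant_y_unit coords_PL)
next
  case (LL l m)
  define d where "d = fst (p m) - fst (p l)"
  have d: "d \<noteq> 0" using slope_distinct[of l m] LL by (simp add: d_def)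
  then have "fst (p m) / d - fst (p l) / d = 1"
    by (simp add: d_def flip: diff_divide_distrib)
  define v where "v = (if j then fst (p m) / d else 1 / d) *\<^sub>R unit (B l)
    + (if j then - fst (p l) / d else - 1 / d) *\<^sub>R unit (B m)"
  have "v \<in> supported (planar_coords G e)"
    unfolding v_def LL(1) coords_LL[OF LL(3,4)]
    by (intro subspace_add subspace_scale subspace_supported) auto
  moreover have "resultant G p i v = (if i = j then 1 else 0)" for i
  proof -
    have "resultant G p i v = (if j then fst (p m) / d else 1 / d) * resultant G p i (unit (B l))
        + (if j then - fst (p l) / d else - 1 / d) * resultant G p i (unit (B m))"
      unfolding v_def by (simp add: linear_add[OF linear_resultant] linear_cmul[OF linear_resultant])
    also have "\<dots> = (if i = j then 1 else 0)"
      using \<open>fst (p m) / d - fst (p l) / d = 1\<close> LL(3,4) by (cases i; cases j)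
        (auto simp: resultant_def resultant_x_unit resultant_y_unit mult.commute)
    finally show ?thesis .
  qed
  ultimately show ?thesis by blast
qed

text \<open>A unit load on the slope of a line has moment one. Between two points, a couple of horizontal or of
  vertical forces has nonzero moment, and one of these two avoids the given column.\<close>

lemma moment_anchor_avoiding:
  assumes "e \<in> edges G" "c \<notin> slope_coords G e"
  shows "\<exists>v\<in>forces G p e. moment G p v = 1 \<and> v c = 0"
proof -
  have unit: "?thesis" if "l \<in> e" "l \<in> lines G" for l
    using assms(2) that
    by (intro bexI[of _ "unit (A l)"])
      (auto simp: forces_def moment_unit resultant_def resultant_x_unit resultant_y_unit slope_coords_def unit_apply)
  show ?thesis using assms(1)
  proof (cases rule: edge_cases)
    case (PP u w)
    define h k where "h = 1 / (fst (p w) - fst (p u))" and "k = 1 / (snd (p u) - snd (p w))"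
    have hk: "fst (p w) * h - fst (p u) * h = 1" "snd (p u) * k - snd (p w) * k = 1"
      using x_distinct[of u w] y_distinct[of u w] PP by (auto simp: h_def k_def diff_divide_distrib[symmetric])
    define v where "v = (if c \<in> range X then h *\<^sub>R (unit (Y u) - unit (Y w)) else k *\<^sub>R (unit (X u) - unit (X w)))"
    have sup: "v \<in> supported {X u, X w, Y u, Y w}"
      unfolding v_def by (auto intro!: subspace_scale subspace_diff subspace_supported)
    have "v c = 0" by (auto simp: v_def unit_apply)
    moreover have "v \<in> forces G p e"
      using sup PP(2) functionals_PP(1)[OF PP(2-4) sup] functionals_PP(2)[OF PP(2-4) sup, of p]
      by (auto simp: forces_def resultant_def PP(1) coords_PP[OF PP(3,4)] v_def unit_apply)
    moreover have "moment G p v = 1"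
      unfolding functionals_PP(3)[OF PP(2-4) sup]
      using PP(2) hk by (auto simp: v_def unit_apply)
    ultimately show ?thesis by blast
  qed (use unit in auto)
qed

end

section \<open>The two truncations that produce the rows\<close>

context point_line
begin

lemma finite_subset_edges: "R \<subseteq> edges G \<Longrightarrow> finite R"
  using finite_edges by (rule finite_subset[rotated])

lemma UN_planar_coords:
  "(\<Union>e\<in>R. planar_coords G e) = X ` points_of G R \<union> Y ` points_of G R \<union> B ` lines_of G R"
  by (auto simp: planar_coords_def points_of_def lines_of_def)

lemma UN_slope_coords: "(\<Union>e\<in>R. slope_coords G e) = A ` lines_of G R"
  by (auto simp: slope_coords_def lines_of_def)

lemma finite_points_of: "finite (points_of G R)" and finite_lines_of: "finite (lines_of G R)"
  using finite_points finite_lines by (simp_all add: points_of_def lines_of_def)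

lemma card_UN_planar_coords: "card (\<Union>e\<in>R. planar_coords G e) = 2 * nu_P G R + nu_L G R"
proof -
  have "card (X ` points_of G R \<union> Y ` points_of G R \<union> B ` lines_of G R)
      = card (X ` points_of G R) + card (Y ` points_of G R) + card (B ` lines_of G R)"
    using finite_points_of finite_lines_of by (subst card_Un_disjoint, auto)+
  then show ?thesis
    by (simp add: UN_planar_coords nu_P_def nu_L_def card_image inj_on_def)
qed

lemma subspace_resultant_free:
  "subspace {v \<in> supported C. \<forall>b. resultant G p b v = 0}"
  using subspace_supported[of C] linear_resultant[of G p]
  by (auto simp: subspace_def linear_0 linear_add linear_cmul)

lemma fin_dim_balanced: "R \<subseteq> edges G \<Longrightarrow> fin_dim (\<Union>e\<in>R. balanced G p e)"
  by (intro fin_dim_UN finite_subset_edges)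
    (auto simp: balanced_def intro: fin_dim_subset[OF fin_dim_supported[OF finite_planar_coords]])

lemma fin_dim_forces_edge: "fin_dim (forces G p e)"
  using fin_dim_supported[of "planar_coords G e \<union> slope_coords G e"] finite_planar_coords finite_slope_coords
  by (auto simp: forces_def intro: fin_dim_subset)

text \<open>The columns \<open>A\<close> split off as a direct summand.\<close>

lemma dim_forces:
  assumes "R \<subseteq> edges G"
  shows "dim (\<Union>e\<in>R. forces G p e) = nu_L G R + dim (\<Union>e\<in>R. balanced G p e)"
proof -
  let ?D = "unit ` A ` lines_of G R" and ?K = "\<Union>e\<in>R. balanced G p e"
  have finD: "finite (A ` lines_of G R)" using finite_lines_of by simp
  have dimD: "dim ?D = nu_L G R"
    using dim_units[OF finD] by (simp add: nu_L_def card_image inj_on_def)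
  have "span (\<Union>e\<in>R. forces G p e) = span (?K \<union> ?D)"
    unfolding span_eq
  proof
    show "(\<Union>e\<in>R. forces G p e) \<subseteq> span (?K \<union> ?D)"
    proof
      fix v assume "v \<in> (\<Union>e\<in>R. forces G p e)"
      then obtain e where e: "e \<in> R" and v: "v \<in> supported (planar_coords G e \<union> slope_coords G e)"
          "\<And>b. resultant G p b v = 0"
        by (auto simp: forces_def)
      define a where "a = (\<Sum>c\<in>slope_coords G e. v c *\<^sub>R unit c)"
      have "a \<in> span ?D"
        unfolding a_def using e UN_slope_coords[of R] by (intro span_sum span_scale span_base) blast
      have a: "a d = (if d \<in> slope_coords G e then v d else 0)" for d
      proof -
        have "a d = (\<Sum>c\<in>slope_coords G e. if c = d then v c else 0)"
          unfolding a_def sum_fun_apply by (intro sum.cong) (auto simp: unit_apply)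
        then show ?thesis using finite_slope_coords by simp
      qed
      have "v - a \<in> supported (planar_coords G e)"
        using v(1) a by (auto simp: supported_def)
      moreover have "resultant G p b a = 0" for b
      proof -
        have "resultant G p b a = (\<Sum>c\<in>slope_coords G e. v c * resultant G p b (unit c))"
          by (simp add: a_def linear_sum[OF linear_resultant] linear_cmul[OF linear_resultant])
        also have "\<dots> = 0"
          by (intro sum.neutral) (auto simp: resultant_def resultant_x_unit resultant_y_unit slope_coords_def)
        finally show ?thesis .
      qed
      ultimately have "v - a \<in> balanced G p e"
        using v(2) by (simp add: balanced_def linear_diff[OF linear_resultant])
      then have "v - a \<in> span ?K" using e by (intro span_base) blast
      with \<open>a \<in> span ?D\<close> have "v - a \<in> span (?K \<union> ?D)" "a \<in> span (?K \<union> ?D)"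
        using span_mono[of ?K "?K \<union> ?D"] span_mono[of ?D "?K \<union> ?D"] by blast+
      from span_add[OF this] show "v \<in> span (?K \<union> ?D)" by simp
    qed
    have "balanced G p e \<subseteq> forces G p e" for e
      using supported_mono[of "planar_coords G e" "planar_coords G e \<union> slope_coords G e"]
      by (auto simp: balanced_def forces_def)
    moreover have "?D \<subseteq> (\<Union>e\<in>R. forces G p e)"
      unfolding UN_slope_coords[symmetric]
      by (auto simp: forces_def resultant_def resultant_x_unit resultant_y_unit slope_coords_def)
    ultimately have "?K \<union> ?D \<subseteq> (\<Union>e\<in>R. forces G p e)" by blast
    then show "?K \<union> ?D \<subseteq> span (\<Union>e\<in>R. forces G p e)" by (rule subset_trans[OF _ span_superset])
  qed
  then have "dim (\<Union>e\<in>R. forces G p e) = dim (?K \<union> ?D)" by (rule span_eq_dim)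
  also have "\<dots> = dim ?K + dim ?D"
  proof (rule antisym)
    show "dim (?K \<union> ?D) \<le> dim ?K + dim ?D"
      using fin_dim_balanced[OF assms] finD by (intro dim_Un_le) auto
    have "span ?K \<subseteq> supported (- range A)"
      by (intro span_minimal subspace_supported) (auto simp: balanced_def supported_def planar_coords_def)
    moreover have "span ?D \<subseteq> supported (range A)"
      by (intro span_minimal subspace_supported) auto
    ultimately have "span ?K \<inter> span ?D \<subseteq> supported (- range A) \<inter> supported (range A)" by blast
    also have "\<dots> \<subseteq> {0}"
    proof
      fix v :: "'v coordinate \<Rightarrow> real" assume v: "v \<in> supported (- range A) \<inter> supported (range A)"
      have "v c = 0" for c using v by (cases "c \<in> range A") (auto simp: supported_def)
      then show "v \<in> {0}" by (simp add: fun_eq_iff)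
    qed
    finally show "dim ?K + dim ?D \<le> dim (?K \<union> ?D)"
      using fin_dim_balanced[OF assms] finD by (intro dim_Un_direct) auto
  qed
  finally show ?thesis using dimD by simp
qed

lemma resultant_perturb_slope:
  assumes "l \<in> lines G"
  shows "resultant G (perturb (A l) \<epsilon> p) i v = resultant G p i v + (if i = False then \<epsilon> * (- 1) * v (B l) else 0)"
proof (cases i)
  case False
  have "(\<Sum>m\<in>lines G. fst (perturb (A l) \<epsilon> p m) * v (B m))
      = (\<Sum>m\<in>lines G. fst (p m) * v (B m) + (if m = l then \<epsilon> * v (B l) else 0))"
    by (intro sum.cong) (auto simp: algebra_simps)
  also have "\<dots> = (\<Sum>m\<in>lines G. fst (p m) * v (B m)) + \<epsilon> * v (B l)"
    using assms finite_lines by (simp add: sum.distrib)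
  finally show ?thesis using False by (simp add: resultant_def resultant_y_def)
qed (simp add: resultant_def)

lemma resultant_perturb_point:
  assumes "u \<in> points G" "c = X u \<or> c = Y u"
  shows "resultant G (perturb c \<epsilon> p) = resultant G p"
proof
  have "perturb c \<epsilon> p l = p l" if "l \<in> lines G" for l
    using assms that point_not_line by auto
  then show "resultant G (perturb c \<epsilon> p) i = resultant G p i" for i
    by (auto simp: resultant_def resultant_y_def fun_eq_iff intro!: sum.cong)
qed

lemma moment_perturb_x:
  assumes "u \<in> points G"
  shows "moment G (perturb (X u) \<epsilon> p) v = moment G p v + \<epsilon> * (- 1) * v (Y u)"
proof -
  have "(\<Sum>w\<in>points G. snd (perturb (X u) \<epsilon> p w) * v (X w) - fst (perturb (X u) \<epsilon> p w) * v (Y w))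
      = (\<Sum>w\<in>points G. (snd (p w) * v (X w) - fst (p w) * v (Y w)) + (if w = u then - (\<epsilon> * v (Y u)) else 0))"
    by (intro sum.cong) (auto simp: algebra_simps)
  also have "\<dots> = (\<Sum>w\<in>points G. snd (p w) * v (X w) - fst (p w) * v (Y w)) - \<epsilon> * v (Y u)"
    unfolding sum.distrib using assms finite_points by simp
  finally show ?thesis by (simp add: moment_def)
qed

lemma moment_perturb_y:
  assumes "u \<in> points G"
  shows "moment G (perturb (Y u) \<epsilon> p) v = moment G p v + \<epsilon> * 1 * v (X u)"
proof -
  have "(\<Sum>w\<in>points G. snd (perturb (Y u) \<epsilon> p w) * v (X w) - fst (perturb (Y u) \<epsilon> p w) * v (Y w))
      = (\<Sum>w\<in>points G. (snd (p w) * v (X w) - fst (p w) * v (Y w)) + (if w = u then \<epsilon> * v (X u) else 0))"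
    by (intro sum.cong) (auto simp: algebra_simps)
  also have "\<dots> = (\<Sum>w\<in>points G. snd (p w) * v (X w) - fst (p w) * v (Y w)) + \<epsilon> * v (X u)"
    unfolding sum.distrib using assms finite_points by simp
  finally show ?thesis by (simp add: moment_def)
qed

end

context generic_framework
begin

lemma planar_truncation:
  "\<exists>x. truncation (edges G) (\<lambda>e. supported (planar_coords G e)) UNIV (resultant G p) x"
proof -
  have "\<forall>j e. \<exists>v. e \<in> edges G \<longrightarrow> v \<in> supported (planar_coords G e) \<and>
      (\<forall>i. resultant G p i v = (if i = j then 1 else 0))"
    using resultant_anchor by blast
  then obtain x where "\<And>j e. e \<in> edges G \<Longrightarrow> x j e \<in> supported (planar_coords G e) \<and>
      (\<forall>i. resultant G p i (x j e) = (if i = j then 1 else 0))"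
    by metis
  then have "truncation (edges G) (\<lambda>e. supported (planar_coords G e)) UNIV (resultant G p) x"
    by (intro truncation.intro)
      (auto simp: finite_edges subspace_supported fin_dim_supported finite_planar_coords linear_resultant)
  then show ?thesis by blast
qed

lemma moment_truncation:
  "\<exists>x. truncation (edges G) (forces G p) (UNIV :: unit set) (\<lambda>_. moment G p) x"
proof -
  have "\<forall>e\<in>edges G. \<exists>v. v \<in> forces G p e \<and> moment G p v = 1"
  proof
    fix e assume "e \<in> edges G"
    \<comment> \<open>Any column outside the slope columns serves as the column to be avoided.\<close>
    moreover have "X undefined \<notin> slope_coords G e" by (auto simp: slope_coords_def)
    ultimately show "\<exists>v. v \<in> forces G p e \<and> moment G p v = 1"
      using moment_anchor_avoiding[of e "X undefined"] by blast
  qed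
  then obtain x where "\<And>e. e \<in> edges G \<Longrightarrow> x e \<in> forces G p e \<and> moment G p (x e) = 1"
    by metis
  then have "truncation (edges G) (forces G p) (UNIV :: unit set) (\<lambda>_. moment G p) (\<lambda>_. x)"
    by (intro truncation.intro)
      (auto simp: finite_edges forces_def[abs_def] subspace_resultant_free linear_moment
        fin_dim_forces_edge[unfolded forces_def])
  then show ?thesis by blast
qed

lemma dim_balanced_le:
  assumes "R \<subseteq> edges G" "R \<noteq> {}"
  shows "dim (\<Union>e\<in>R. balanced G p e) + 2 \<le> 2 * nu_P G R + nu_L G R"
proof -
  obtain x where "truncation (edges G) (\<lambda>e. supported (planar_coords G e)) UNIV (resultant G p) x"
    using planar_truncation by blast
  then interpret truncation "edges G" "\<lambda>e. supported (planar_coords G e)" UNIV "resultant G p" x .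
  have "kernel e = balanced G p e" for e by (simp add: kernel_def balanced_def)
  then show ?thesis
    using dim_kernel_le[OF assms] dim_UN_supported[OF finite_subset_edges[OF assms(1)], of "planar_coords G"]
      finite_planar_coords by (simp add: card_UN_planar_coords)
qed

lemma span_rows:
  assumes "R \<subseteq> edges G"
  shows "span (rigidity_matrix G p ` R) = span (\<Union>e\<in>R. equilibrium G p e)"
proof -
  have "(\<Union>e\<in>R. equilibrium G p e) = (\<Union>e\<in>R. span {rigidity_matrix G p e})"
    using equilibrium_eq_span_row assms by blast
  moreover have "span {rigidity_matrix G p e} \<subseteq> span (rigidity_matrix G p ` R)" if "e \<in> R" for e
    using that by (intro span_mono) blast
  moreover have "rigidity_matrix G p e \<in> span {rigidity_matrix G p e}" for e by (simp add: span_base)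
  ultimately show ?thesis
    unfolding span_eq using span_superset[of "\<Union>e\<in>R. equilibrium G p e"] by (simp only:) blast
qed

lemma dim_equilibrium_le:
  assumes "R \<subseteq> edges G" "R \<noteq> {}"
  shows "dim (\<Union>e\<in>R. equilibrium G p e) + 1 \<le> nu_L G R + dim (\<Union>e\<in>R. balanced G p e)"
proof -
  obtain x where "truncation (edges G) (forces G p) (UNIV :: unit set) (\<lambda>_. moment G p) x"
    using moment_truncation by blast
  then interpret truncation "edges G" "forces G p" "UNIV :: unit set" "\<lambda>_. moment G p" x .
  have "kernel e = equilibrium G p e" for e by (simp add: kernel_def equilibrium_def)
  then show ?thesis using dim_kernel_le[OF assms] by (simp add: dim_forces[OF assms(1)])
qed

lemma fin_dim_equilibrium: "R \<subseteq> edges G \<Longrightarrow> fin_dim (\<Union>e\<in>R. equilibrium G p e)"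
  by (intro fin_dim_UN finite_subset_edges fin_dim_subset[OF fin_dim_forces_edge])
    (auto simp: equilibrium_def)

end

section \<open>Lower bounds at a framework of maximal rank\<close>

text \<open>The sum runs over all sets of edges because the lower bound for balanced loads is needed for every
  part of the partition that comes from the second truncation.\<close>

definition balanced_rank_sum :: "'v point_line_graph \<Rightarrow> ('v \<Rightarrow> real \<times> real) \<Rightarrow> nat" where
  "balanced_rank_sum G p = (\<Sum>R\<in>Pow (edges G). dim (\<Union>e\<in>R. balanced G p e))"

definition equilibrium_rank_sum :: "'v point_line_graph \<Rightarrow> ('v \<Rightarrow> real \<times> real) \<Rightarrow> nat" where
  "equilibrium_rank_sum G p = (\<Sum>R\<in>Pow (edges G). dim (\<Union>e\<in>R. equilibrium G p e))"

text \<open>The two sums are maximized lexicographically: moving a point leaves all balanced spaces unchanged,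
  so the second sum cannot increase if the new framework is again generic, while turning a line is only used for the first sum.\<close>

locale extremal_framework = generic_framework +
  assumes max_balanced: "generic G q \<Longrightarrow> balanced_rank_sum G q \<le> balanced_rank_sum G p"
    and max_equilibrium: "generic G q \<Longrightarrow> balanced_rank_sum G q = balanced_rank_sum G p \<Longrightarrow>
      equilibrium_rank_sum G q \<le> equilibrium_rank_sum G p"

lemma (in point_line) extremal_framework_exists: "\<exists>p. extremal_framework G p"
proof -
  let ?C = "\<lambda>e. planar_coords G e \<union> slope_coords G e"
  let ?N = "(\<Sum>R\<in>Pow (edges G). card (\<Union>e\<in>R. ?C e))"
  have bound: "dim (\<Union>e\<in>R. H e) \<le> card (\<Union>e\<in>R. ?C e)"
    if "R \<subseteq> edges G" "\<And>e. H e \<subseteq> supported (?C e)" for H R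
  proof -
    have "dim (\<Union>e\<in>R. H e) \<le> dim (\<Union>e\<in>R. supported (?C e))"
    proof (rule dim_le_dim_span)
      show "fin_dim (\<Union>e\<in>R. supported (?C e))"
        using finite_subset_edges[OF that(1)] finite_planar_coords finite_slope_coords
        by (intro fin_dim_UN fin_dim_supported) auto
      have "(\<Union>e\<in>R. H e) \<subseteq> (\<Union>e\<in>R. supported (?C e))" using that(2) by blast
      then show "(\<Union>e\<in>R. H e) \<subseteq> span (\<Union>e\<in>R. supported (?C e))" by (rule subset_trans[OF _ span_superset])
    qed
    then show ?thesis
      using finite_subset_edges[OF that(1)] finite_planar_coords finite_slope_coords
      by (simp add: dim_UN_supported)
  qed
  have "balanced G q e \<subseteq> supported (?C e)" for q e
    using supported_mono[of "planar_coords G e" "?C e"] by (auto simp: balanced_def)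
  then have b: "balanced_rank_sum G q < Suc ?N" for q
    unfolding balanced_rank_sum_def less_Suc_eq_le by (intro sum_mono bound) auto
  have e: "equilibrium_rank_sum G q < Suc ?N" for q
    unfolding equilibrium_rank_sum_def less_Suc_eq_le
    by (intro sum_mono bound) (auto simp: equilibrium_def forces_def)
  obtain p0 where "generic G p0" using generic_exists[OF point_line_graph] by blast
  then obtain p1 where p1: "generic G p1" "\<And>q. generic G q \<Longrightarrow> balanced_rank_sum G q \<le> balanced_rank_sum G p1"
    using ex_has_greatest_nat[of "generic G" p0 "balanced_rank_sum G" "Suc ?N"] b by blast
  let ?P = "\<lambda>q. generic G q \<and> balanced_rank_sum G q = balanced_rank_sum G p1"
  obtain p where p: "?P p" "\<And>q. ?P q \<Longrightarrow> equilibrium_rank_sum G q \<le> equilibrium_rank_sum G p"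
    using ex_has_greatest_nat[of ?P p1 "equilibrium_rank_sum G" "Suc ?N"] e p1(1) by blast
  have "extremal_framework G p"
    by unfold_locales (use p p1 in auto)
  then show ?thesis by blast
qed

context extremal_framework
begin

text \<open>General position for the first truncation. A coordinate of a point \<open>u\<close> is covered by the common
  vector \<open>unit (X u)\<close> or \<open>unit (Y u)\<close>. For a column \<open>B l\<close>, turning the line \<open>l\<close> changes the vertical
  resultant by a multiple of that column, which covers the vertical functional. The load \<open>unit (B l)\<close> is common
  to all edges at \<open>l\<close> and has resultants \<open>1\<close> and minus the slope, and so covers the combination of the two
  functionals that remains.\<close>

lemma planar_relation:
  assumes "truncation (edges G) (\<lambda>e. supported (planar_coords G e)) UNIV (resultant G p) x"
    and R: "R \<subseteq> edges G" and y: "\<And>e. e \<in> R \<Longrightarrow> y e \<in> balanced G p e" "(\<Sum>e\<in>R. y e) = 0"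
  shows "(\<Sum>e\<in>R. y e c *\<^sub>R x j e) \<in> span (\<Union>e\<in>R. balanced G p e)"
proof (cases "\<forall>e\<in>R. y e c = 0")
  case True
  then show ?thesis by (simp add: span_zero)
next
  case False
  interpret truncation "edges G" "\<lambda>e. supported (planar_coords G e)" UNIV "resultant G p" x
    by (rule assms(1))
  have kernel: "kernel e = balanced G p e" for e by (simp add: kernel_def balanced_def)
  obtain f where f: "f \<in> R" "y f c \<noteq> 0" using False by blast
  have support: "c \<in> planar_coords G e" if "e \<in> R" "y e c \<noteq> 0" for e
    using y(1)[OF that(1)] that(2) by (auto simp: balanced_def supported_def)
  have common: "(\<Sum>e\<in>R. y e c *\<^sub>R (\<Sum>j\<in>UNIV. resultant G p j s *\<^sub>R x j e)) \<in> span (\<Union>e\<in>R. balanced G p e)"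
    if "\<And>e. e \<in> R \<Longrightarrow> y e c \<noteq> 0 \<Longrightarrow> s \<in> supported (planar_coords G e)" for s
    using relation_common_vector[OF R, of y c s] y that by (simp add: kernel)
  show ?thesis
  proof (cases "c \<in> range B")
    case False
    then obtain u where u: "c = X u \<or> c = Y u" "u \<in> points G"
      using support[OF f] by (auto simp: planar_coords_def)
    let ?s = "unit (if j then X u else Y u)"
    have "(\<Sum>e\<in>R. y e c *\<^sub>R (\<Sum>i\<in>UNIV. resultant G p i ?s *\<^sub>R x i e)) \<in> span (\<Union>e\<in>R. balanced G p e)"
    proof (rule common)
      fix e assume "e \<in> R" "y e c \<noteq> 0"
      then have "u \<in> e" using support[of e] u by (auto simp: planar_coords_def)
      then show "?s \<in> supported (planar_coords G e)" using u(2) by (auto simp: planar_coords_def)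
    qed
    moreover have "(\<Sum>i\<in>UNIV. resultant G p i ?s *\<^sub>R x i e) = x j e" for e
      using u(2) by (cases j) (simp_all add: UNIV_bool resultant_def resultant_x_unit resultant_y_unit)
    ultimately show ?thesis by simp
  next
    case True
    then obtain l where l: "c = B l" "l \<in> lines G"
      using support[OF f] by (auto simp: planar_coords_def)
    have perturbed: "balanced G (perturb (A l) \<epsilon> p) e = kernel_perturbed False (B l) (- 1) \<epsilon> e" for \<epsilon> e
      unfolding balanced_def kernel_perturbed_def resultant_perturb_slope[OF l(2)] by simp
    have anchor: "\<exists>x'. x' \<in> supported (planar_coords G e) \<and>
        (\<forall>i\<in>UNIV. resultant G p i x' = (if i = False then 1 else 0)) \<and> x' (B l) = 0"
      if e: "e \<in> edges G" "v \<in> kernel e" "v (B l) \<noteq> 0" for e v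
      using e(1)
    proof (cases rule: edge_cases)
      case (PP u w)
      have "v \<in> supported (planar_coords G e)" using e(2) unfolding kernel balanced_def by blast
      then have "v (B l) = 0" unfolding PP(1) coords_PP[OF PP(3,4)] by (simp add: supported_def)
      then show ?thesis using e(3) by blast
    next
      case (PL u m)
      then show ?thesis
        by (intro exI[of _ "unit (Y u)"])
          (auto simp: coords_PL resultant_def resultant_x_unit resultant_y_unit unit_apply)
    next
      case (LL m n)
      have v: "v \<in> supported (planar_coords G e)" "\<And>b. resultant G p b v = 0"
        using e(2) unfolding kernel balanced_def by blast+
      then have sup: "v \<in> supported {B m, B n}" unfolding LL(1) coords_LL[OF LL(3,4)] by blast
      then have "moment G p v = 0"
        using functionals_LL(3)[OF LL(2-4), of v p] by (simp add: supported_def)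
      moreover have "v \<in> supported (planar_coords G e \<union> slope_coords G e)"
        using v(1) supported_mono[of "planar_coords G e" "planar_coords G e \<union> slope_coords G e"] by blast
      ultimately have "v \<in> equilibrium G p e" using v(2) by (simp add: equilibrium_def forces_def)
      \<comment> \<open>The row of an edge between two lines has no entry in the columns \<open>B\<close>, which excludes this case.\<close>
      then obtain k where "v = k *\<^sub>R rigidity_matrix G p e"
        using equilibrium_eq_span_row[OF e(1)] by (auto simp: span_singleton)
      moreover have "rigidity_matrix G p e (B l) = 0"
        using row_LL[OF LL(2-4)] by (metis LL(1) coordinate.distinct(11))
      ultimately show ?thesis using e(3) by simp
    qed
    have stable: "\<exists>\<epsilon>. \<epsilon> \<noteq> 0 \<and> \<bar>\<epsilon>\<bar> < \<delta> \<and>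
        dim (\<Union>e\<in>R. kernel_perturbed False (B l) (- 1) \<epsilon> e) \<le> dim (\<Union>e\<in>R. kernel e)" if "\<delta> > 0" for \<delta>
    proof -
      let ?K = "\<lambda>R \<epsilon>. \<Union>e\<in>R. kernel_perturbed False (B l) (- 1) \<epsilon> e"
      have "\<exists>\<epsilon>. \<epsilon> \<noteq> 0 \<and> \<bar>\<epsilon>\<bar> < \<delta> \<and> dim (?K R \<epsilon>) \<le> dim (?K R 0)"
      proof (rule stable_of_stable_sum[of "Pow (edges G)"])
        fix S v assume S: "S \<in> Pow (edges G)" "v \<in> ?K S 0"
        show "liftable (?K S) v"
        proof (rule perturbed_liftable[OF _ _ _ S(2)])
          show "S \<subseteq> edges G" using S(1) by simp
        qed (use anchor S(1) in blast)+
      next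
        fix \<delta> :: real assume "\<delta> > 0"
        then obtain \<epsilon> where \<epsilon>: "\<epsilon> \<noteq> 0" "\<bar>\<epsilon>\<bar> < \<delta>" "generic G (perturb (A l) \<epsilon> p)"
          using generic_perturb[OF point_line_graph generic, of "A l" \<delta>] l(2)
          by (auto simp: generic_coordinates_def)
        show "\<exists>\<epsilon>. \<epsilon> \<noteq> 0 \<and> \<bar>\<epsilon>\<bar> < \<delta> \<and> (\<Sum>S\<in>Pow (edges G). dim (?K S \<epsilon>)) \<le> (\<Sum>S\<in>Pow (edges G). dim (?K S 0))"
          using \<epsilon>(1,2) max_balanced[OF \<epsilon>(3)]
          unfolding balanced_rank_sum_def perturbed kernel_perturbed_0 kernel by blast
      qed (use that R finite_edges fin_dim_kernel_perturbed in auto)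
      then show ?thesis unfolding kernel_perturbed_0 .
    qed
    have F: "(\<Sum>e\<in>R. y e c *\<^sub>R x False e) \<in> span (\<Union>e\<in>R. balanced G p e)"
      unfolding l(1) kernel[symmetric]
    proof (rule relation_perturbed[OF R, of False y "- 1" "B l"])
      show "\<exists>\<epsilon>. \<epsilon> \<noteq> 0 \<and> \<bar>\<epsilon>\<bar> < \<delta> \<and>
          dim (\<Union>e\<in>R. kernel_perturbed False (B l) (- 1) \<epsilon> e) \<le> dim (\<Union>e\<in>R. kernel e)" if "\<delta> > 0" for \<delta>
        by (rule stable[OF that])
    qed (use y kernel anchor R in \<open>blast | simp\<close>)+
    show ?thesis
    proof (cases j)
      case True
      have "(\<Sum>e\<in>R. y e c *\<^sub>R (\<Sum>i\<in>UNIV. resultant G p i (unit (B l)) *\<^sub>R x i e))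
          \<in> span (\<Union>e\<in>R. balanced G p e)"
        by (rule common) (use support l in auto)
      then have "(\<Sum>e\<in>R. y e c *\<^sub>R (x True e - fst (p l) *\<^sub>R x False e)) \<in> span (\<Union>e\<in>R. balanced G p e)"
        using l(2) by (simp add: UNIV_bool resultant_def resultant_x_unit resultant_y_unit)
      note span_add[OF this span_scale[OF F, of "fst (p l)"]]
      moreover have "(\<Sum>e\<in>R. y e c *\<^sub>R (x True e - fst (p l) *\<^sub>R x False e)) + fst (p l) *\<^sub>R (\<Sum>e\<in>R. y e c *\<^sub>R x False e)
          = (\<Sum>e\<in>R. y e c *\<^sub>R x True e)"
        by (simp add: scaleR_sum_right algebra_simps flip: sum.distrib)
      ultimately show ?thesis using True by simp
    qed (use F in simp)
  qed
qed

lemma balanced_partition: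
  assumes "S \<subseteq> edges G"
  shows "\<exists>P. partition_on S P \<and>
    (\<Sum>R\<in>P. 2 * int (nu_P G R) + int (nu_L G R) - 2) \<le> int (dim (\<Union>e\<in>S. balanced G p e))"
proof -
  obtain x where x: "truncation (edges G) (\<lambda>e. supported (planar_coords G e)) UNIV (resultant G p) x"
    using planar_truncation by blast
  interpret truncation "edges G" "\<lambda>e. supported (planar_coords G e)" UNIV "resultant G p" x by (rule x)
  have kernel: "kernel e = balanced G p e" for e by (simp add: kernel_def balanced_def)
  have "\<exists>P. partition_on S P \<and>
    (\<Sum>R\<in>P. int (dim (\<Union>e\<in>R. supported (planar_coords G e))) - int (card (UNIV :: bool set)))
      \<le> int (dim (\<Union>e\<in>S. kernel e))"
    by (rule truncation_partition_dims[OF _ assms]) (unfold kernel, rule planar_relation[OF x])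
  then obtain P where P: "partition_on S P"
    "(\<Sum>R\<in>P. int (dim (\<Union>e\<in>R. supported (planar_coords G e))) - 2) \<le> int (dim (\<Union>e\<in>S. balanced G p e))"
    unfolding kernel by auto
  have "dim (\<Union>e\<in>R. supported (planar_coords G e)) = 2 * nu_P G R + nu_L G R" if "R \<in> P" for R
  proof -
    have "R \<subseteq> edges G" using that P(1) assms by (auto simp: partition_on_def)
    then show ?thesis
      using finite_planar_coords by (simp add: dim_UN_supported finite_subset_edges card_UN_planar_coords)
  qed
  then show ?thesis using P by (intro exI[of _ P]) simp
qed

text \<open>General position for the second truncation. A column of a line \<open>l\<close> is covered by the common
  vector \<open>unit (A l)\<close>. For a column of a point, moving the point in the perpendicular direction changes the
  moment by a multiple of that column and leaves the resultants alone.\<close>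

lemma moment_relation:
  assumes "truncation (edges G) (forces G p) (UNIV :: unit set) (\<lambda>_. moment G p) x"
    and R: "R \<subseteq> edges G" and y: "\<And>e. e \<in> R \<Longrightarrow> y e \<in> equilibrium G p e" "(\<Sum>e\<in>R. y e) = 0"
  shows "(\<Sum>e\<in>R. y e c *\<^sub>R x j e) \<in> span (\<Union>e\<in>R. equilibrium G p e)"
proof (cases "\<forall>e\<in>R. y e c = 0")
  case True
  then show ?thesis by (simp add: span_zero)
next
  case False
  interpret truncation "edges G" "forces G p" "UNIV :: unit set" "\<lambda>_. moment G p" x
    by (rule assms(1))
  have kernel: "kernel e = equilibrium G p e" for e by (simp add: kernel_def equilibrium_def)
  obtain f where f: "f \<in> R" "y f c \<noteq> 0" using False by blast
  have support: "c \<in> planar_coords G e \<union> slope_coords G e" if "e \<in> R" "y e c \<noteq> 0" for e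
    using y(1)[OF that(1)] that(2) by (auto simp: equilibrium_def forces_def supported_def)
  show ?thesis
  proof (cases "c \<in> range A \<union> range B")
    case True
    then obtain l where l: "c = A l \<or> c = B l" "l \<in> lines G"
      using support[OF f] by (auto simp: planar_coords_def slope_coords_def)
    have "(\<Sum>e\<in>R. y e c *\<^sub>R (\<Sum>j\<in>UNIV. moment G p (unit (A l)) *\<^sub>R x j e)) \<in> span (\<Union>e\<in>R. kernel e)"
    proof (rule relation_common_vector[OF R])
      fix e assume "e \<in> R" "y e c \<noteq> 0"
      then have "l \<in> e" using support[of e] l by (auto simp: planar_coords_def slope_coords_def)
      then show "unit (A l) \<in> forces G p e"
        using l(2) by (auto simp: forces_def slope_coords_def resultant_def resultant_x_unit resultant_y_unit)
    qed (use y kernel in auto)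
    then show ?thesis unfolding kernel using l(2) by (simp add: moment_unit UNIV_unit)
  next
    case False
    then obtain u where u: "c = X u \<or> c = Y u" "u \<in> points G"
      using support[OF f] by (auto simp: planar_coords_def slope_coords_def)
    \<comment> \<open>The coordinate \<open>d\<close> of \<open>u\<close> has coefficient \<open>s * v c\<close> in the moment of \<open>v\<close>.\<close>
    define d s where "d = (if c = X u then Y u else X u)" and "s = (if c = X u then 1 else - 1 :: real)"
    have d: "d \<in> generic_coordinates G" "d = X u \<or> d = Y u" and "s \<noteq> 0"
      using u by (auto simp: d_def s_def generic_coordinates_def)
    have moment: "moment G (perturb d \<epsilon> p) v = moment G p v + \<epsilon> * s * v c" for \<epsilon> v
      using u moment_perturb_x[OF u(2)] moment_perturb_y[OF u(2)] by (auto simp: d_def s_def)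
    have resultant: "resultant G (perturb d \<epsilon> p) = resultant G p" for \<epsilon>
      by (rule resultant_perturb_point[OF u(2) d(2)])
    have perturbed: "equilibrium G (perturb d \<epsilon> p) e = kernel_perturbed () c s \<epsilon> e" for \<epsilon> e
      by (simp add: equilibrium_def forces_def kernel_perturbed_def moment resultant)
    have anchor: "\<exists>x'. x' \<in> forces G p e \<and> (\<forall>i\<in>(UNIV :: unit set). moment G p x' = (if i = () then 1 else 0)) \<and> x' c = 0"
      if e: "e \<in> edges G" for e
    proof -
      have "c \<notin> slope_coords G e" using u(1) by (auto simp: slope_coords_def)
      from moment_anchor_avoiding[OF e this] show ?thesis by auto
    qed
    have "(\<Sum>e\<in>R. y e c *\<^sub>R x () e) \<in> span (\<Union>e\<in>R. kernel e)"
    proof (rule relation_perturbed[OF R])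
      fix \<delta> :: real assume "\<delta> > 0"
      let ?K = "\<lambda>R \<epsilon>. \<Union>e\<in>R. kernel_perturbed () c s \<epsilon> e"
      have "\<exists>\<epsilon>. \<epsilon> \<noteq> 0 \<and> \<bar>\<epsilon>\<bar> < \<delta> \<and> dim (?K R \<epsilon>) \<le> dim (?K R 0)"
      proof (rule stable_of_stable_sum[of "Pow (edges G)"])
        fix S v assume S: "S \<in> Pow (edges G)" "v \<in> ?K S 0"
        show "liftable (?K S) v"
        proof (rule perturbed_liftable[OF _ _ _ S(2)])
          show "S \<subseteq> edges G" using S(1) by simp
        qed (use anchor S(1) in blast)+
      next
        fix \<delta> :: real assume "\<delta> > 0"
        then obtain \<epsilon> where \<epsilon>: "\<epsilon> \<noteq> 0" "\<bar>\<epsilon>\<bar> < \<delta>" "generic G (perturb d \<epsilon> p)"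
          using generic_perturb[OF point_line_graph generic d(1)] by blast
        have "balanced_rank_sum G (perturb d \<epsilon> p) = balanced_rank_sum G p"
          by (simp add: balanced_rank_sum_def balanced_def resultant)
        from max_equilibrium[OF \<epsilon>(3) this] \<epsilon>(1,2)
        show "\<exists>\<epsilon>. \<epsilon> \<noteq> 0 \<and> \<bar>\<epsilon>\<bar> < \<delta> \<and> (\<Sum>S\<in>Pow (edges G). dim (?K S \<epsilon>)) \<le> (\<Sum>S\<in>Pow (edges G). dim (?K S 0))"
          unfolding equilibrium_rank_sum_def perturbed kernel_perturbed_0 kernel by blast
      qed (use \<open>\<delta> > 0\<close> R finite_edges fin_dim_kernel_perturbed in auto)
      then show "\<exists>\<epsilon>. \<epsilon> \<noteq> 0 \<and> \<bar>\<epsilon>\<bar> < \<delta> \<and> dim (?K R \<epsilon>) \<le> dim (\<Union>e\<in>R. kernel e)"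
        unfolding kernel_perturbed_0 .
    qed (use y kernel anchor R \<open>s \<noteq> 0\<close> in auto)
    then show ?thesis by (simp add: kernel)
  qed
qed

lemma equilibrium_partition:
  assumes "S \<subseteq> edges G"
  shows "\<exists>P. partition_on S P \<and>
    (\<Sum>R\<in>P. int (nu_L G R) + int (dim (\<Union>e\<in>R. balanced G p e)) - 1) \<le> int (dim (\<Union>e\<in>S. equilibrium G p e))"
proof -
  obtain x where x: "truncation (edges G) (forces G p) (UNIV :: unit set) (\<lambda>_. moment G p) x"
    using moment_truncation by blast
  interpret truncation "edges G" "forces G p" "UNIV :: unit set" "\<lambda>_. moment G p" x by (rule x)
  have kernel: "kernel e = equilibrium G p e" for e by (simp add: kernel_def equilibrium_def)
  have "\<exists>P. partition_on S P \<and>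
    (\<Sum>R\<in>P. int (dim (\<Union>e\<in>R. forces G p e)) - int (card (UNIV :: unit set))) \<le> int (dim (\<Union>e\<in>S. kernel e))"
    by (rule truncation_partition_dims[OF _ assms]) (unfold kernel, rule moment_relation[OF x])
  then obtain P where P: "partition_on S P"
    "(\<Sum>R\<in>P. int (dim (\<Union>e\<in>R. forces G p e)) - 1) \<le> int (dim (\<Union>e\<in>S. equilibrium G p e))"
    unfolding kernel by auto
  have "dim (\<Union>e\<in>R. forces G p e) = nu_L G R + dim (\<Union>e\<in>R. balanced G p e)" if "R \<in> P" for R
    by (rule dim_forces) (use that P(1) assms in \<open>auto simp: partition_on_def\<close>)
  then show ?thesis using P by (intro exI[of _ P]) simp
qed

end

section \<open>The rank as the dimension of the row space\<close>

lemma (in point_line) rows_independent_card_le: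
  assumes "generic G p" "S \<subseteq> F" "F \<subseteq> edges G" "rows_independent G p S"
  shows "card S \<le> dim (rigidity_matrix G p ` F)"
proof -
  have finS: "finite S" using assms(2,3) finite_subset_edges by blast
  have "\<forall>e\<in>S. a e = 0" if "(\<Sum>e\<in>S. a e *\<^sub>R rigidity_matrix G p e) = 0" for a
  proof -
    have "(\<Sum>e\<in>S. a e * rigidity_matrix G p e d) = 0" for d
      using fun_cong[OF that, of d] by (simp add: sum_fun_apply)
    then show ?thesis using assms(4) by (auto simp: rows_independent_def)
  qed
  then have "inj_on (rigidity_matrix G p) S" "independent (rigidity_matrix G p ` S)"
    using independent_family[OF finS] by blast+
  moreover have "rigidity_matrix G p ` S \<subseteq> span (rigidity_matrix G p ` F)"
    using assms(2) span_superset by blast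
  ultimately have "card (rigidity_matrix G p ` S) \<le> dim (rigidity_matrix G p ` F)"
    using finite_subset_edges[OF assms(3)] by (intro independent_card_le_dim_span) auto
  then show ?thesis using \<open>inj_on _ S\<close> by (simp add: card_image)
qed

lemma rigidity_matrix_outside: "d \<notin> columns G \<Longrightarrow> rigidity_matrix G p e d = 0"
  by (cases d) (auto simp: columns_def)

lemma (in point_line) rows_independent_exists:
  assumes "F \<subseteq> edges G"
  obtains S where "S \<subseteq> F" "rows_independent G p S" "card S = dim (rigidity_matrix G p ` F)"
proof -
  obtain Z where Z: "Z \<subseteq> rigidity_matrix G p ` F" "finite Z" "independent Z" "card Z = dim (rigidity_matrix G p ` F)"
    using fin_dim_basis[of "rigidity_matrix G p ` F"] finite_subset_edges[OF assms] by (metis fin_dim_finite finite_imageI)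
  obtain S where S: "S \<subseteq> F" "inj_on (rigidity_matrix G p) S" "Z = rigidity_matrix G p ` S"
    using subset_image_inj[of Z "rigidity_matrix G p" F] Z(1) by auto
  have finS: "finite S" using S(1) assms finite_subset_edges by blast
  have "rows_independent G p S"
    unfolding rows_independent_def
  proof (intro allI impI)
    fix a :: "'v set \<Rightarrow> real" assume a: "\<forall>j\<in>columns G. (\<Sum>e\<in>S. a e * rigidity_matrix G p e j) = 0"
    have "(\<Sum>e\<in>S. a e *\<^sub>R rigidity_matrix G p e) d = 0" for d
      using a by (cases "d \<in> columns G") (simp_all add: sum_fun_apply rigidity_matrix_outside)
    then have "(\<Sum>e\<in>S. a e *\<^sub>R rigidity_matrix G p e) = 0" by (simp add: fun_eq_iff)
    moreover define b where "b = a \<circ> inv_into S (rigidity_matrix G p)"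
    ultimately have "(\<Sum>v\<in>Z. b v *\<^sub>R v) = 0"
      unfolding S(3) by (simp add: sum.reindex[OF S(2)] S(2))
    then have "\<forall>v\<in>Z. b v = 0" using independentD[OF Z(3,2) subset_refl] by blast
    then show "\<forall>e\<in>S. a e = 0" using S(2,3) by (auto simp: b_def)
  qed
  then show ?thesis using that S Z(4) by (simp add: card_image)
qed

lemma (in point_line) PL_rank_ge:
  assumes "F \<subseteq> edges G" "generic G p"
  shows "dim (rigidity_matrix G p ` F) \<le> PL_rank G F"
proof -
  have fin: "finite (card ` {S. S \<subseteq> F \<and> PL_independent G S})"
    using finite_subset_edges[OF assms(1)] by simp
  obtain S where "S \<subseteq> F" "rows_independent G p S" "card S = dim (rigidity_matrix G p ` F)"
    using rows_independent_exists[OF assms(1)] by blast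
  then have "dim (rigidity_matrix G p ` F) \<in> card ` {S. S \<subseteq> F \<and> PL_independent G S}"
    using assms by (force simp: PL_independent_def intro!: image_eqI[of _ card S])
  then show ?thesis unfolding PL_rank_def using fin by (rule Max_ge[rotated])
qed

lemma (in point_line) PL_rank_le:
  assumes "F \<subseteq> edges G"
  obtains p where "generic G p" "PL_rank G F \<le> dim (rigidity_matrix G p ` F)"
proof -
  let ?I = "card ` {S. S \<subseteq> F \<and> PL_independent G S}"
  have fin: "finite ?I" using finite_subset_edges[OF assms] by simp
  obtain q where "generic G q" using generic_exists[OF point_line_graph] by blast
  then have "PL_independent G {}" by (auto simp: PL_independent_def rows_independent_def)
  then have "?I \<noteq> {}" by blast
  then have "PL_rank G F \<in> ?I" unfolding PL_rank_def using fin Max_in by blast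
  then obtain S p where "S \<subseteq> F" "generic G p" "rows_independent G p S" "PL_rank G F = card S"
    by (auto simp: PL_independent_def)
  then show ?thesis using rows_independent_card_le[of p S F] assms that by auto
qed

section \<open>Merging parts that share line-vertices\<close>

text \<open>Adjacent members of \<open>\<F>\<close> lie in the same part of \<open>P\<close>, so each component of \<open>\<F>\<close> lies in one part,
  and every part contains some component.\<close>

lemma disjoint_lines_card_le_c_L:
  assumes F: "partition_on E \<F>" "finite \<F>" and P: "partition_on E P"
    and refines: "\<And>C. C \<in> \<F> \<Longrightarrow> \<exists>R\<in>P. C \<subseteq> R"
    and disjoint: "\<And>R R'. R \<in> P \<Longrightarrow> R' \<in> P \<Longrightarrow> R \<noteq> R' \<Longrightarrow> lines_of G R \<inter> lines_of G R' = {}"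
  shows "card P \<le> c_L G \<F>"
proof -
  let ?r = "(line_adjacent G \<F>)\<^sup>* \<inter> \<F> \<times> \<F>"
  obtain g where g: "\<And>C. C \<in> \<F> \<Longrightarrow> g C \<in> P \<and> C \<subseteq> g C" using refines by metis
  have step: "g C = g D" if "(C, D) \<in> line_adjacent G \<F>" for C D
  proof (rule ccontr)
    assume "g C \<noteq> g D"
    then have "lines_of G (g C) \<inter> lines_of G (g D) = {}"
      using that g by (intro disjoint) (auto simp: line_adjacent_def)
    moreover have "lines_of G C \<subseteq> lines_of G (g C)" "lines_of G D \<subseteq> lines_of G (g D)"
      using that g[of C] g[of D] by (auto simp: line_adjacent_def lines_of_def)
    ultimately show False using that by (auto simp: line_adjacent_def)
  qed
  have const: "g C = g D" if "(C, D) \<in> ?r" for C D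
  proof -
    have "(C, D) \<in> (line_adjacent G \<F>)\<^sup>*" using that by blast
    then show ?thesis by (induction rule: rtrancl_induct) (auto dest: step)
  qed
  have "P \<subseteq> (\<lambda>K. g (SOME C. C \<in> K)) ` (\<F> // ?r)"
  proof
    fix R assume R: "R \<in> P"
    then have "R \<noteq> {}" using P by (auto simp: partition_on_def)
    then obtain e where e: "e \<in> R" by blast
    then have "e \<in> E" using R P by (auto simp: partition_on_def)
    then obtain C where C: "C \<in> \<F>" "e \<in> C" using F(1) by (auto simp: partition_on_def)
    have "g C = R"
    proof (rule ccontr)
      assume "g C \<noteq> R"
      then have "g C \<inter> R = {}" using g[OF C(1)] R P by (auto simp: partition_on_def disjoint_def)
      then show False using g[OF C(1)] C(2) e by blast
    qed
    let ?K = "?r `` {C}"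
    have "C \<in> ?K" using C by auto
    then have "(SOME D. D \<in> ?K) \<in> ?K" by (rule someI)
    then have "g (SOME D. D \<in> ?K) = R" using const \<open>g C = R\<close> by blast
    moreover have "?K \<in> \<F> // ?r" using C(1) by (rule quotientI)
    ultimately show "R \<in> (\<lambda>K. g (SOME C. C \<in> K)) ` (\<F> // ?r)"
      by (intro image_eqI[of _ _ ?K]) auto
  qed
  moreover have "finite (\<F> // ?r)" using F(2) by (intro finite_quotient) auto
  ultimately have "card P \<le> card ((\<lambda>K. g (SOME C. C \<in> K)) ` (\<F> // ?r))" by (intro card_mono) auto
  also have "\<dots> \<le> card (\<F> // ?r)" by (rule card_image_le) fact
  finally show ?thesis by (simp add: c_L_def)
qed

text \<open>Merging two parts that share \<open>k \<ge> 1\<close> line-vertices lowers the number of parts by one and changes the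
  sum by \<open>1 - k\<close>.\<close>

lemma merge_parts:
  assumes "finite (lines G)" "finite E" "partition_on E P"
  shows "\<exists>P'. partition_on E P' \<and> (\<forall>R\<in>P. \<exists>R'\<in>P'. R \<subseteq> R') \<and>
    (\<forall>R\<in>P'. \<forall>R'\<in>P'. R \<noteq> R' \<longrightarrow> lines_of G R \<inter> lines_of G R' = {}) \<and>
    (\<Sum>R\<in>P'. int (nu_L G R) - 1) \<le> (\<Sum>R\<in>P. int (nu_L G R) - 1)"
  using assms(3)
proof (induction "card P" arbitrary: P rule: less_induct)
  case less
  have finP: "finite P" using less.prems assms(2) finite_elements by blast
  show ?case
  proof (cases "\<forall>R\<in>P. \<forall>R'\<in>P. R \<noteq> R' \<longrightarrow> lines_of G R \<inter> lines_of G R' = {}")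
    case True
    then show ?thesis using less.prems by (intro exI[of _ P]) auto
  next
    case False
    then obtain R R' where R: "R \<in> P" "R' \<in> P" "R \<noteq> R'" "lines_of G R \<inter> lines_of G R' \<noteq> {}" by blast
    define Q where "Q = P - {R, R'}"
    have PQ: "P = insert R (insert R' Q)" "R \<notin> insert R' Q" "R' \<notin> Q" "finite Q"
      using R(1-3) finP by (auto simp: Q_def)
    define P1 where "P1 = insert (R \<union> R') Q"
    have ne: "R \<noteq> {}" "R' \<noteq> {}" using R(1,2) less.prems by (auto simp: partition_on_def)
    have disj: "D \<inter> D' = {}" if "D \<in> P" "D' \<in> P" "D \<noteq> D'" for D D'
      using less.prems that by (auto simp: partition_on_def disjoint_def)
    have new: "R \<union> R' \<notin> Q"
      using disj[OF R(1)] ne(1) by (auto simp: Q_def)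
    have "partition_on E P1"
    proof (rule partition_onI)
      show "\<Union>P1 = E" using less.prems R(1,2) by (auto simp: P1_def Q_def partition_on_def)
      show "{} \<notin> P1"
        using ne less.prems by (auto simp: P1_def Q_def partition_on_def)
      show "disjnt D D'" if "D \<in> P1" "D' \<in> P1" "D \<noteq> D'" for D D'
        using that disj R(1,2) by (auto simp: P1_def Q_def disjnt_def)
    qed
    moreover have cardP: "card P = card Q + 2"
      unfolding PQ(1) using PQ(2-4) by simp
    moreover have "card P1 = card Q + 1" using PQ(4) new by (simp add: P1_def)
    ultimately obtain P' where P': "partition_on E P'" "\<forall>R\<in>P1. \<exists>R'\<in>P'. R \<subseteq> R'"
      "\<forall>R\<in>P'. \<forall>R'\<in>P'. R \<noteq> R' \<longrightarrow> lines_of G R \<inter> lines_of G R' = {}"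
      "(\<Sum>R\<in>P'. int (nu_L G R) - 1) \<le> (\<Sum>R\<in>P1. int (nu_L G R) - 1)"
      using less.hyps[of P1] by auto
    have fin: "finite (lines_of G D)" for D using assms(1) by (simp add: lines_of_def)
    have "lines_of G (R \<union> R') = lines_of G R \<union> lines_of G R'" by (auto simp: lines_of_def)
    then have "nu_L G (R \<union> R') + card (lines_of G R \<inter> lines_of G R') = nu_L G R + nu_L G R'"
      using card_Un_Int[OF fin fin, of R R'] by (simp add: nu_L_def)
    moreover have "card (lines_of G R \<inter> lines_of G R') \<ge> 1"
      using R(4) fin by (metis card_gt_0_iff finite_Int less_eq_Suc_le One_nat_def)
    ultimately have "int (nu_L G (R \<union> R')) - 1 \<le> (int (nu_L G R) - 1) + (int (nu_L G R') - 1)" by linarith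
    moreover have "(\<Sum>R\<in>P. int (nu_L G R) - 1) = (int (nu_L G R) - 1) + ((int (nu_L G R') - 1) + (\<Sum>R\<in>Q. int (nu_L G R) - 1))"
      unfolding PQ(1) using PQ(2-4) by simp
    moreover have "(\<Sum>R\<in>P1. int (nu_L G R) - 1) = (int (nu_L G (R \<union> R')) - 1) + (\<Sum>R\<in>Q. int (nu_L G R) - 1)"
      unfolding P1_def using PQ(4) new by simp
    ultimately have "(\<Sum>R\<in>P'. int (nu_L G R) - 1) \<le> (\<Sum>R\<in>P. int (nu_L G R) - 1)"
      using P'(4) by linarith
    moreover have "\<forall>D\<in>P. \<exists>D'\<in>P'. D \<subseteq> D'"
    proof
      fix D assume "D \<in> P"
      then have "\<exists>D1\<in>P1. D \<subseteq> D1" by (auto simp: P1_def Q_def)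
      then show "\<exists>D'\<in>P'. D \<subseteq> D'" using P'(2) by (meson subset_trans)
    qed
    ultimately show ?thesis using P' by blast
  qed
qed

lemma nu_L_partition:
  assumes "finite (lines G)" "finite P" "\<Union>P = E"
    and "\<And>R R'. R \<in> P \<Longrightarrow> R' \<in> P \<Longrightarrow> R \<noteq> R' \<Longrightarrow> lines_of G R \<inter> lines_of G R' = {}"
  shows "nu_L G E = (\<Sum>R\<in>P. nu_L G R)"
proof -
  have "lines_of G E = (\<Union>R\<in>P. lines_of G R)" using assms(3) by (auto simp: lines_of_def)
  moreover have "card (\<Union>R\<in>P. lines_of G R) = (\<Sum>R\<in>P. card (lines_of G R))"
    using assms by (intro card_UN_disjoint) (auto simp: lines_of_def)
  ultimately show ?thesis by (simp add: nu_L_def)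
qed

section \<open>The rank formula\<close>

context point_line
begin

text \<open>Group the members of \<open>\<F>\<close> by components. The rows of the edges in one component are bounded by the second
  truncation, and the balanced loads of each member by the first one. Distinct components have disjoint sets of
  line-vertices, so that their numbers of line-vertices add up to \<open>\<nu>\<^sub>L E\<close>.\<close>

lemma rank_le:
  assumes E: "E \<subseteq> edges G" and F: "partition_on E \<F>"
  shows "int (PL_rank G E) \<le> int (nu_L G E) +
    ((\<Sum>C\<in>\<F>. 2 * int (nu_P G C) + int (nu_L G C) - 2) - int (c_L G \<F>))"
proof -
  obtain p where p: "generic G p" "PL_rank G E \<le> dim (rigidity_matrix G p ` E)"
    using PL_rank_le[OF E] by blast
  interpret generic_framework G p by unfold_locales (rule p(1))
  let ?r = "(line_adjacent G \<F>)\<^sup>* \<inter> \<F> \<times> \<F>"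
  let ?w = "\<lambda>C. 2 * int (nu_P G C) + int (nu_L G C) - 2"
  have finF: "finite \<F>" using F finite_subset_edges[OF E] finite_elements by blast
  have "sym (line_adjacent G \<F>)" by (auto simp: sym_def line_adjacent_def)
  then have sym: "sym ((line_adjacent G \<F>)\<^sup>*)" by (rule sym_rtrancl)
  have eq: "equiv \<F> ?r"
  proof (rule equivI)
    show "sym ?r" using sym by (auto simp: sym_def)
  qed (auto simp: refl_on_def intro!: transI)
  have part: "partition_on \<F> (\<F> // ?r)" by (rule partition_on_quotient[OF eq])
  have finQ: "finite (\<F> // ?r)" using finF by (intro finite_quotient) auto
  have cls: "K \<subseteq> \<F>" "finite K" "\<Union>K \<subseteq> E" "\<Union>K \<subseteq> edges G" "K \<noteq> {}" "\<Union>K \<noteq> {}" if "K \<in> \<F> // ?r" for K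
  proof -
    show 1: "K \<subseteq> \<F>" "K \<noteq> {}" using that part by (auto simp: partition_on_def)
    then show "finite K" using finF finite_subset by blast
    show "\<Union>K \<subseteq> E" using 1 F by (auto simp: partition_on_def)
    obtain C where "C \<in> K" "C \<in> \<F>" using 1 by blast
    moreover from this have "C \<noteq> {}" using F by (auto simp: partition_on_def)
    ultimately show "\<Union>K \<noteq> {}" by blast
    show "\<Union>K \<subseteq> edges G" using 1 F E by (auto simp: partition_on_def)
  qed
  have comp: "int (dim (\<Union>e\<in>\<Union>K. equilibrium G p e)) \<le> int (nu_L G (\<Union>K)) - 1 + (\<Sum>C\<in>K. ?w C)"
    if K: "K \<in> \<F> // ?r" for K
  proof -
    have "dim (\<Union>e\<in>\<Union>K. balanced G p e) = dim (\<Union>C\<in>K. \<Union>e\<in>C. balanced G p e)"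
      by (rule arg_cong[where f=dim]) blast
    also have "\<dots> \<le> (\<Sum>C\<in>K. dim (\<Union>e\<in>C. balanced G p e))"
      using cls(2)[OF K] fin_dim_balanced[OF subset_trans[OF Union_upper cls(4)[OF K]]]
      by (rule dim_UN_le)
    finally have "int (dim (\<Union>e\<in>\<Union>K. balanced G p e)) \<le> (\<Sum>C\<in>K. int (dim (\<Union>e\<in>C. balanced G p e)))"
      by (simp flip: of_nat_sum)
    also have "\<dots> \<le> (\<Sum>C\<in>K. ?w C)"
    proof (rule sum_mono)
      fix C assume "C \<in> K"
      then have "C \<subseteq> edges G" "C \<noteq> {}" using cls[OF K] F by (auto simp: partition_on_def)
      from dim_balanced_le[OF this] show "int (dim (\<Union>e\<in>C. balanced G p e)) \<le> ?w C" by linarith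
    qed
    finally show ?thesis using dim_equilibrium_le[OF cls(4,6)[OF K]] by linarith
  qed
  have "dim (rigidity_matrix G p ` E) = dim (\<Union>e\<in>E. equilibrium G p e)"
    by (rule span_eq_dim[OF span_rows[OF E]])
  also have "(\<Union>e\<in>E. equilibrium G p e) = (\<Union>K\<in>\<F> // ?r. \<Union>e\<in>\<Union>K. equilibrium G p e)"
  proof -
    have "E = (\<Union>K\<in>\<F> // ?r. \<Union>K)" using part F by (auto simp: partition_on_def)
    then show ?thesis by blast
  qed
  also have "dim \<dots> \<le> (\<Sum>K\<in>\<F> // ?r. dim (\<Union>e\<in>\<Union>K. equilibrium G p e))"
    using finQ by (rule dim_UN_le) (rule fin_dim_equilibrium[OF cls(4)])
  finally have "int (PL_rank G E) \<le> (\<Sum>K\<in>\<F> // ?r. int (dim (\<Union>e\<in>\<Union>K. equilibrium G p e)))"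
    using p(2) by (simp flip: of_nat_sum)
  also have "\<dots> \<le> (\<Sum>K\<in>\<F> // ?r. int (nu_L G (\<Union>K)) - 1 + (\<Sum>C\<in>K. ?w C))"
    by (intro sum_mono comp)
  also have "\<dots> = (\<Sum>K\<in>\<F> // ?r. int (nu_L G (\<Union>K))) - int (c_L G \<F>) + (\<Sum>K\<in>\<F> // ?r. \<Sum>C\<in>K. ?w C)"
    by (simp add: sum.distrib sum_subtractf c_L_def)
  also have "(\<Sum>K\<in>\<F> // ?r. \<Sum>C\<in>K. ?w C) = (\<Sum>C\<in>\<F>. ?w C)"
  proof -
    have "\<Union>(\<F> // ?r) = \<F>" using part by (simp add: partition_on_def)
    then have "(\<Sum>C\<in>\<F>. ?w C) = (\<Sum>C\<in>\<Union>(\<F> // ?r). ?w C)" by simp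
    also have "\<dots> = (sum \<circ> sum) ?w (\<F> // ?r)"
      by (rule sum.Union_disjoint) (use cls(2) part in \<open>auto simp: partition_on_def disjoint_def\<close>)
    finally show ?thesis by simp
  qed
  also have "(\<Sum>K\<in>\<F> // ?r. int (nu_L G (\<Union>K))) = int (nu_L G E)"
  proof -
    have disj: "lines_of G (\<Union>K) \<inter> lines_of G (\<Union>K') = {}"
      if K: "K \<in> \<F> // ?r" "K' \<in> \<F> // ?r" "K \<noteq> K'" for K K'
    proof (rule ccontr)
      assume "\<not> ?thesis"
      then obtain C C' where C: "C \<in> K" "C' \<in> K'" "lines_of G C \<inter> lines_of G C' \<noteq> {}"
        by (fastforce simp: lines_of_def)
      then have F': "C \<in> \<F>" "C' \<in> \<F>" using cls K by blast+
      then have "(C, C') \<in> ?r" using C(3) by (cases "C = C'") (auto simp: line_adjacent_def)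
      then have "K = K'" using quotient_eqI[OF eq K(1,2) C(1,2)] by blast
      then show False using K(3) by blast
    qed
    have "int (nu_L G E) = int (\<Sum>R\<in>Union ` (\<F> // ?r). nu_L G R)"
    proof (intro arg_cong[where f=int] nu_L_partition)
      show "\<Union>(Union ` (\<F> // ?r)) = E" using part F by (auto simp: partition_on_def)
    qed (use finQ finite_lines disj in auto)
    also have "(\<Sum>R\<in>Union ` (\<F> // ?r). nu_L G R) = (\<Sum>K\<in>\<F> // ?r. nu_L G (\<Union>K))"
    proof (rule sum.reindex_nontrivial[OF finQ, simplified comp_def])
      fix K K' assume K: "K \<in> \<F> // ?r" "K' \<in> \<F> // ?r" "K \<noteq> K'" "\<Union>K = \<Union>K'"
      then show "nu_L G (\<Union>K) = 0" using disj[OF K(1-3)] by (simp add: nu_L_def)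
    qed
    finally show ?thesis by simp
  qed
  finally show ?thesis by linarith
qed

text \<open>The partition \<open>\<F>\<close> refines the partition \<open>P\<close> of the second truncation: it consists of the partitions
  that the first truncation provides for the parts of \<open>P\<close>. Merging the parts of \<open>P\<close> until they have disjoint
  sets of line-vertices leaves at most \<open>c_L G \<F>\<close> parts.\<close>

lemma rank_ge:
  assumes E: "E \<subseteq> edges G"
  shows "\<exists>\<F>. partition_on E \<F> \<and> int (nu_L G E) +
    ((\<Sum>C\<in>\<F>. 2 * int (nu_P G C) + int (nu_L G C) - 2) - int (c_L G \<F>)) \<le> int (PL_rank G E)"
proof -
  obtain p where "extremal_framework G p" using extremal_framework_exists by blast
  then interpret extremal_framework G p .
  let ?w = "\<lambda>C. 2 * int (nu_P G C) + int (nu_L G C) - 2"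
  obtain P where P: "partition_on E P"
    "(\<Sum>R\<in>P. int (nu_L G R) + int (dim (\<Union>e\<in>R. balanced G p e)) - 1) \<le> int (dim (\<Union>e\<in>E. equilibrium G p e))"
    using equilibrium_partition[OF E] by blast
  have finE: "finite E" using finite_subset_edges[OF E] .
  have finP: "finite P" using P(1) finE finite_elements by blast
  have sub: "R \<subseteq> edges G" "finite R" if "R \<in> P" for R
    using that P(1) E finE by (auto simp: partition_on_def intro: finite_subset)
  have "\<forall>R\<in>P. \<exists>Q. partition_on R Q \<and> (\<Sum>C\<in>Q. ?w C) \<le> int (dim (\<Union>e\<in>R. balanced G p e))"
    using balanced_partition sub by blast
  from bchoice[OF this] obtain Q where Q: "\<And>R. R \<in> P \<Longrightarrow> partition_on R (Q R)"
    "\<And>R. R \<in> P \<Longrightarrow> (\<Sum>C\<in>Q R. ?w C) \<le> int (dim (\<Union>e\<in>R. balanced G p e))" by blast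
  define \<F> where "\<F> = (\<Union>R\<in>P. Q R)"
  have disjP: "R \<inter> R' = {}" if "R \<in> P" "R' \<in> P" "R \<noteq> R'" for R R'
    using P(1) that by (auto simp: partition_on_def disjoint_def)
  have QC: "C \<subseteq> R" "C \<noteq> {}" if "R \<in> P" "C \<in> Q R" for R C
    using Q(1)[OF that(1)] that(2) by (auto simp: partition_on_def)
  have F: "partition_on E \<F>"
  proof (rule partition_onI)
    show "\<Union>\<F> = E" using Q(1) P(1) by (fastforce simp: \<F>_def partition_on_def)
    show "{} \<notin> \<F>" using QC(2) by (auto simp: \<F>_def)
    show "disjnt C D" if CD: "C \<in> \<F>" "D \<in> \<F>" "C \<noteq> D" for C D
    proof -
      obtain R S where RS: "R \<in> P" "C \<in> Q R" "S \<in> P" "D \<in> Q S" using CD by (auto simp: \<F>_def)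
      show ?thesis
      proof (cases "R = S")
        case True
        then show ?thesis using Q(1)[OF RS(1)] RS CD(3) by (auto simp: partition_on_def disjoint_def disjnt_def)
      next
        case False
        then show ?thesis using disjP[OF RS(1,3)] QC[OF RS(1,2)] QC[OF RS(3,4)] by (auto simp: disjnt_def)
      qed
    qed
  qed
  have finF: "finite \<F>" using F finE finite_elements by blast
  have sumF: "(\<Sum>C\<in>\<F>. ?w C) = (\<Sum>R\<in>P. \<Sum>C\<in>Q R. ?w C)"
    unfolding \<F>_def
  proof (rule sum.UNION_disjoint[OF finP])
    show "\<forall>R\<in>P. finite (Q R)" using Q(1) sub(2) finite_elements by blast
    show "\<forall>R\<in>P. \<forall>S\<in>P. R \<noteq> S \<longrightarrow> Q R \<inter> Q S = {}"
    proof (intro ballI impI, rule ccontr)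
      fix R S assume RS: "R \<in> P" "S \<in> P" "R \<noteq> S" "Q R \<inter> Q S \<noteq> {}"
      then obtain C where "C \<in> Q R" "C \<in> Q S" by blast
      then have "C \<subseteq> R \<inter> S" "C \<noteq> {}" using QC RS(1,2) by blast+
      then show False using disjP[OF RS(1-3)] by blast
    qed
  qed
  obtain P' where P': "partition_on E P'" "\<forall>R\<in>P. \<exists>R'\<in>P'. R \<subseteq> R'"
    "\<forall>R\<in>P'. \<forall>R'\<in>P'. R \<noteq> R' \<longrightarrow> lines_of G R \<inter> lines_of G R' = {}"
    "(\<Sum>R\<in>P'. int (nu_L G R) - 1) \<le> (\<Sum>R\<in>P. int (nu_L G R) - 1)"
    using merge_parts[OF finite_lines finE P(1)] by blast
  have finP': "finite P'" using P'(1) finE finite_elements by blast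
  have "card P' \<le> c_L G \<F>"
  proof (rule disjoint_lines_card_le_c_L[OF F finF P'(1)])
    show "\<exists>R\<in>P'. C \<subseteq> R" if C: "C \<in> \<F>" for C
    proof -
      obtain R where R: "R \<in> P" "C \<in> Q R" using C by (auto simp: \<F>_def)
      then obtain R' where "R' \<in> P'" "R \<subseteq> R'" using P'(2) by blast
      then show ?thesis using QC(1)[OF R] by blast
    qed
  qed (use P'(3) in blast)
  moreover have "nu_L G E = (\<Sum>R\<in>P'. nu_L G R)"
    using P'(1,3) finite_lines finP' by (intro nu_L_partition) (auto simp: partition_on_def)
  ultimately have "int (nu_L G E) - int (c_L G \<F>) \<le> (\<Sum>R\<in>P'. int (nu_L G R) - 1)"
    by (simp add: sum_subtractf)
  also have "\<dots> \<le> (\<Sum>R\<in>P. int (nu_L G R) - 1)" by (rule P'(4))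
  finally have "int (nu_L G E) + ((\<Sum>C\<in>\<F>. ?w C) - int (c_L G \<F>))
      \<le> (\<Sum>R\<in>P. int (nu_L G R) - 1) + (\<Sum>R\<in>P. \<Sum>C\<in>Q R. ?w C)"
    unfolding sumF by simp
  also have "\<dots> = (\<Sum>R\<in>P. int (nu_L G R) - 1 + (\<Sum>C\<in>Q R. ?w C))" by (simp add: sum.distrib)
  also have "\<dots> \<le> (\<Sum>R\<in>P. int (nu_L G R) + int (dim (\<Union>e\<in>R. balanced G p e)) - 1)"
    using Q(2) by (intro sum_mono) fastforce
  also have "\<dots> \<le> int (dim (rigidity_matrix G p ` E))"
    using P(2) span_eq_dim[OF span_rows[OF E]] by simp
  also have "\<dots> \<le> int (PL_rank G E)"
    using PL_rank_ge[OF E generic] by simp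
  finally show ?thesis using F by blast
qed

end

theorem theorem4p9:
  fixes G :: "'v point_line_graph" and A :: "'v set set"
  assumes "is_point_line_graph G" and "A \<subseteq> edges G"
  shows "int (PL_rank G A) =
    int (nu_L G A) +
    Min {(\<Sum>C\<in>\<F>. 2 * int (nu_P G C) + int (nu_L G C) - 2) - int (c_L G \<F>) | \<F>. partition_on A \<F>}"
proof -
  interpret point_line G by unfold_locales (rule assms(1))
  let ?val = "\<lambda>\<F>. (\<Sum>C\<in>\<F>. 2 * int (nu_P G C) + int (nu_L G C) - 2) - int (c_L G \<F>)"
  have "Min {?val \<F> | \<F>. partition_on A \<F>} = int (PL_rank G A) - int (nu_L G A)"
  proof (rule Min_eqI)
    have "{?val \<F> | \<F>. partition_on A \<F>} \<subseteq> ?val ` Pow (Pow A)" by (auto simp: partition_on_def)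
    from finite_subset[OF this] show "finite {?val \<F> | \<F>. partition_on A \<F>}"
      using finite_subset_edges[OF assms(2)] by simp
    fix z assume "z \<in> {?val \<F> | \<F>. partition_on A \<F>}"
    then show "int (PL_rank G A) - int (nu_L G A) \<le> z" using rank_le[OF assms(2)] by force
  next
    obtain \<F> where "partition_on A \<F>" "int (nu_L G A) + ?val \<F> \<le> int (PL_rank G A)"
      using rank_ge[OF assms(2)] by blast
    moreover from this have "int (PL_rank G A) - int (nu_L G A) = ?val \<F>"
      using rank_le[OF assms(2), of \<F>] by linarith
    ultimately show "int (PL_rank G A) - int (nu_L G A) \<in> {?val \<F> | \<F>. partition_on A \<F>}" by blast
  qed
  then show ?thesis by simp
qed

end
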